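(* Let $f:\mathcal{X}\times\mathcal{Y}\to\mathcal{Z}$ be a function (with $\mathcal{X},\mathcal{Y}$ finite), let $n,t\geq 1$ be integers and $\delta>0$ real. (Classical) Suppose the communication game $f^{(n),A}$ has a $[t;l_1,l_2,\ldots,l_t]^A$ public coin randomised protocol with error less than $\delta$. Then $f$ has a $[t-1;l_2,\ldots,l_t]^B$ public coin randomised protocol with error less than $$\epsilon := \delta+\frac12\left(\frac{2 l_1\ln 2}{n}\right)^{1/2}.$$ (Quantum) A similar result holds for public coin quantum protocols too. Precisely: suppose the communication game $f^{(n),A}$ has a $[t;c;l_1,\ldots,l_t]^A$ safe public coin quantum protocol with error less than $\delta$. Then $f$ has a $[t-1;c+l_1;l_2,\ldots,l_t]^B$ safe public coin quantum protocol with error less than $$\delta+\frac12\left(\frac{8 l_1\ln 2}{n}\right)^{1/2}.$$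
   Context: All protocols are two-party (Alice and Bob). For a communication problem $f:\mathcal{X}\times\mathcal{Y}\to\mathcal{Z}$, Alice is given $x\in\mathcal{X}$, Bob is given $y\in\mathcal{Y}$, and they must compute $f(x,y)$. In the game $f^{(n),A}$, Alice is given $x_1,\ldots,x_n\in\mathcal{X}$, and Bob is given $y\in\mathcal{Y}$, an index $i\in\{1,\ldots,n\}$ and copies of $x_1,\ldots,x_{i-1}$; they must compute $f(x_i,y)$. The error of a randomised or quantum protocol is the maximum over all inputs of the probability that its output is incorrect. Classical protocols. A $[t;l_1,\ldots,l_t]^A$ (respectively $[t;l_1,\ldots,l_t]^B$) protocol is one in which Alice (respectively Bob) starts, the players alternate sending messages, the $i$th message is $l_i$ bits long, and there are $t$ rounds (messages) in total. The last recipient of a message outputs the answer. A public coin randomised protocol is a probability distribution over finitely many deterministic protocols (of the same type). Quantum protocols. In a coinless quantum protocol, Alice and Bob start with their inputs in computational basis states and with work qubits in a fixed state with no prior entanglement between them; they alternately apply unitary transformations to the qubits in their possession and send qubits to each other. The number and lengths of the messages are independent of the inputs, and no measurement is made during the protocol. At the end, the last recipient of a message measures, in the computational basis, certain qubits in her possession (chosen independently of the inputs) to determine the answer. The protocol is secure if the input qubits are never sent as messages, never measured, and their state remains unchanged throughout. A $[t;c;l_1,\ldots,l_t]^A$ (respectively $[t;c;l_1,\ldots,l_t]^B$) safe quantum protocol is a secure quantum protocol in which Alice (respectively Bob) starts, there are $t$ rounds, the first message is $l_1+c$ qubits long, and the $i$th message, for $i\geq 2$, is $l_i$ qubits long; the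 first message consists of a main part of $l_1$ qubits and a safe overhead of $c$ qubits, and the density matrix of the safe overhead is independent of the inputs to Alice and Bob. A public coin quantum protocol has, before it starts, a shared state $\sum_r\sqrt{p_r}\,|r\rangle_A|r\rangle_B$ (a finite sum with $p_r\geq 0$, $\sum_r p_r=1$, the subscripts denoting ownership by Alice and Bob); each player makes an (entangled) copy of their half using CNOT gates before the protocol commences, and the public coin itself is not touched by the players' unitary transformations, never measured and never sent. It can thus be viewed as a probability distribution $(p_r)$ over finitely many coinless quantum protocols. A safe public coin quantum protocol is, likewise, a probability distribution over finitely many safe coinless quantum protocols (of the same type). In a zero-round protocol (the case $t=1$ of the conclusions) with superscript $B$, no message is sent and Bob outputs the answer. *)

theory Defs
  imports "HOL-Probability.Probability"
begin

section \<open>Communication problems\<close>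

datatype party = Alice | Bob

fun other :: "party \<Rightarrow> party" where
  "other Alice = Bob"
| "other Bob = Alice"

text \<open>Steps are counted from 0, so the \<open>i\<close>th message is sent in step \<open>i - 1\<close>. In a protocol
  with \<open>t\<close> messages, \<open>mover s t\<close> is the last recipient; for \<open>t = 0\<close> it is the starting party.\<close>

definition mover :: "party \<Rightarrow> nat \<Rightarrow> party" where
  "mover s k = (if even k then s else other s)"

text \<open>The pairs in \<open>inputs\<close> are the inputs that can occur. In an n-fold game this is not a product,
  since Bob holds copies of part of Alice's input.\<close>

record ('a, 'b, 'z) game =
  inputs :: "('a \<times> 'b) set"
  answer :: "'a \<Rightarrow> 'b \<Rightarrow> 'z"

definition single_game :: "('x \<Rightarrow> 'y \<Rightarrow> 'z) \<Rightarrow> ('x, 'y, 'z) game" where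
  "single_game f = \<lparr>inputs = UNIV, answer = f\<rparr>"

text \<open>The game $f^{(n),A}$: the list \<open>xs\<close> is $x_1,\ldots,x_n$, so $x_i$ is \<open>xs ! (i - 1)\<close>.\<close>

definition nfold_game ::
    "nat \<Rightarrow> ('x \<Rightarrow> 'y \<Rightarrow> 'z) \<Rightarrow> ('x list, 'y \<times> nat \<times> 'x list, 'z) game" where
  "nfold_game n f =
     \<lparr>inputs = {(xs, (y, i, copies)). length xs = n \<and> i \<in> {1..n} \<and> copies = take (i - 1) xs},
      answer = (\<lambda>xs (y, i, copies). f (xs ! (i - 1)) y)\<rparr>"

section \<open>Classical protocols\<close>

text \<open>The list argument is the transcript so far; a party's own earlier messages are determined by
  its input and the messages it has received.\<close>

record ('a, 'b, 'z) det_protocol =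
  alice_msg :: "'a \<Rightarrow> bool list list \<Rightarrow> bool list"
  bob_msg :: "'b \<Rightarrow> bool list list \<Rightarrow> bool list"
  alice_out :: "'a \<Rightarrow> bool list list \<Rightarrow> 'z"
  bob_out :: "'b \<Rightarrow> bool list list \<Rightarrow> 'z"

primrec transcript ::
    "('a, 'b, 'z) det_protocol \<Rightarrow> party \<Rightarrow> 'a \<Rightarrow> 'b \<Rightarrow> nat \<Rightarrow> bool list list" where
  "transcript P s a b 0 = []"
| "transcript P s a b (Suc k) =
     (let h = transcript P s a b k
      in h @ [case mover s k of Alice \<Rightarrow> alice_msg P a h | Bob \<Rightarrow> bob_msg P b h])"

definition det_output :: "('a, 'b, 'z) det_protocol \<Rightarrow> party \<Rightarrow> nat \<Rightarrow> 'a \<Rightarrow> 'b \<Rightarrow> 'z" where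
  "det_output P s t a b =
     (let h = transcript P s a b t
      in case mover s t of Alice \<Rightarrow> alice_out P a h | Bob \<Rightarrow> bob_out P b h)"

definition is_det_protocol ::
    "('a, 'b, 'z) game \<Rightarrow> party \<Rightarrow> nat \<Rightarrow> nat list \<Rightarrow> ('a, 'b, 'z) det_protocol \<Rightarrow> bool" where
  "is_det_protocol G s t l P \<longleftrightarrow>
     length l = t \<and> (\<forall>(a, b) \<in> inputs G. map length (transcript P s a b t) = l)"

definition is_public_coin_protocol ::
    "('a, 'b, 'z) game \<Rightarrow> party \<Rightarrow> nat \<Rightarrow> nat list \<Rightarrow> ('a, 'b, 'z) det_protocol pmf \<Rightarrow> bool" where
  "is_public_coin_protocol G s t l p \<longleftrightarrow>
     finite (set_pmf p) \<and> (\<forall>P \<in> set_pmf p. is_det_protocol G s t l P)"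

definition public_coin_error ::
    "('a, 'b, 'z) game \<Rightarrow> party \<Rightarrow> nat \<Rightarrow> ('a, 'b, 'z) det_protocol pmf \<Rightarrow> real" where
  "public_coin_error G s t p =
     Max ((\<lambda>(a, b). measure_pmf.prob p {P. det_output P s t a b \<noteq> answer G a b}) ` inputs G)"

section \<open>Systems of qubits\<close>

text \<open>Qubits are labelled by natural numbers. A computational basis state of a finite set \<open>Q\<close> of
  qubits is the subset of \<open>Q\<close> of those qubits that are 1, so a pure state of \<open>Q\<close> is given by its
  amplitudes on \<open>Pow Q\<close>, and an operator on \<open>Q\<close> by its matrix entries \<open>U S T\<close> (row \<open>S\<close>, column \<open>T\<close>)
  for \<open>S, T \<in> Pow Q\<close>. Values outside these index sets are irrelevant.\<close>

type_synonym amplitudes = "nat set \<Rightarrow> complex"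
type_synonym qmatrix = "nat set \<Rightarrow> nat set \<Rightarrow> complex"

definition unit_state :: "nat set \<Rightarrow> amplitudes \<Rightarrow> bool" where
  "unit_state Q \<psi> \<longleftrightarrow> (\<Sum>S\<in>Pow Q. (cmod (\<psi> S))\<^sup>2) = 1"

definition unitary_on :: "nat set \<Rightarrow> qmatrix \<Rightarrow> bool" where
  "unitary_on Q U \<longleftrightarrow>
     (\<forall>S\<in>Pow Q. \<forall>T\<in>Pow Q. (\<Sum>R\<in>Pow Q. cnj (U R S) * U R T) = (if S = T then 1 else 0))"

text \<open>\<open>U\<close> on the qubits in \<open>Q\<close>, tensored with the identity on all other qubits.\<close>

definition apply_on :: "nat set \<Rightarrow> qmatrix \<Rightarrow> amplitudes \<Rightarrow> amplitudes" where
  "apply_on Q U \<psi> = (\<lambda>S. \<Sum>T\<in>Pow Q. U (S \<inter> Q) T * \<psi> ((S - Q) \<union> T))"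

text \<open>The reduced density matrix on \<open>Q\<close> of a pure state of \<open>V \<supseteq> Q\<close>; entries outside \<open>Pow Q\<close> are set
  to 0 so that density matrices can be compared by equality.\<close>

definition density :: "nat set \<Rightarrow> nat set \<Rightarrow> amplitudes \<Rightarrow> qmatrix" where
  "density V Q \<psi> = (\<lambda>S T. if S \<subseteq> Q \<and> T \<subseteq> Q
     then \<Sum>R\<in>Pow (V - Q). \<psi> (S \<union> R) * cnj (\<psi> (T \<union> R)) else 0)"

definition outcome_prob :: "nat set \<Rightarrow> nat set \<Rightarrow> amplitudes \<Rightarrow> nat set \<Rightarrow> real" where
  "outcome_prob V M \<psi> S = (\<Sum>R\<in>Pow (V - M). (cmod (\<psi> (S \<union> R)))\<^sup>2)"

section \<open>Coinless quantum protocols\<close>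

text \<open>\<open>own\<close>: qubits initially held by each party; \<open>inp\<close>: its input qubits, the remaining ones being
  work qubits; \<open>alice_code\<close>, \<open>bob_code\<close>: the basis states of the input qubits that encode the inputs;
  \<open>work\<close>: the fixed initial state of each party's work qubits. In step \<open>k\<close> the party \<open>mover s k\<close>
  applies the unitary \<open>op k\<close> to all qubits it holds and then sends the qubits \<open>msg k\<close>; after the
  last message its recipient applies \<open>op t\<close> and measures \<open>measured\<close>. The qubits \<open>overhead\<close> are the
  safe overhead, a part of \<open>msg 0\<close>.\<close>

record ('a, 'b, 'z) qprotocol =
  own :: "party \<Rightarrow> nat set"
  inp :: "party \<Rightarrow> nat set"
  alice_code :: "'a \<Rightarrow> nat set"
  bob_code :: "'b \<Rightarrow> nat set"
  work :: "party \<Rightarrow> amplitudes"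
  op :: "nat \<Rightarrow> qmatrix"
  msg :: "nat \<Rightarrow> nat set"
  overhead :: "nat set"
  measured :: "nat set"
  decode :: "nat set \<Rightarrow> 'z"

definition all_qubits :: "('a, 'b, 'z) qprotocol \<Rightarrow> nat set" where
  "all_qubits P = own P Alice \<union> own P Bob"

definition input_qubits :: "('a, 'b, 'z) qprotocol \<Rightarrow> nat set" where
  "input_qubits P = inp P Alice \<union> inp P Bob"

primrec held :: "('a, 'b, 'z) qprotocol \<Rightarrow> party \<Rightarrow> nat \<Rightarrow> party \<Rightarrow> nat set" where
  "held P s 0 q = own P q"
| "held P s (Suc k) q =
     (if q = mover s k then held P s k q - msg P k else held P s k q \<union> msg P k)"

definition init_state :: "('a, 'b, 'z) qprotocol \<Rightarrow> 'a \<Rightarrow> 'b \<Rightarrow> amplitudes" where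
  "init_state P a b = (\<lambda>S.
     if S \<inter> inp P Alice = alice_code P a \<and> S \<inter> inp P Bob = bob_code P b
     then work P Alice (S \<inter> (own P Alice - inp P Alice)) * work P Bob (S \<inter> (own P Bob - inp P Bob))
     else 0)"

text \<open>The global state after the first \<open>k\<close> unitaries.\<close>

primrec qstate :: "('a, 'b, 'z) qprotocol \<Rightarrow> party \<Rightarrow> 'a \<Rightarrow> 'b \<Rightarrow> nat \<Rightarrow> amplitudes" where
  "qstate P s a b 0 = init_state P a b"
| "qstate P s a b (Suc k) = apply_on (held P s k (mover s k)) (op P k) (qstate P s a b k)"

definition is_coinless_protocol ::
    "('a, 'b, 'z) game \<Rightarrow> party \<Rightarrow> nat \<Rightarrow> ('a, 'b, 'z) qprotocol \<Rightarrow> bool" where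
  "is_coinless_protocol G s t P \<longleftrightarrow>
     finite (own P Alice) \<and> finite (own P Bob) \<and> own P Alice \<inter> own P Bob = {} \<and>
     inp P Alice \<subseteq> own P Alice \<and> inp P Bob \<subseteq> own P Bob \<and>
     alice_code P ` fst ` inputs G \<subseteq> Pow (inp P Alice) \<and> inj_on (alice_code P) (fst ` inputs G) \<and>
     bob_code P ` snd ` inputs G \<subseteq> Pow (inp P Bob) \<and> inj_on (bob_code P) (snd ` inputs G) \<and>
     unit_state (own P Alice - inp P Alice) (work P Alice) \<and>
     unit_state (own P Bob - inp P Bob) (work P Bob) \<and>
     (\<forall>k\<le>t. unitary_on (held P s k (mover s k)) (op P k)) \<and>
     (\<forall>k<t. msg P k \<subseteq> held P s k (mover s k)) \<and>
     measured P \<subseteq> held P s t (mover s t)"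

text \<open>On an input, the initial density matrix of the input qubits is that of a computational basis
  state.\<close>

definition secure :: "('a, 'b, 'z) game \<Rightarrow> party \<Rightarrow> nat \<Rightarrow> ('a, 'b, 'z) qprotocol \<Rightarrow> bool" where
  "secure G s t P \<longleftrightarrow>
     (\<forall>k<t. msg P k \<inter> input_qubits P = {}) \<and>
     measured P \<inter> input_qubits P = {} \<and>
     (\<forall>(a, b) \<in> inputs G. \<forall>k\<le>Suc t.
        density (all_qubits P) (input_qubits P) (qstate P s a b k) =
        density (all_qubits P) (input_qubits P) (init_state P a b))"

text \<open>A $[t;c;l_1,\ldots,l_t]$ safe coinless protocol started by \<open>s\<close>. The state \<open>qstate P s a b 1\<close> is the
  one in which the first message is sent. For \<open>t = 0\<close> there is no first message, hence no condition
  on the overhead.\<close>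

definition is_safe_protocol ::
    "('a, 'b, 'z) game \<Rightarrow> party \<Rightarrow> nat \<Rightarrow> nat \<Rightarrow> nat list \<Rightarrow> ('a, 'b, 'z) qprotocol \<Rightarrow> bool" where
  "is_safe_protocol G s t c l P \<longleftrightarrow>
     is_coinless_protocol G s t P \<and> secure G s t P \<and> length l = t \<and>
     (\<forall>k<t. card (msg P k) = (if k = 0 then l ! k + c else l ! k)) \<and>
     (0 < t \<longrightarrow>
        overhead P \<subseteq> msg P 0 \<and> card (overhead P) = c \<and>
        (\<forall>(a, b) \<in> inputs G. \<forall>(a', b') \<in> inputs G.
           density (all_qubits P) (overhead P) (qstate P s a b 1) =
           density (all_qubits P) (overhead P) (qstate P s a' b' 1)))"

definition incorrect_prob ::
    "('a, 'b, 'z) game \<Rightarrow> party \<Rightarrow> nat \<Rightarrow> ('a, 'b, 'z) qprotocol \<Rightarrow> 'a \<Rightarrow> 'b \<Rightarrow> real" where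
  "incorrect_prob G s t P a b =
     (\<Sum>S | S \<subseteq> measured P \<and> decode P S \<noteq> answer G a b.
        outcome_prob (all_qubits P) (measured P) (qstate P s a b (Suc t)) S)"

section \<open>Safe public coin quantum protocols\<close>

definition is_safe_public_coin_protocol ::
    "('a, 'b, 'z) game \<Rightarrow> party \<Rightarrow> nat \<Rightarrow> nat \<Rightarrow> nat list \<Rightarrow> ('a, 'b, 'z) qprotocol pmf \<Rightarrow> bool" where
  "is_safe_public_coin_protocol G s t c l p \<longleftrightarrow>
     finite (set_pmf p) \<and> (\<forall>P \<in> set_pmf p. is_safe_protocol G s t c l P)"

definition quantum_error ::
    "('a, 'b, 'z) game \<Rightarrow> party \<Rightarrow> nat \<Rightarrow> ('a, 'b, 'z) qprotocol pmf \<Rightarrow> real" where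
  "quantum_error G s t p =
     Max ((\<lambda>(a, b). measure_pmf.expectation p (\<lambda>P. incorrect_prob G s t P a b)) ` inputs G)"

end

theory Submission
  imports Defs "Jordan_Normal_Form.Spectral_Radius"
begin

text \<open>
  By the minimax theorem it suffices to find, for every distribution \<open>D\<close> of the inputs to \<open>f\<close>, a
  protocol without the first message whose average error under \<open>D\<close> is small. Feed the given
  protocol with $x_1,\ldots,x_n$ independent apart from the correlation of $x_i$ and \<open>y\<close>
  prescribed by \<open>D\<close>, for random \<open>i\<close>. The first message carries little information about
  $x_1,\ldots,x_n$, so by the chain rule, given a typical prefix $x_1,\ldots,x_{i-1}$, it is almost
  independent of $x_i$; hence it can be replaced by an average message.

  Classically, Pinsker's inequality bounds the loss. The average message can be fixed, and Alice
  picks the best of the completions of her input that are consistent with it.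

  In the quantum case the information is at most $2 l_1$, because the main part of the message has
  only $l_1$ qubits and the state of the safe overhead is independent of the input. Bob prepares
  a purification of the average message and sends the purifying qubits as safe overhead of his
  first message. With the canonical purifications (the square roots of the density matrices) the
  loss is governed by the overlap of square roots, which the relative entropy controls through
  Jensen's inequality for the distributions of Nussbaum and Szkola.
\<close>

section \<open>Minimax\<close>

text \<open>The square-root dependence on l_1/n governs the choice of tools. Passing from relative
  entropy to trace distance and from there to purifications would leave a fourth root in the quantum
  bound; comparing relative entropy directly with the overlap F of two purifications puts 1 - F^2
  under a single root. In nats, the information per position is on average at most l_1 ln 2 / n
  classically and 2 l_1 ln 2 / n in the quantum case. The constants 2 and 8 of the statement are
  these bounds times 1/2 (Pinsker) and 1 (overlap) under the root.

  The strict inequalities are met because the error of the given protocol is a maximum over finitely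
  many inputs, hence some \<open>\<delta>0\<close> < \<open>\<delta>\<close>, and the gap is slack
  for the minimax argument. The new protocol may depend on the input distribution, so the public
  coin, the prefix and, classically, the message can all be fixed to favourable values.

  Security survives the superposition over the rest of Alice's input because the old input qubits
  become work qubits, while the new input qubits only control operations.\<close>

lemma expectation_finite_pmf:
  fixes g :: "'p \<Rightarrow> real"
  assumes "finite (set_pmf p)"
  shows "measure_pmf.expectation p g = (\<Sum>P\<in>set_pmf p. pmf p P * g P)"
  using assms by (subst integral_measure_pmf[of "set_pmf p"]) (auto simp: mult.commute)

text \<open>A point of the hull is a finite convex combination of error vectors. Reading the
  coefficients as probabilities and choosing one element of \<open>S\<close> over each vector turns
  the point into the expected errors of a mixed strategy.\<close>

lemma pmf_of_convex_hull:
  fixes err :: "'p \<Rightarrow> real^'i"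
  assumes "v \<in> convex hull (err ` S)"
  shows "\<exists>p. finite (set_pmf p) \<and> set_pmf p \<subseteq> S \<and>
    (\<forall>i. measure_pmf.expectation p (\<lambda>P. vec_nth (err P) i) = vec_nth v i)"
proof -
  obtain T u where T: "finite T" "T \<subseteq> err ` S" "\<forall>x\<in>T. 0 \<le> u x" "sum u T = 1"
    and v: "(\<Sum>x\<in>T. u x *\<^sub>R x) = v"
    using assms unfolding convex_hull_explicit by blast
  define q where "q = embed_pmf (\<lambda>x. if x \<in> T then u x else 0)"
  have q: "pmf q x = (if x \<in> T then u x else 0)" for x
    unfolding q_def
  proof (rule pmf_embed_pmf)
    show "\<And>x. 0 \<le> (if x \<in> T then u x else 0)"
      using T by auto
    have "(\<integral>\<^sup>+x. ennreal (if x \<in> T then u x else 0) \<partial>count_space UNIV) = (\<Sum>x\<in>T. ennreal (u x))"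
      using T by (subst nn_integral_count_space'[of T]) auto
    also have "\<dots> = 1"
      using T by (subst sum_ennreal) auto
    finally show "(\<integral>\<^sup>+x. ennreal (if x \<in> T then u x else 0) \<partial>count_space UNIV) = 1" .
  qed
  define g where "g = inv_into S err"
  have g: "g x \<in> S" "err (g x) = x" if "x \<in> T" for x
    using T(2) that unfolding g_def by (auto intro: inv_into_into f_inv_into_f)
  have sq: "set_pmf q \<subseteq> T"
    by (auto simp: set_pmf_iff q split: if_splits)
  have "measure_pmf.expectation (map_pmf g q) (\<lambda>P. vec_nth (err P) i) = vec_nth v i" for i
  proof -
    have "measure_pmf.expectation (map_pmf g q) (\<lambda>P. vec_nth (err P) i)
        = (\<Sum>x\<in>T. pmf q x * vec_nth (err (g x)) i)"
      using T(1) sq by (subst integral_map_pmf, subst integral_measure_pmf[of T]) (auto simp: mult.commute)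
    also have "\<dots> = (\<Sum>x\<in>T. u x * vec_nth x i)"
      by (rule sum.cong) (auto simp: q g)
    also have "\<dots> = vec_nth v i"
      unfolding v[symmetric] by (simp add: sum_component)
    finally show ?thesis .
  qed
  moreover have "finite (set_pmf (map_pmf g q))" "set_pmf (map_pmf g q) \<subseteq> S"
    using finite_subset[OF sq T(1)] sq g by auto
  ultimately show ?thesis by blast
qed

text \<open>The slack between \<open>\<epsilon>'\<close> and \<open>\<epsilon>\<close> makes it enough to consider input distributions of full
  support, and replaces a compactness argument.\<close>

lemma minimax:
  fixes err :: "'p \<Rightarrow> 'i::finite \<Rightarrow> real"
  assumes nonneg: "\<And>P i. P \<in> S \<Longrightarrow> 0 \<le> err P i"
    and eps: "\<epsilon>' < \<epsilon>" "0 < \<epsilon>"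
    and dist: "\<And>D. (\<And>i. D i > 0) \<Longrightarrow> sum D UNIV = 1 \<Longrightarrow> \<exists>P\<in>S. (\<Sum>i\<in>UNIV. D i * err P i) \<le> \<epsilon>'"
  shows "\<exists>p. finite (set_pmf p) \<and> set_pmf p \<subseteq> S \<and>
    (\<forall>i. measure_pmf.expectation p (\<lambda>P. err P i) < \<epsilon>)"
proof -
  define E where "E P = vec_lambda (err P)" for P
  have E: "vec_nth (E P) i = err P i" for P i by (simp add: E_def)
  define T where "T = {v :: real^'i. \<forall>i. vec_nth v i < \<epsilon>}"
  have inner: "inner a b = (\<Sum>i\<in>UNIV. vec_nth a i * vec_nth b i)" for a b :: "real^'i"
    by (simp add: inner_vec_def)
  \<comment> \<open>\<open>T\<close> consists of the vectors with all entries below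
    \<open>\<epsilon>\<close>. If no mixed strategy reached it, the normal of a separating
    hyperplane would yield, once normalised, a distribution of inputs on which every element of
    \<open>S\<close> does badly.\<close>
  have "T \<inter> convex hull (E ` S) \<noteq> {}"
  proof
    assume disj: "T \<inter> convex hull (E ` S) = {}"
    have conv: "convex T"
    proof -
      have "T = (\<Inter>i. {v. inner (axis i 1) v < \<epsilon>})"
        by (auto simp: T_def inner_axis' )
      then show ?thesis
        by (simp only: convex_INT convex_halfspace_lt)
    qed
    have card: "real CARD('i) > 0" by simp
    have "\<exists>P. P \<in> S"
      using dist[of "\<lambda>_. 1 / real CARD('i)"] by auto
    then have ne: "convex hull (E ` S) \<noteq> {}" by auto
    have neT: "T \<noteq> {}"
      by (auto simp: T_def intro!: exI[of _ "vec_lambda (\<lambda>_. \<epsilon> - 1)"])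
    obtain a b where a: "a \<noteq> 0" "\<And>v. v \<in> T \<Longrightarrow> inner a v \<le> b"
      "\<And>v. v \<in> convex hull (E ` S) \<Longrightarrow> b \<le> inner a v"
      using separating_hyperplane_sets[OF conv convex_convex_hull neT ne disj] by blast
    \<comment> \<open>\<open>T\<close> is closed under decreasing any coordinate, so a negative
      entry of the normal would make the functional unbounded on \<open>T\<close>; \<open>s\<close>
      is a decrease that pushes it beyond \<open>b\<close>.\<close>
    have a0: "vec_nth a i \<ge> 0" for i
    proof (rule ccontr)
      assume neg: "\<not> vec_nth a i \<ge> 0"
      define s where "s = (\<bar>b\<bar> + \<bar>\<Sum>j\<in>UNIV. vec_nth a j * (\<epsilon> - 1)\<bar> + 1) / \<bar>vec_nth a i\<bar>"
      have s: "s \<ge> 0" by (simp add: s_def)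
      have "vec_lambda (\<lambda>j. (\<epsilon> - 1) - (if j = i then s else 0)) \<in> T"
        using s by (auto simp: T_def)
      from a(2)[OF this] have "(\<Sum>j\<in>UNIV. vec_nth a j * (\<epsilon> - 1)) - vec_nth a i * s \<le> b"
        by (simp add: inner right_diff_distrib sum_subtractf if_distrib[of "\<lambda>z. _ * z"] cong: if_cong)
      moreover have "- vec_nth a i * s = \<bar>b\<bar> + \<bar>\<Sum>j\<in>UNIV. vec_nth a j * (\<epsilon> - 1)\<bar> + 1"
        using neg by (simp add: s_def field_simps)
      ultimately show False by linarith
    qed
    define A where "A = (\<Sum>i\<in>UNIV. vec_nth a i)"
    have "A \<noteq> 0"
    proof
      assume "A = 0"
      then have "vec_nth a i = 0" for i
        using sum_nonneg_eq_0_iff[of UNIV "vec_nth a"] a0 by (auto simp: A_def)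
      then show False using a(1) by (simp add: Finite_Cartesian_Product.vec_eq_iff)
    qed
    then have A: "A > 0"
      using a0 sum_nonneg[of UNIV "vec_nth a"] by (auto simp: A_def less_le)
    \<comment> \<open>The supremum of the functional on \<open>T\<close> is approached along the
      constant vectors just below \<open>\<epsilon>\<close>.\<close>
    have bA: "\<epsilon> * A \<le> b"
    proof (rule field_le_epsilon)
      fix e :: real assume "e > 0"
      then have "vec_lambda (\<lambda>j. \<epsilon> - e / A) \<in> T"
        using A by (auto simp: T_def)
      from a(2)[OF this] have "A * (\<epsilon> - e / A) \<le> b"
        by (simp add: inner A_def sum_distrib_right)
      then show "\<epsilon> * A \<le> b + e"
        using A by (simp add: algebra_simps)
    qed
    define \<eta> where "\<eta> = min (1/2) ((\<epsilon> - \<epsilon>') / (2 * \<epsilon>))"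
    have \<eta>: "0 < \<eta>" "\<eta> < 1" "\<epsilon>' < (1 - \<eta>) * \<epsilon>"
    proof -
      show "0 < \<eta>" "\<eta> < 1" using eps by (auto simp: \<eta>_def)
      have "\<eta> * \<epsilon> \<le> (\<epsilon> - \<epsilon>') / (2 * \<epsilon>) * \<epsilon>"
        using eps by (intro mult_right_mono) (auto simp: \<eta>_def)
      also have "\<dots> = (\<epsilon> - \<epsilon>') / 2"
        using eps by simp
      finally have "\<eta> * \<epsilon> \<le> (\<epsilon> - \<epsilon>') / 2" .
      then have "\<epsilon> - \<eta> * \<epsilon> > \<epsilon>'" using eps by argo
      then show "\<epsilon>' < (1 - \<eta>) * \<epsilon>"
        by (simp add: algebra_simps)
    qed
    define D where "D i = (1 - \<eta>) * (vec_nth a i / A) + \<eta> / real CARD('i)" for i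
    have Dpos: "D i > 0" for i
      unfolding D_def using a0[of i] A \<eta> card by (intro add_nonneg_pos mult_nonneg_nonneg divide_pos_pos) auto
    have Dsum: "sum D UNIV = 1"
    proof -
      have "sum D UNIV = (1 - \<eta>) * (A / A) + \<eta>"
        unfolding D_def A_def sum.distrib sum_distrib_left[symmetric] sum_divide_distrib[symmetric] by simp
      then show ?thesis using A by simp
    qed
    obtain P where P: "P \<in> S" "(\<Sum>i\<in>UNIV. D i * err P i) \<le> \<epsilon>'"
      using dist[OF Dpos Dsum] by blast
    have "b \<le> inner a (E P)"
      by (rule a(3)) (use P in \<open>auto intro: hull_inc\<close>)
    then have "\<epsilon> * A \<le> (\<Sum>i\<in>UNIV. vec_nth a i * err P i)"
      using bA by (simp add: inner E)
    then have "\<epsilon> \<le> (\<Sum>i\<in>UNIV. vec_nth a i * err P i) / A"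
      using A by (simp add: field_simps)
    then have "(1 - \<eta>) * \<epsilon> \<le> (1 - \<eta>) * ((\<Sum>i\<in>UNIV. vec_nth a i * err P i) / A)"
      using \<eta> by (intro mult_left_mono) auto
    also have "\<dots> = (\<Sum>i\<in>UNIV. (1 - \<eta>) * (vec_nth a i / A) * err P i)"
      by (simp add: sum_divide_distrib sum_distrib_left mult_ac)
    also have "\<dots> \<le> (\<Sum>i\<in>UNIV. D i * err P i)"
      using \<eta> P nonneg by (intro sum_mono mult_right_mono) (auto simp: D_def)
    finally show False using P(2) \<eta>(3) by linarith
  qed
  then obtain v where v: "v \<in> convex hull (E ` S)" "\<forall>i. vec_nth v i < \<epsilon>"
    by (auto simp: T_def)
  from pmf_of_convex_hull[OF v(1)] v(2) show ?thesis
    by (auto simp: E)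
qed

section \<open>Averages over lists of independent inputs\<close>

text \<open>The expectation of \<open>F\<close> over \<open>k\<close> independent letters of law
  \<open>w\<close>, when \<open>w\<close> is a probability distribution. As a finite sum it allows
  Fubini and linearity without measure theory.\<close>

definition lavg :: "('x::finite \<Rightarrow> real) \<Rightarrow> nat \<Rightarrow> ('x list \<Rightarrow> real) \<Rightarrow> real" where
  "lavg w k F = (\<Sum>u | length u = k. prod_list (map w u) * F u)"

lemma finite_lists_of_length [simp]: "finite {u :: 'x::finite list. length u = k}"
  using finite_lists_length_eq[of "UNIV :: 'x set" k] by simp

lemma sum_lists_Suc:
  "(\<Sum>u | length u = Suc k. g u) = (\<Sum>x\<in>UNIV. \<Sum>v | length v = k. g (x # v))"
  for g :: "'x::finite list \<Rightarrow> 'a::comm_monoid_add"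
proof -
  have eq: "{u. length u = Suc k} = (\<lambda>(x, v). x # v) ` (UNIV \<times> {v :: 'x list. length v = k})"
    by (auto simp: length_Suc_conv image_iff)
  show ?thesis
    unfolding eq by (subst sum.reindex) (auto simp: inj_on_def case_prod_unfold sum.cartesian_product)
qed

lemma lavg_0 [simp]: "lavg w 0 F = F []"
  by (simp add: lavg_def)

lemma lavg_Suc: "lavg w (Suc k) F = (\<Sum>x\<in>UNIV. w x * lavg w k (\<lambda>v. F (x # v)))"
  by (simp add: lavg_def sum_lists_Suc sum_distrib_left mult_ac)

lemma lavg_append: "lavg w (k + m) F = lavg w k (\<lambda>u. lavg w m (\<lambda>v. F (u @ v)))"
  by (induction k arbitrary: F) (auto simp: lavg_Suc)

lemma lavg_snoc: "lavg w (Suc k) F = lavg w k (\<lambda>u. \<Sum>x\<in>UNIV. w x * F (u @ [x]))"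
  using lavg_append[of w k 1 F] by (simp add: lavg_Suc)

lemma lavg_cong: "(\<And>u. length u = k \<Longrightarrow> F u = G u) \<Longrightarrow> lavg w k F = lavg w k G"
  by (auto simp: lavg_def intro!: sum.cong)

lemma prod_list_map_nonneg: "(\<And>x. w x \<ge> 0) \<Longrightarrow> prod_list (map w u) \<ge> (0 :: real)"
  by (induction u) auto

lemma lavg_mono:
  assumes "\<And>x. w x \<ge> 0" "\<And>u. length u = k \<Longrightarrow> F u \<le> G u"
  shows "lavg w k F \<le> lavg w k G"
  unfolding lavg_def using assms
  by (intro sum_mono mult_left_mono) (auto simp: prod_list_map_nonneg)

lemma lavg_add: "lavg w k (\<lambda>u. F u + G u) = lavg w k F + lavg w k G"
  by (simp add: lavg_def algebra_simps sum.distrib)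

lemma lavg_diff: "lavg w k (\<lambda>u. F u - G u) = lavg w k F - lavg w k G"
  by (simp add: lavg_def algebra_simps sum_subtractf)

lemma lavg_cmult: "lavg w k (\<lambda>u. c * F u) = c * lavg w k F"
  by (simp add: lavg_def sum_distrib_left mult_ac)

lemma lavg_sum: "lavg w k (\<lambda>u. \<Sum>i\<in>S. F i u) = (\<Sum>i\<in>S. lavg w k (F i))"
  by (simp add: lavg_def sum_distrib_left) (rule sum.swap)

lemma lavg_const: "sum w UNIV = 1 \<Longrightarrow> lavg w k (\<lambda>_. c) = c"
  by (induction k) (auto simp: lavg_Suc sum_distrib_right[symmetric])

lemma lavg_nonneg: "(\<And>x. w x \<ge> 0) \<Longrightarrow> (\<And>u. length u = k \<Longrightarrow> F u \<ge> 0) \<Longrightarrow> lavg w k F \<ge> 0"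
  unfolding lavg_def by (intro sum_nonneg mult_nonneg_nonneg) (auto simp: prod_list_map_nonneg)

text \<open>The drift of the potential \<open>\<Phi>\<close> when one further random letter is
  revealed.\<close>

definition increment :: "('x::finite \<Rightarrow> real) \<Rightarrow> ('x list \<Rightarrow> real) \<Rightarrow> 'x list \<Rightarrow> real" where
  "increment w \<Phi> u = (\<Sum>x\<in>UNIV. w x * \<Phi> (u @ [x])) - \<Phi> u"

text \<open>Telescoping, because averaging the first term of \<open>increment\<close> over prefixes
  of length \<open>k\<close> gives the average of \<open>\<Phi>\<close> over prefixes of length
  \<open>k + 1\<close>.\<close>

lemma sum_increment: "(\<Sum>k<n. lavg w k (increment w \<Phi>)) = lavg w n \<Phi> - \<Phi> []"
proof (induction n)
  case (Suc n)
  have "lavg w n (increment w \<Phi>) = lavg w (Suc n) \<Phi> - lavg w n \<Phi>"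
    unfolding increment_def lavg_diff lavg_snoc ..
  then show ?case using Suc by simp
qed simp

text \<open>The drifts add up to at most \<open>L\<close>, so a typical one is \<open>L / n\<close>,
  and concavity of the square root bounds the average loss. Only one good prefix is claimed, so
  \<open>new\<close> may come from a different protocol for every prefix.\<close>

lemma round_averaging:
  fixes w :: "'x::finite \<Rightarrow> real"
  assumes w: "\<And>x. w x \<ge> 0" "sum w UNIV = 1" and n: "n \<ge> 1" and C: "C \<ge> 0"
    and incr: "\<And>u. length u < n \<Longrightarrow> 0 \<le> increment w \<Phi> u"
    and total: "lavg w n \<Phi> - \<Phi> [] \<le> L"
    and new: "\<And>u. length u < n \<Longrightarrow> new u \<le> old u + sqrt (C * increment w \<Phi> u)"
    and old: "(\<Sum>k<n. lavg w k old) \<le> n * \<delta>"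
  shows "\<exists>u. length u < n \<and> new u \<le> \<delta> + sqrt (C * L / n)"
proof (rule ccontr)
  assume "\<not> ?thesis"
  then have big: "new u > \<delta> + sqrt (C * L / n)" if "length u < n" for u
    using that by (meson not_le)
  \<comment> \<open>As there are finitely many prefixes, the least value of \<open>new\<close> still
    exceeds the target strictly.\<close>
  define m where "m = Min (new ` {u :: 'x list. length u < n})"
  have fin: "finite {u :: 'x list. length u < n}"
  proof -
    have "{u :: 'x list. length u < n} = (\<Union>k<n. {u. length u = k})" by auto
    then show ?thesis by simp
  qed
  have "{u :: 'x list. length u < n} \<noteq> {}"
    using n by (auto intro!: exI[of _ "[]"])
  then have "m \<in> new ` {u. length u < n}"
    unfolding m_def using fin by (intro Min_in) auto
  then have m1: "m > \<delta> + sqrt (C * L / n)" using big by auto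
  have m2: "m \<le> new u" if "length u < n" for u
    unfolding m_def using fin that by (intro Min_le) auto
  \<comment> \<open>The assumed excess also serves as the point of tangency for the square root:
    with this choice the summed linear bounds give \<open>s * s \<le> C * L / n\<close>, contrary to
    its size.\<close>
  define s where "s = m - \<delta>"
  have inc_total: "0 \<le> lavg w n \<Phi> - \<Phi> []"
    unfolding sum_increment[symmetric] using w incr by (intro sum_nonneg lavg_nonneg) auto
  then have L: "C * L / n \<ge> 0" using total C by auto
  have s: "s > sqrt (C * L / n)" "s > 0"
    using m1 real_sqrt_ge_zero[OF L] unfolding s_def by linarith+
  text \<open>AM-GM turns the square root into a linear function of the increment.\<close>
  have amgm: "sqrt z \<le> (z / s + s) / 2" if "z \<ge> 0" for z
  proof -
    have "0 \<le> (sqrt z - s)\<^sup>2" by simp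
    also have "\<dots> = z + s\<^sup>2 - 2 * s * sqrt z" using that by (simp add: power2_diff)
    finally show ?thesis using s by (simp add: field_simps power2_eq_square)
  qed
  have "n * m = (\<Sum>k<n. lavg w k (\<lambda>_. m))"
    using w by (simp add: lavg_const)
  also have "\<dots> \<le> (\<Sum>k<n. lavg w k (\<lambda>u. old u + (C / s * increment w \<Phi> u + s) / 2))"
  proof (intro sum_mono lavg_mono w)
    fix k and u :: "'x list" assume "k \<in> {..<n}" "length u = k"
    then have u: "length u < n" by simp
    show "m \<le> old u + (C / s * increment w \<Phi> u + s) / 2"
    proof -
      have "sqrt (C * increment w \<Phi> u) \<le> (C / s * increment w \<Phi> u + s) / 2"
        using amgm[of "C * increment w \<Phi> u"] incr[OF u] C by simp
      then show ?thesis using new[OF u] m2[OF u] by linarith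
    qed
  qed
  also have "\<dots> = (\<Sum>k<n. lavg w k old + ((C / s) * lavg w k (increment w \<Phi>) + s) / 2)"
  proof (rule sum.cong)
    fix k
    have "lavg w k (\<lambda>u. old u + (C / s * increment w \<Phi> u + s) / 2)
        = lavg w k (\<lambda>u. old u + ((C / s / 2) * increment w \<Phi> u + s / 2))"
      by (rule lavg_cong) (simp add: add_divide_distrib)
    then show "lavg w k (\<lambda>u. old u + (C / s * increment w \<Phi> u + s) / 2)
        = lavg w k old + ((C / s) * lavg w k (increment w \<Phi>) + s) / 2"
      using w by (simp only: lavg_add lavg_cmult lavg_const) (simp add: field_simps)
  qed simp
  also have "\<dots> = (\<Sum>k<n. lavg w k old) + ((C / s) * (lavg w n \<Phi> - \<Phi> []) + n * s) / 2"
    unfolding sum_increment[symmetric]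
    by (simp add: sum.distrib sum_distrib_left add_divide_distrib sum_divide_distrib)
  also have "\<dots> \<le> n * \<delta> + ((C / s) * L + n * s) / 2"
    using old total C s by (intro add_mono divide_right_mono mult_left_mono) auto
  finally have "n * m \<le> n * \<delta> + ((C / s) * L + n * s) / 2" .
  moreover have "n * m = n * \<delta> + n * s"
    by (simp add: s_def algebra_simps)
  ultimately have "n * s \<le> (C / s) * L" by argo
  then have "n * s \<le> C * L / s" by simp
  then have "s * s \<le> C * L / n"
    using s n by (simp add: field_simps)
  moreover have "C * L / n < s * s"
  proof -
    have "sqrt (C * L / n) * sqrt (C * L / n) < s * s"
      using s L by (intro mult_strict_mono') auto
    moreover have "sqrt z * sqrt z = z" if "z \<ge> 0" for z :: real
      using that by simp
    ultimately show ?thesis using L by metis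
  qed
  ultimately show False by simp
qed

section \<open>The hard distribution for the n-fold game\<close>

definition marginal :: "('x \<times> 'y::finite \<Rightarrow> real) \<Rightarrow> 'x \<Rightarrow> real" where
  "marginal D x = (\<Sum>y\<in>UNIV. D (x, y))"

text \<open>The average of \<open>e\<close> over the inputs to $f^{(n),A}$ in which Bob holds the prefix \<open>u\<close>, the pair
  $(x_i, y)$ has distribution \<open>D\<close>, and the later components are independent with the distribution
  of $x_i$.\<close>

definition prefix_avg ::
    "('x::finite \<times> 'y::finite \<Rightarrow> real) \<Rightarrow> nat \<Rightarrow> ('x list \<Rightarrow> 'y \<times> nat \<times> 'x list \<Rightarrow> real) \<Rightarrow> 'x list \<Rightarrow> real" where
  "prefix_avg D n e u = (\<Sum>(x, y)\<in>UNIV. D (x, y) *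
     lavg (marginal D) (n - Suc (length u)) (\<lambda>v. e (u @ x # v) (y, Suc (length u), u)))"

lemma sum_marginal: "sum (marginal D) (UNIV :: 'x::finite set) = sum D UNIV"
  unfolding marginal_def by (simp add: sum.cartesian_product)

lemma marginal_pos: "(\<And>i. D i > 0) \<Longrightarrow> marginal D x > 0"
  by (auto simp: marginal_def intro!: sum_pos)

lemma nfold_inputs_prefix:
  assumes "length u < n" "length v = n - Suc (length u)"
  shows "(u @ x # v, (y, Suc (length u), u)) \<in> inputs (nfold_game n f)"
  using assms by (auto simp: nfold_game_def)

lemma ex_below_average:
  assumes "finite (set_pmf p)" "(\<Sum>P\<in>set_pmf p. pmf p P * g P) \<le> c"
  shows "\<exists>P\<in>set_pmf p. g P \<le> c"
proof (rule ccontr)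
  assume "\<not> ?thesis"
  then have "(\<Sum>P\<in>set_pmf p. pmf p P * c) < (\<Sum>P\<in>set_pmf p. pmf p P * g P)"
    using assms(1) set_pmf_not_empty by (intro sum_strict_mono) (auto simp: pmf_positive)
  moreover have "(\<Sum>P\<in>set_pmf p. pmf p P * c) = c"
    using assms(1) by (simp add: sum_distrib_right[symmetric] sum_pmf_eq_1)
  ultimately show False using assms(2) by linarith
qed

text \<open>Every \<open>prefix_avg\<close> is an average of errors on admissible inputs, so for the
  randomised protocol it is at most \<open>\<delta>\<close>. The total over all positions and
  prefixes is linear in the error; hence one value of the public coin does at least as well as the
  mixture in total, though perhaps not at each prefix.\<close>

lemma ex_good_protocol:
  assumes fin: "finite (set_pmf p)" and D: "\<And>i. D i > 0" "sum D UNIV = 1"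
    and err: "\<And>a b. (a, b) \<in> inputs (nfold_game n f) \<Longrightarrow> (\<Sum>P\<in>set_pmf p. pmf p P * e P a b) \<le> \<delta>"
  shows "\<exists>P\<in>set_pmf p. (\<Sum>k<n. lavg (marginal D) k (prefix_avg D n (e P))) \<le> n * \<delta>"
proof (rule ex_below_average[OF fin])
  have m: "\<And>x. marginal D x \<ge> 0" "sum (marginal D) UNIV = 1"
    using D by (simp_all add: sum_marginal marginal_pos less_imp_le)
  have lin: "prefix_avg D n (\<lambda>a b. \<Sum>P\<in>set_pmf p. pmf p P * e P a b) u
      = (\<Sum>P\<in>set_pmf p. pmf p P * prefix_avg D n (e P) u)" for u
  proof -
    have "prefix_avg D n (\<lambda>a b. \<Sum>P\<in>set_pmf p. pmf p P * e P a b) u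
      = (\<Sum>i\<in>UNIV. \<Sum>P\<in>set_pmf p. D i * (pmf p P *
          lavg (marginal D) (n - Suc (length u)) (\<lambda>v. e P (u @ fst i # v) (snd i, Suc (length u), u))))"
      unfolding prefix_avg_def by (simp add: lavg_sum lavg_cmult sum_distrib_left case_prod_unfold)
    also have "\<dots> = (\<Sum>P\<in>set_pmf p. \<Sum>i\<in>UNIV. D i * (pmf p P *
          lavg (marginal D) (n - Suc (length u)) (\<lambda>v. e P (u @ fst i # v) (snd i, Suc (length u), u))))"
      by (rule sum.swap)
    finally show ?thesis
      by (simp add: prefix_avg_def sum_distrib_left case_prod_unfold mult_ac)
  qed
  have "(\<Sum>P\<in>set_pmf p. pmf p P * (\<Sum>k<n. lavg (marginal D) k (prefix_avg D n (e P))))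
      = (\<Sum>P\<in>set_pmf p. \<Sum>k<n. lavg (marginal D) k (\<lambda>u. pmf p P * prefix_avg D n (e P) u))"
    by (simp add: sum_distrib_left lavg_cmult)
  also have "\<dots> = (\<Sum>k<n. \<Sum>P\<in>set_pmf p. lavg (marginal D) k (\<lambda>u. pmf p P * prefix_avg D n (e P) u))"
    by (rule sum.swap)
  also have "\<dots> = (\<Sum>k<n. lavg (marginal D) k (prefix_avg D n (\<lambda>a b. \<Sum>P\<in>set_pmf p. pmf p P * e P a b)))"
    by (simp only: ext[OF lin] lavg_sum)
  also have "\<dots> \<le> (\<Sum>k<n. lavg (marginal D) k (\<lambda>_. \<delta>))"
  proof (intro sum_mono lavg_mono m)
    fix k and u :: "'b list" assume "k \<in> {..<n}" "length u = k"
    then have u: "length u < n" by simp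
    have "prefix_avg D n (\<lambda>a b. \<Sum>P\<in>set_pmf p. pmf p P * e P a b) u
        \<le> (\<Sum>(x, y)\<in>UNIV. D (x, y) * lavg (marginal D) (n - Suc (length u)) (\<lambda>v. \<delta>))"
      unfolding prefix_avg_def case_prod_unfold using D m u
      by (intro sum_mono mult_left_mono lavg_mono err nfold_inputs_prefix) (auto simp: less_imp_le)
    also have "\<dots> = \<delta>"
      using D m by (simp add: lavg_const case_prod_unfold sum_distrib_right[symmetric])
    finally show "prefix_avg D n (\<lambda>a b. \<Sum>P\<in>set_pmf p. pmf p P * e P a b) u \<le> \<delta>" .
  qed
  also have "\<dots> = n * \<delta>"
    using m by (simp add: lavg_const)
  finally show "(\<Sum>P\<in>set_pmf p. pmf p P * (\<Sum>k<n. lavg (marginal D) k (prefix_avg D n (e P)))) \<le> n * \<delta>" .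
qed

text \<open>The role of \<open>\<Phi>\<close> is played by the negative entropy of the first message given a prefix of
  Alice's input; its increments are the terms of the chain rule for mutual information.\<close>

lemma round_elimination_core:
  fixes e' :: "'q \<Rightarrow> 'x::finite \<times> 'y::finite \<Rightarrow> real"
  assumes fin: "finite (set_pmf p)" and n: "n \<ge> 1" and C: "C \<ge> 0"
    and err: "\<And>a b. (a, b) \<in> inputs (nfold_game n f) \<Longrightarrow> (\<Sum>P\<in>set_pmf p. pmf p P * e P a b) \<le> \<delta>"
    and \<epsilon>: "\<delta> + sqrt (C * L / n) < \<epsilon>" "0 < \<epsilon>"
    and nonneg: "\<And>Q i. Q \<in> S \<Longrightarrow> 0 \<le> e' Q i"
    and step: "\<And>P D. P \<in> set_pmf p \<Longrightarrow> (\<And>i. D i > 0) \<Longrightarrow> sum D UNIV = 1 \<Longrightarrow>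
      \<exists>\<Phi>. lavg (marginal D) n \<Phi> - \<Phi> [] \<le> L \<and>
        (\<forall>u. length u < n \<longrightarrow> 0 \<le> increment (marginal D) \<Phi> u \<and>
          (\<exists>Q\<in>S. (\<Sum>i\<in>UNIV. D i * e' Q i)
             \<le> prefix_avg D n (e P) u + sqrt (C * increment (marginal D) \<Phi> u)))"
  shows "\<exists>q. finite (set_pmf q) \<and> set_pmf q \<subseteq> S \<and>
    (\<forall>i. measure_pmf.expectation q (\<lambda>Q. e' Q i) < \<epsilon>)"
proof (rule minimax[OF nonneg \<epsilon>])
  fix D :: "'x \<times> 'y \<Rightarrow> real"
  assume D: "\<And>i. D i > 0" "sum D UNIV = 1"
  have m: "\<And>x. marginal D x \<ge> 0" "sum (marginal D) UNIV = 1"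
    using D by (simp_all add: sum_marginal marginal_pos less_imp_le)
  obtain P where P: "P \<in> set_pmf p" "(\<Sum>k<n. lavg (marginal D) k (prefix_avg D n (e P))) \<le> n * \<delta>"
    using ex_good_protocol[where f = f and e = e and n = n and \<delta> = \<delta>, OF fin D err] by blast
  obtain \<Phi> where \<Phi>: "lavg (marginal D) n \<Phi> - \<Phi> [] \<le> L"
    "\<And>u. length u < n \<Longrightarrow> 0 \<le> increment (marginal D) \<Phi> u"
    "\<And>u. length u < n \<Longrightarrow> \<exists>Q\<in>S. (\<Sum>i\<in>UNIV. D i * e' Q i)
             \<le> prefix_avg D n (e P) u + sqrt (C * increment (marginal D) \<Phi> u)"
    using step[OF P(1) D] by blast
  \<comment> \<open>The new protocol is chosen separately for every prefix; the prefix itself is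
    selected by \<open>round_averaging\<close>.\<close>
  then obtain Q where Q: "\<And>u. length u < n \<Longrightarrow> Q u \<in> S"
    "\<And>u. length u < n \<Longrightarrow> (\<Sum>i\<in>UNIV. D i * e' (Q u) i)
             \<le> prefix_avg D n (e P) u + sqrt (C * increment (marginal D) \<Phi> u)"
    by metis
  from round_averaging[where new = "\<lambda>u. \<Sum>i\<in>UNIV. D i * e' (Q u) i", OF m n C \<Phi>(2,1) Q(2) P(2)]
  show "\<exists>Q\<in>S. (\<Sum>i\<in>UNIV. D i * e' Q i) \<le> \<delta> + sqrt (C * L / n)"
    using Q(1) by blast
qed

section \<open>Inequalities for relative entropy\<close>

text \<open>The tangent of the logarithm at the mean \<open>Z\<close> lies above it. Where the
  weight is 0 the ratio may vanish as well, and the term is 0 whatever the value of the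
  logarithm.\<close>

lemma jensen_ln:
  fixes w r :: "'i \<Rightarrow> real"
  assumes fin: "finite I" and w: "\<And>i. i \<in> I \<Longrightarrow> w i \<ge> 0" "sum w I = 1"
    and r: "\<And>i. i \<in> I \<Longrightarrow> r i \<ge> 0" "\<And>i. i \<in> I \<Longrightarrow> w i > 0 \<Longrightarrow> r i > 0"
  shows "0 < (\<Sum>i\<in>I. w i * r i)" "(\<Sum>i\<in>I. w i * ln (r i)) \<le> ln (\<Sum>i\<in>I. w i * r i)"
proof -
  define Z where "Z = (\<Sum>i\<in>I. w i * r i)"
  obtain i where "i \<in> I" "w i \<noteq> 0"
    using w(2) sum.not_neutral_contains_not_neutral[of w I] by auto
  then have i: "i \<in> I" "w i > 0" using w(1)[of i] by auto
  have "w i * r i \<le> Z"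
    unfolding Z_def using fin i w r by (intro member_le_sum) auto
  moreover have "w i * r i > 0" using i r by simp
  ultimately have Z: "Z > 0" by linarith
  show "0 < (\<Sum>i\<in>I. w i * r i)" using Z by (simp add: Z_def)
  have "w i * ln (r i) \<le> w i * (ln Z - 1) + w i * r i / Z" if "i \<in> I" for i
  proof (cases "w i > 0")
    case True
    then have ri: "r i > 0" using r that by auto
    have "ln (r i / Z) \<le> r i / Z - 1"
      using ri Z by (intro ln_le_minus_one) auto
    then have "ln (r i) \<le> (ln Z - 1) + r i / Z"
      using ri Z by (simp add: ln_div)
    then have "w i * ln (r i) \<le> w i * ((ln Z - 1) + r i / Z)"
      using True by (intro mult_left_mono) auto
    then show ?thesis by (simp add: algebra_simps)
  next
    case False
    then have "w i = 0" using w(1)[OF that] by simp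
    then show ?thesis by simp
  qed
  then have "(\<Sum>i\<in>I. w i * ln (r i)) \<le> (\<Sum>i\<in>I. w i * (ln Z - 1) + w i * r i / Z)"
    by (rule sum_mono)
  also have "\<dots> = sum w I * (ln Z - 1) + Z / Z"
    unfolding sum.distrib sum_distrib_right sum_divide_distrib[symmetric] Z_def ..
  also have "\<dots> = ln Z" using w Z by simp
  finally show "(\<Sum>i\<in>I. w i * ln (r i)) \<le> ln (\<Sum>i\<in>I. w i * r i)" by (simp add: Z_def)
qed

text \<open>Concavity of the square root, as Cauchy--Schwarz for the vectors
  \<open>sqrt (w i)\<close> and \<open>sqrt (w i * g i)\<close>.\<close>

lemma sum_weighted_sqrt_le:
  fixes w g :: "'i \<Rightarrow> real"
  assumes "finite I" "\<And>i. i \<in> I \<Longrightarrow> w i \<ge> 0" "sum w I = 1" "\<And>i. i \<in> I \<Longrightarrow> g i \<ge> 0"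
  shows "(\<Sum>i\<in>I. w i * sqrt (g i)) \<le> sqrt (\<Sum>i\<in>I. w i * g i)"
proof (rule real_le_rsqrt)
  have "(\<Sum>i\<in>I. w i * sqrt (g i))\<^sup>2 = (\<Sum>i\<in>I. sqrt (w i) * sqrt (w i * g i))\<^sup>2"
    using assms by (intro arg_cong[where f = "\<lambda>z. z\<^sup>2"] sum.cong) (auto simp: real_sqrt_mult)
  also have "\<dots> \<le> (\<Sum>i\<in>I. (sqrt (w i))\<^sup>2) * (\<Sum>i\<in>I. (sqrt (w i * g i))\<^sup>2)"
    by (rule Cauchy_Schwarz_ineq_sum)
  also have "\<dots> = sum w I * (\<Sum>i\<in>I. w i * g i)"
    using assms by (intro arg_cong2[where f = "(*)"] sum.cong) auto
  finally show "(\<Sum>i\<in>I. w i * sqrt (g i))\<^sup>2 \<le> (\<Sum>i\<in>I. w i * g i)"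
    using assms by simp
qed

text \<open>The difference \<open>h\<close> of the two sides has derivative \<open>4 * g\<close>,
  where \<open>g\<close> is increasing and \<open>g 1 = 0\<close>; so \<open>h\<close> attains its
  minimum at 1, and \<open>h 1 = 0\<close>.\<close>

lemma pinsker_pointwise_aux:
  fixes t :: real
  assumes "t > 0"
  shows "3 * (t - 1)\<^sup>2 \<le> (2 * t + 4) * (t * ln t - t + 1)"
proof -
  define g where "g t = (t + 1) * ln t - 2 * (t - 1)" for t :: real
  define h where "h t = (2 * t + 4) * (t * ln t - t + 1) - 3 * (t - 1)\<^sup>2" for t :: real
  have dg: "(g has_real_derivative ln t + 1 / t - 1) (at t)" if "t > 0" for t
    unfolding g_def using that by (auto intro!: derivative_eq_intros simp: field_simps)
  have dh: "(h has_real_derivative 4 * g t) (at t)" if "t > 0" for t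
    unfolding h_def g_def using that
    by (auto intro!: derivative_eq_intros) (simp add: algebra_simps)
  have dg0: "ln t + 1 / t - 1 \<ge> 0" if "t > 0" for t :: real
    using ln_le_minus_one[of "1 / t"] that by (simp add: ln_div)
  have gmono: "g a \<le> g b" if "0 < a" "a \<le> b" for a b
    by (rule DERIV_nonneg_imp_nondecreasing[where f = g, OF that(2)])
       (meson dg dg0 less_le_trans that(1))
  have g1: "g 1 = 0" and h1: "h 1 = 0" by (auto simp: g_def h_def)
  have "h t \<ge> 0"
  proof (cases "t \<ge> 1")
    case True
    have "h 1 \<le> h t"
    proof (rule DERIV_nonneg_imp_nondecreasing[where f = h, OF True])
      fix x :: real assume "1 \<le> x" "x \<le> t"
      then show "\<exists>y. (h has_real_derivative y) (at x) \<and> 0 \<le> y"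
        using dh[of x] gmono[of 1 x] g1 by (intro exI[of _ "4 * g x"]) auto
    qed
    then show ?thesis using h1 by simp
  next
    case False
    have "h 1 \<le> h t"
    proof (rule DERIV_nonpos_imp_nonincreasing[where f = h and a = t and b = 1])
      show "t \<le> 1" using False by simp
      fix x :: real assume "t \<le> x" "x \<le> 1"
      then show "\<exists>y. (h has_real_derivative y) (at x) \<and> y \<le> 0"
        using dh[of x] gmono[of x 1] g1 assms by (intro exI[of _ "4 * g x"]) auto
    qed
    then show ?thesis using h1 by simp
  qed
  then show ?thesis by (simp add: h_def)
qed

text \<open>\<open>pinsker_pointwise_aux\<close> at \<open>t = p / q\<close>, made homogeneous by
  the factor q^2. The summands \<open>- p + q\<close> make each term of the relative entropy
  nonnegative and cancel after summation over two distributions.\<close>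

lemma pinsker_pointwise:
  fixes p q :: real
  assumes "p \<ge> 0" "q \<ge> 0" "q = 0 \<Longrightarrow> p = 0"
  shows "3 * (p - q)\<^sup>2 \<le> (2 * p + 4 * q) * (p * (ln p - ln q) - p + q)"
proof (cases "p = 0 \<or> q = 0")
  case True
  then show ?thesis using assms by (auto simp: power2_eq_square)
next
  case False
  then have pq: "p > 0" "q > 0" using assms by auto
  have "q\<^sup>2 * (3 * (p / q - 1)\<^sup>2) \<le> q\<^sup>2 * ((2 * (p / q) + 4) * (p / q * ln (p / q) - p / q + 1))"
    using pq by (intro mult_left_mono pinsker_pointwise_aux) auto
  also have "q\<^sup>2 * (3 * (p / q - 1)\<^sup>2) = 3 * (q * (p / q - 1))\<^sup>2"
    by (simp add: power_mult_distrib)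
  also have "q * (p / q - 1) = p - q"
    using pq by (simp add: field_simps)
  also have "q\<^sup>2 * ((2 * (p / q) + 4) * (p / q * ln (p / q) - p / q + 1))
      = (q * (2 * (p / q) + 4)) * (q * (p / q * ln (p / q) - p / q + 1))"
    by (simp add: power2_eq_square mult_ac)
  also have "q * (2 * (p / q) + 4) = 2 * p + 4 * q"
    using pq by (simp add: field_simps)
  also have "q * (p / q * ln (p / q) - p / q + 1) = p * (ln p - ln q) - p + q"
    using pq by (simp add: field_simps ln_div)
  finally show ?thesis .
qed

text \<open>Cauchy--Schwarz applied to the pointwise bound: the weights \<open>c\<close> sum to (2 +
  4) / 3 = 2, which is the constant.\<close>

lemma pinsker:
  fixes P Q :: "'m \<Rightarrow> real"
  assumes fin: "finite M" and P: "\<And>m. m \<in> M \<Longrightarrow> P m \<ge> 0" "sum P M = 1"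
    and Q: "\<And>m. m \<in> M \<Longrightarrow> Q m \<ge> 0" "sum Q M = 1"
    and ac: "\<And>m. m \<in> M \<Longrightarrow> Q m = 0 \<Longrightarrow> P m = 0"
  shows "(\<Sum>m\<in>M. \<bar>P m - Q m\<bar>)\<^sup>2 \<le> 2 * (\<Sum>m\<in>M. P m * (ln (P m) - ln (Q m)))"
proof -
  define k where "k m = P m * (ln (P m) - ln (Q m)) - P m + Q m" for m
  define c where "c m = (2 * P m + 4 * Q m) / 3" for m
  have pw: "(P m - Q m)\<^sup>2 \<le> c m * k m" "c m \<ge> 0" "k m \<ge> 0" if "m \<in> M" for m
  proof -
    have "3 * (P m - Q m)\<^sup>2 \<le> (2 * P m + 4 * Q m) * k m"
      unfolding k_def using that P Q ac by (intro pinsker_pointwise) auto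
    then show *: "(P m - Q m)\<^sup>2 \<le> c m * k m" by (simp add: c_def)
    show c: "c m \<ge> 0" using P Q that by (simp add: c_def)
    show "k m \<ge> 0"
    proof (cases "c m = 0")
      case True
      then have "P m = 0" "Q m = 0" using P(1)[OF that] Q(1)[OF that] by (auto simp: c_def)
      then show ?thesis by (simp add: k_def)
    next
      case False
      moreover have "0 \<le> c m * k m" using * by (meson order_trans zero_le_power2)
      ultimately show ?thesis using c by (simp add: zero_le_mult_iff)
    qed
  qed
  have "(\<Sum>m\<in>M. \<bar>P m - Q m\<bar>) \<le> (\<Sum>m\<in>M. sqrt (c m) * sqrt (k m))"
  proof (rule sum_mono)
    fix m assume "m \<in> M"
    then have "sqrt ((P m - Q m)\<^sup>2) \<le> sqrt (c m * k m)"
      by (intro real_sqrt_le_mono pw)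
    then show "\<bar>P m - Q m\<bar> \<le> sqrt (c m) * sqrt (k m)"
      by (simp only: real_sqrt_abs real_sqrt_mult)
  qed
  then have "(\<Sum>m\<in>M. \<bar>P m - Q m\<bar>)\<^sup>2 \<le> (\<Sum>m\<in>M. sqrt (c m) * sqrt (k m))\<^sup>2"
    by (intro power_mono sum_nonneg) auto
  also have "\<dots> \<le> (\<Sum>m\<in>M. (sqrt (c m))\<^sup>2) * (\<Sum>m\<in>M. (sqrt (k m))\<^sup>2)"
    by (rule Cauchy_Schwarz_ineq_sum)
  also have "\<dots> = sum c M * sum k M"
    using pw by (intro arg_cong2[where f = "(*)"] sum.cong) auto
  also have "sum c M = 2"
    using P Q by (simp add: c_def sum_divide_distrib[symmetric] sum.distrib sum_distrib_left[symmetric])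
  also have "sum k M = (\<Sum>m\<in>M. P m * (ln (P m) - ln (Q m)))"
    using P Q by (simp add: k_def sum.distrib sum_subtractf)
  finally show ?thesis .
qed

section \<open>The classical case\<close>

subsection \<open>The distribution of the first message\<close>

definition msg_prob :: "('x::finite \<Rightarrow> real) \<Rightarrow> nat \<Rightarrow> ('x list \<Rightarrow> 'm) \<Rightarrow> 'x list \<Rightarrow> 'm \<Rightarrow> real" where
  "msg_prob w n a u m = lavg w (n - length u) (\<lambda>v. of_bool (a (u @ v) = m))"

text \<open>Minus the Shannon entropy, in nats, of the first message given the prefix
  \<open>u\<close>. On complete lists the message is determined and the value is 0.\<close>

definition msg_negentropy ::
    "('x::finite \<Rightarrow> real) \<Rightarrow> nat \<Rightarrow> ('x list \<Rightarrow> 'm) \<Rightarrow> 'm set \<Rightarrow> 'x list \<Rightarrow> real" where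
  "msg_negentropy w n a Ms u = (\<Sum>m\<in>Ms. msg_prob w n a u m * ln (msg_prob w n a u m))"

context
  fixes w :: "'x::finite \<Rightarrow> real" and n :: nat and a :: "'x list \<Rightarrow> 'm" and Ms :: "'m set"
  assumes w: "\<And>x. w x > 0" "sum w UNIV = 1" and fin: "finite Ms"
    and a: "\<And>v. length v = n \<Longrightarrow> a v \<in> Ms"
begin

lemma msg_prob_nonneg: "msg_prob w n a u m \<ge> 0"
  unfolding msg_prob_def using w by (intro lavg_nonneg) (auto simp: less_imp_le)

lemma msg_prob_sum:
  assumes "length u \<le> n"
  shows "(\<Sum>m\<in>Ms. msg_prob w n a u m) = 1"
proof -
  have "(\<Sum>m\<in>Ms. msg_prob w n a u m) = lavg w (n - length u) (\<lambda>v. \<Sum>m\<in>Ms. of_bool (a (u @ v) = m))"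
    unfolding msg_prob_def lavg_sum ..
  also have "\<dots> = lavg w (n - length u) (\<lambda>v. 1)"
    using a assms fin by (intro lavg_cong) (simp add: of_bool_def)
  finally show ?thesis using w by (simp add: lavg_const)
qed

lemma msg_prob_split:
  assumes "length u < n"
  shows "msg_prob w n a u m = (\<Sum>x\<in>UNIV. w x * msg_prob w n a (u @ [x]) m)"
proof -
  have "n - length u = Suc (n - Suc (length u))" using assms by simp
  then show ?thesis unfolding msg_prob_def by (simp add: lavg_Suc)
qed

text \<open>\<open>msg_prob\<close> at \<open>u\<close> is a mixture of the values at the one-letter
  extensions in which every letter has positive weight, so it vanishes only if all of them
  do.\<close>

lemma msg_prob_ac:
  assumes "length u < n" "msg_prob w n a u m = 0"
  shows "msg_prob w n a (u @ [x]) m = 0"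
proof -
  have "w x * msg_prob w n a (u @ [x]) m \<le> msg_prob w n a u m"
    unfolding msg_prob_split[OF assms(1)] using w msg_prob_nonneg
    by (intro member_le_sum) (auto simp: less_imp_le)
  then show ?thesis
    using assms w(1)[of x] msg_prob_nonneg[of "u @ [x]" m] by (simp add: mult_le_0_iff)
qed

text \<open>One term of the chain rule: information about the next letter is the mean divergence of
  the conditional message distribution from its average. The logarithm of the average does not
  depend on \<open>x\<close>, so its mean collapses to \<open>msg_negentropy\<close> at
  \<open>u\<close>.\<close>

lemma increment_msg_negentropy:
  assumes "length u < n"
  shows "increment w (msg_negentropy w n a Ms) u = (\<Sum>x\<in>UNIV. w x *
    (\<Sum>m\<in>Ms. msg_prob w n a (u @ [x]) m * (ln (msg_prob w n a (u @ [x]) m) - ln (msg_prob w n a u m))))"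
proof -
  have "msg_negentropy w n a Ms u = (\<Sum>m\<in>Ms. \<Sum>x\<in>UNIV. w x * msg_prob w n a (u @ [x]) m * ln (msg_prob w n a u m))"
    unfolding msg_negentropy_def
    by (rule sum.cong) (simp_all add: msg_prob_split[OF assms, of m for m] sum_distrib_right)
  also have "\<dots> = (\<Sum>x\<in>UNIV. \<Sum>m\<in>Ms. w x * msg_prob w n a (u @ [x]) m * ln (msg_prob w n a u m))"
    by (rule sum.swap)
  finally show ?thesis
    unfolding increment_def by (simp add: msg_negentropy_def sum_distrib_left right_diff_distrib sum_subtractf mult_ac)
qed

lemma increment_msg_negentropy_ge:
  assumes "length u < n"
  shows "(\<Sum>x\<in>UNIV. w x * ((\<Sum>m\<in>Ms. \<bar>msg_prob w n a (u @ [x]) m - msg_prob w n a u m\<bar>)\<^sup>2 / 2))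
    \<le> increment w (msg_negentropy w n a Ms) u"
proof -
  have "(\<Sum>m\<in>Ms. \<bar>msg_prob w n a (u @ [x]) m - msg_prob w n a u m\<bar>)\<^sup>2 \<le> 2 *
    (\<Sum>m\<in>Ms. msg_prob w n a (u @ [x]) m * (ln (msg_prob w n a (u @ [x]) m) - ln (msg_prob w n a u m)))" for x
    using assms by (intro pinsker fin msg_prob_nonneg msg_prob_sum msg_prob_ac) auto
  then have "(\<Sum>m\<in>Ms. \<bar>msg_prob w n a (u @ [x]) m - msg_prob w n a u m\<bar>)\<^sup>2 / 2 \<le>
    (\<Sum>m\<in>Ms. msg_prob w n a (u @ [x]) m * (ln (msg_prob w n a (u @ [x]) m) - ln (msg_prob w n a u m)))" for x
    by (simp add: field_simps)
  then show ?thesis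
    unfolding increment_msg_negentropy[OF assms] using w
    by (intro sum_mono mult_left_mono) (auto simp: less_imp_le)
qed

text \<open>The potential is 0 on complete lists, so the total drift is the entropy of the message,
  at most the logarithm of the number of messages.\<close>

lemma msg_negentropy_total:
  "lavg w n (msg_negentropy w n a Ms) - msg_negentropy w n a Ms [] \<le> ln (card Ms)"
proof -
  have "msg_negentropy w n a Ms u = 0" if "length u = n" for u
    using that by (simp add: msg_negentropy_def msg_prob_def)
  then have 1: "lavg w n (msg_negentropy w n a Ms) = 0"
    using w by (simp add: lavg_def)
  define p where "p = msg_prob w n a []"
  have p: "\<And>m. p m \<ge> 0" "sum p Ms = 1" by (auto simp: p_def msg_prob_nonneg msg_prob_sum)
  have "- msg_negentropy w n a Ms [] = (\<Sum>m\<in>Ms. p m * ln (inverse (p m)))"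
    by (auto simp: msg_negentropy_def p_def sum_negf[symmetric] ln_inverse intro!: sum.cong)
  also have "\<dots> \<le> ln (\<Sum>m\<in>Ms. p m * inverse (p m))"
    using p by (intro jensen_ln fin) auto
  also have "\<dots> \<le> ln (\<Sum>m\<in>Ms. 1)"
  proof (subst ln_le_cancel_iff)
    show "0 < (\<Sum>m\<in>Ms. p m * inverse (p m))" using p by (intro jensen_ln fin) auto
    \<comment> \<open>\<open>p m * inverse (p m)\<close> is 1, or 0 when \<open>p m = 0\<close>,
      since \<open>inverse 0 = 0\<close>.\<close>
    show "(\<Sum>m\<in>Ms. p m * inverse (p m)) \<le> (\<Sum>m\<in>Ms. 1)"
      by (intro sum_mono) (simp add: field_simps)
    have "Ms \<noteq> {}" using p by auto
    then show "(0::real) < (\<Sum>m\<in>Ms. 1)" using fin by (simp add: card_gt_0_iff)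
  qed
  finally show ?thesis using 1 by simp
qed

end

subsection \<open>Fixing the first message\<close>

text \<open>On transcripts that cannot occur in the given protocol its messages may have the wrong length.\<close>

definition resize :: "nat \<Rightarrow> bool list \<Rightarrow> bool list" where
  "resize k ms = take k (ms @ replicate k False)"

lemma length_resize [simp]: "length (resize k ms) = k"
  by (simp add: resize_def)

lemma resize_length [simp]: "resize (length ms) ms = ms"
  by (simp add: resize_def)

text \<open>With \<open>m\<close> and the prefix \<open>u\<close> built in, the parties put
  \<open>m\<close> in front of every history; hence step \<open>k\<close> uses the length
  \<open>l ! Suc k\<close>. Alice completes her single input \<open>x\<close> to a full list by the
  fixed choice \<open>vs x\<close>.\<close>

definition fix_first_message ::
    "('x list, 'y \<times> nat \<times> 'x list, 'z) det_protocol \<Rightarrow> nat list \<Rightarrow> 'x list \<Rightarrow> bool list \<Rightarrow>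
     ('x \<Rightarrow> 'x list) \<Rightarrow> ('x, 'y, 'z) det_protocol" where
  "fix_first_message P l u m vs =
     \<lparr>alice_msg = (\<lambda>x h. resize (l ! Suc (length h)) (alice_msg P (u @ x # vs x) (m # h))),
      bob_msg = (\<lambda>y h. resize (l ! Suc (length h)) (bob_msg P (y, Suc (length u), u) (m # h))),
      alice_out = (\<lambda>x h. alice_out P (u @ x # vs x) (m # h)),
      bob_out = (\<lambda>y h. bob_out P (y, Suc (length u), u) (m # h))\<rparr>"

lemma fix_first_message_out:
  "alice_out (fix_first_message P l u m vs) x h = alice_out P (u @ x # vs x) (m # h)"
  "bob_out (fix_first_message P l u m vs) y h = bob_out P (y, Suc (length u), u) (m # h)"
  by (simp_all add: fix_first_message_def)

section \<open>Transcripts after removal of the first message\<close>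

lemma length_transcript [simp]: "length (transcript P s a b k) = k"
  by (induction k) (auto simp: Let_def)

lemma transcript_take: "k \<le> t \<Longrightarrow> take k (transcript P s a b t) = transcript P s a b k"
proof (induction t)
  case (Suc t)
  then show ?case
    by (cases "k = Suc t") (auto simp: Let_def)
qed simp

lemma mover_Suc: "mover Alice (Suc k) = mover Bob k" "mover Bob (Suc k) = mover Alice k"
  by (auto simp: mover_def)

text \<open>\<open>resize\<close> enforces the lengths on all pairs, also for those \<open>x\<close>
  that have no completion on which Alice would send \<open>m\<close>.\<close>

lemma is_det_protocol_fix_first_message:
  assumes "length l = t" "t \<ge> 1"
  shows "is_det_protocol (single_game f) Bob (t - 1) (tl l) (fix_first_message P l u m vs)"
proof -
  have "map length (transcript (fix_first_message P l u m vs) Bob x y k) = take k (tl l)"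
    if "k \<le> t - 1" for x y k
    using that
  proof (induction k)
    case (Suc k)
    then have "l ! Suc k = tl l ! k" "k < length (tl l)"
      using assms by (auto simp: nth_tl)
    then show ?case using Suc
      by (auto simp: Let_def take_Suc_conv_app_nth fix_first_message_def split: party.split)
  qed simp
  then show ?thesis
    using assms by (simp add: is_det_protocol_def)
qed

text \<open>On a list on which Alice really sends \<open>m\<close>, all later messages have the
  prescribed lengths, so \<open>resize\<close> changes nothing and the two runs agree.\<close>

lemma transcript_fix_first_message:
  assumes P: "map length (transcript P Alice a b t) = l"
    and m: "alice_msg P a [] = m" and k: "Suc k \<le> t"
    and ab: "a = u @ x # vs x" "b = (y, Suc (length u), u)"
  shows "transcript P Alice a b (Suc k) = m # transcript (fix_first_message P l u m vs) Bob x y k"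
  using k
proof (induction k)
  case 0
  then show ?case using m by (simp add: Let_def mover_def)
next
  case (Suc k)
  define Q where "Q = fix_first_message P l u m vs"
  have Q: "alice_msg Q x h = resize (l ! Suc (length h)) (alice_msg P a (m # h))"
    "bob_msg Q y h = resize (l ! Suc (length h)) (bob_msg P b (m # h))" for h
    by (simp_all add: Q_def fix_first_message_def ab)
  define h where "h = transcript Q Bob x y k"
  have IH: "transcript P Alice a b (Suc k) = m # h"
    using Suc by (simp add: h_def Q_def)
  define r where "r = (case mover Bob k of Alice \<Rightarrow> alice_msg P a (m # h) | Bob \<Rightarrow> bob_msg P b (m # h))"
  have step: "transcript P Alice a b (Suc (Suc k)) = (m # h) @ [r]"
    unfolding transcript.simps(2)[of P Alice a b "Suc k"] IH by (simp add: r_def Let_def mover_Suc)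
  have "map length (transcript P Alice a b (Suc (Suc k))) = take (Suc (Suc k)) l"
    using Suc.prems P[symmetric] by (simp only: take_map transcript_take)
  then have "map length (transcript P Alice a b (Suc (Suc k))) ! Suc k = l ! Suc k"
    by simp
  moreover have h: "length h = k" by (simp add: h_def)
  ultimately have r: "length r = l ! Suc k"
    unfolding step by (simp add: nth_append)
  then have "(case mover Bob k of Alice \<Rightarrow> alice_msg Q x h | Bob \<Rightarrow> bob_msg Q y h) = r"
    unfolding Q h r[symmetric] by (simp add: r_def split: party.split)
  then have "transcript Q Bob x y (Suc k) = h @ [r]"
    by (simp add: Let_def flip: h_def)
  then show ?case
    unfolding step Q_def by simp
qed

definition det_error :: "('a, 'b, 'z) game \<Rightarrow> party \<Rightarrow> nat \<Rightarrow> ('a, 'b, 'z) det_protocol \<Rightarrow> 'a \<Rightarrow> 'b \<Rightarrow> real" where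
  "det_error G s t P a b = of_bool (det_output P s t a b \<noteq> answer G a b)"

lemma det_error_range: "0 \<le> det_error G s t P a b" "det_error G s t P a b \<le> 1"
  by (auto simp: det_error_def)

lemma det_error_fix_first_message:
  assumes P: "is_det_protocol (nfold_game n f) Alice t l P" and t: "t \<ge> 1"
    and m: "alice_msg P (u @ x # vs x) [] = m"
    and len: "length u < n" "length (vs x) = n - Suc (length u)"
  shows "det_error (single_game f) Bob (t - 1) (fix_first_message P l u m vs) x y
    = det_error (nfold_game n f) Alice t P (u @ x # vs x) (y, Suc (length u), u)"
proof -
  have "map length (transcript P Alice (u @ x # vs x) (y, Suc (length u), u) t) = l"
    using P nfold_inputs_prefix[OF len, of x y f] by (auto simp: is_det_protocol_def)
  then have "transcript P Alice (u @ x # vs x) (y, Suc (length u), u) (Suc (t - 1))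
    = m # transcript (fix_first_message P l u m vs) Bob x y (t - 1)"
    using m t by (intro transcript_fix_first_message) auto
  then have "transcript P Alice (u @ x # vs x) (y, Suc (length u), u) t
    = m # transcript (fix_first_message P l u m vs) Bob x y (t - 1)"
    using t by simp
  moreover have "mover Alice t = mover Bob (t - 1)"
    using t mover_Suc(1)[of "t - 1"] by simp
  ultimately have "det_output (fix_first_message P l u m vs) Bob (t - 1) x y
      = det_output P Alice t (u @ x # vs x) (y, Suc (length u), u)"
    by (simp add: det_output_def Let_def fix_first_message_out split: party.split)
  then show ?thesis
    by (simp add: det_error_def nfold_game_def single_game_def)
qed

text \<open>Drawing \<open>m\<close> from its distribution given \<open>u\<close>, instead of given
  \<open>u\<close> and \<open>x\<close>, costs half the L1 distance of the two, weighted by the mass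
  of \<open>x\<close>. The randomness that remains, in the completion \<open>v\<close> and in
  \<open>m\<close>, is replaced by best choices, which cannot increase the average error.\<close>

lemma classical_round_elimination_step:
  fixes f :: "'x::finite \<Rightarrow> 'y::finite \<Rightarrow> 'z"
  assumes P: "is_det_protocol (nfold_game n f) Alice t l P" and t: "t \<ge> 1" and l: "length l = t"
    and D: "\<And>i. D i > 0" "sum D UNIV = 1" and u: "length u < n"
  defines "a \<equiv> (\<lambda>v. alice_msg P v [])" and "Ms \<equiv> {m :: bool list. length m = hd l}"
  assumes a: "\<And>v. length v = n \<Longrightarrow> a v \<in> Ms"
  shows "\<exists>Q. is_det_protocol (single_game f) Bob (t - 1) (tl l) Q \<and>
    (\<Sum>i\<in>UNIV. D i * det_error (single_game f) Bob (t - 1) Q (fst i) (snd i))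
      \<le> prefix_avg D n (det_error (nfold_game n f) Alice t P) u
        + sqrt (1 / 2 * increment (marginal D) (msg_negentropy (marginal D) n a Ms) u)"
proof -
  define w where "w = marginal D"
  have w: "\<And>x. w x > 0" "sum w UNIV = 1"
    using D by (simp_all add: w_def sum_marginal marginal_pos)
  have fin: "finite Ms" by (simp add: Ms_def)
  note wa = w fin a
  have pnn: "msg_prob w n a v m \<ge> 0" for v m
    by (rule msg_prob_nonneg[where a = a and Ms = Ms and n = n, OF wa])
  define k where "k = n - Suc (length u)"
  define E where "E x v = (\<Sum>y\<in>UNIV. D (x, y) *
    det_error (nfold_game n f) Alice t P (u @ x # v) (y, Suc (length u), u))" for x v
  \<comment> \<open>The completions of \<open>x\<close> consistent with the message
    \<open>m\<close>, from which \<open>vs m x\<close> takes one of least error. If there is none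
    the choice is arbitrary; such an \<open>m\<close> has probability 0 given \<open>x\<close>, and
    its effect is part of the L1 distance.\<close>
  define V where "V m x = {v. length v = k \<and> a (u @ x # v) = m}" for m x
  define vs where "vs m x = arg_min_on (E x) (V m x)" for m x
  have finV: "finite (V m x)" for m x
    by (rule finite_subset[of _ "{v. length v = k}"]) (auto simp: V_def)
  have vs: "vs m x \<in> V m x" "E x (vs m x) \<le> E x v" if "v \<in> V m x" for v m x
    using that finV arg_min_if_finite(1)[of "V m x" "E x"] arg_min_least[of "V m x" v "E x"]
    by (auto simp: vs_def)
  define Q where "Q m = fix_first_message P l u m (vs m)" for m
  define F where "F m x = (\<Sum>y\<in>UNIV. D (x, y) * det_error (single_game f) Bob (t - 1) (Q m) x y)" for m x
  let ?p = "msg_prob w n a"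
  have F0: "F m x \<ge> 0" for m x
    unfolding F_def using D by (intro sum_nonneg mult_nonneg_nonneg) (auto simp: det_error_range less_imp_le)
  have F1: "F m x \<le> w x" for m x
    unfolding F_def w_def marginal_def using D
    by (intro sum_mono mult_left_le) (auto simp: det_error_range less_imp_le)
  \<comment> \<open>Given \<open>m\<close>, the conditional average of \<open>E x v\<close> over the
    consistent \<open>v\<close> is at least the minimum; multiplying by the probability of
    \<open>m\<close> avoids a division.\<close>
  have F_le: "?p (u @ [x]) m * F m x \<le> lavg w k (\<lambda>v. of_bool (a (u @ x # v) = m) * E x v)" for m x
  proof -
    have "?p (u @ [x]) m * F m x = lavg w k (\<lambda>v. F m x * of_bool (a (u @ x # v) = m))"
      unfolding lavg_cmult by (simp add: msg_prob_def k_def)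
    also have "\<dots> \<le> lavg w k (\<lambda>v. of_bool (a (u @ x # v) = m) * E x v)"
    proof (intro lavg_mono less_imp_le[OF w(1)])
      fix v :: "'x list" assume v: "length v = k"
      show "F m x * of_bool (a (u @ x # v) = m) \<le> of_bool (a (u @ x # v) = m) * E x v"
      proof (cases "a (u @ x # v) = m")
        case True
        then have "v \<in> V m x" using v by (simp add: V_def)
        from vs[OF this] have *: "a (u @ x # vs m x) = m" "length (vs m x) = k" "E x (vs m x) \<le> E x v"
          by (auto simp: V_def)
        then have "F m x = E x (vs m x)"
          unfolding F_def E_def Q_def
          using det_error_fix_first_message[OF P t, of u x "vs m" m] u by (simp add: a_def k_def)
        then show ?thesis using * True by simp
      qed simp
    qed
    finally show ?thesis .
  qed
  have sumE: "(\<Sum>x\<in>UNIV. lavg w k (E x)) = prefix_avg D n (det_error (nfold_game n f) Alice t P) u"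
  proof -
    have "lavg w k (E x) = (\<Sum>y\<in>UNIV. D (x, y) * lavg w k (\<lambda>v.
        det_error (nfold_game n f) Alice t P (u @ x # v) (y, Suc (length u), u)))" for x
      unfolding E_def lavg_sum lavg_cmult ..
    then show ?thesis
      by (simp add: prefix_avg_def w_def k_def sum.cartesian_product)
  qed
  have sumF: "(\<Sum>m\<in>Ms. ?p (u @ [x]) m * F m x) \<le> lavg w k (E x)" for x
  proof -
    have "(\<Sum>m\<in>Ms. ?p (u @ [x]) m * F m x) \<le> (\<Sum>m\<in>Ms. lavg w k (\<lambda>v. of_bool (a (u @ x # v) = m) * E x v))"
      by (intro sum_mono F_le)
    also have "\<dots> = lavg w k (\<lambda>v. \<Sum>m\<in>Ms. of_bool (a (u @ x # v) = m) * E x v)"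
      by (rule lavg_sum[symmetric])
    also have "\<dots> = lavg w k (E x)"
    proof (rule lavg_cong)
      fix v :: "'x list" assume "length v = k"
      then have "a (u @ x # v) \<in> Ms" using a u by (simp add: k_def)
      then have "(\<Sum>m\<in>Ms. of_bool (a (u @ x # v) = m)) = (1::real)"
        using fin by (simp add: of_bool_def)
      then show "(\<Sum>m\<in>Ms. of_bool (a (u @ x # v) = m) * E x v) = E x v"
        unfolding sum_distrib_right[symmetric] by simp
    qed
    finally show ?thesis .
  qed
  define tv where "tv x = (\<Sum>m\<in>Ms. \<bar>?p (u @ [x]) m - ?p u m\<bar>)" for x
  \<comment> \<open>As \<open>F\<close> is nonnegative, only the positive part of
    \<open>?p u m - ?p (u @ [x]) m\<close> matters, and the positive parts sum to half of
    \<open>tv x\<close>, both distributions having mass 1. Writing \<open>tv x / 2\<close> as a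
    square root prepares the form C times increment with C = 1/2.\<close>
  have swap: "(\<Sum>m\<in>Ms. ?p u m * F m x) \<le> lavg w k (E x) + w x * sqrt (1 / 2 * ((tv x)\<^sup>2 / 2))" for x
  proof -
    have p1: "sum (?p u) Ms = 1" "sum (?p (u @ [x])) Ms = 1"
      using u by (auto intro!: msg_prob_sum[OF wa])
    have "(\<Sum>m\<in>Ms. ?p u m * F m x)
        \<le> (\<Sum>m\<in>Ms. ?p (u @ [x]) m * F m x + w x * ((\<bar>?p (u @ [x]) m - ?p u m\<bar> + (?p u m - ?p (u @ [x]) m)) / 2))"
    proof (rule sum_mono)
      fix m
      define d where "d = (\<bar>?p (u @ [x]) m - ?p u m\<bar> + (?p u m - ?p (u @ [x]) m)) / 2"
      have "d \<ge> 0" "?p u m \<le> ?p (u @ [x]) m + d" by (auto simp: d_def abs_if field_simps)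
      then have "?p u m * F m x \<le> (?p (u @ [x]) m + d) * F m x" "d * F m x \<le> d * w x"
        using F0 F1 by (auto intro: mult_right_mono mult_left_mono)
      then show "?p u m * F m x \<le> ?p (u @ [x]) m * F m x
          + w x * ((\<bar>?p (u @ [x]) m - ?p u m\<bar> + (?p u m - ?p (u @ [x]) m)) / 2)"
        unfolding d_def[symmetric] by (simp add: algebra_simps)
    qed
    also have "\<dots> = (\<Sum>m\<in>Ms. ?p (u @ [x]) m * F m x) + w x * ((tv x + (1 - 1)) / 2)"
      unfolding sum.distrib sum_distrib_left[symmetric] sum_divide_distrib[symmetric] sum_subtractf p1 tv_def ..
    also have "(tv x + (1 - 1)) / 2 = sqrt (1 / 2 * ((tv x)\<^sup>2 / 2))"
    proof -
      have "tv x \<ge> 0" by (simp add: tv_def sum_nonneg)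
      moreover have "1 / 2 * ((tv x)\<^sup>2 / 2) = (tv x / 2)\<^sup>2" by (simp add: power2_eq_square)
      ultimately show ?thesis by (simp only: real_sqrt_abs) simp
    qed
    finally show ?thesis using sumF[of x] by linarith
  qed
  have "(\<Sum>m\<in>Ms. ?p u m * (\<Sum>x\<in>UNIV. F m x)) = (\<Sum>x\<in>UNIV. \<Sum>m\<in>Ms. ?p u m * F m x)"
    unfolding sum_distrib_left by (rule sum.swap)
  also have "\<dots> \<le> (\<Sum>x\<in>UNIV. lavg w k (E x) + w x * sqrt (1 / 2 * ((tv x)\<^sup>2 / 2)))"
    by (intro sum_mono swap)
  also have "\<dots> = prefix_avg D n (det_error (nfold_game n f) Alice t P) u
      + (\<Sum>x\<in>UNIV. w x * sqrt (1 / 2 * ((tv x)\<^sup>2 / 2)))"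
    by (simp add: sum.distrib sumE)
  also have "(\<Sum>x\<in>UNIV. w x * sqrt (1 / 2 * ((tv x)\<^sup>2 / 2))) \<le> sqrt (\<Sum>x\<in>UNIV. w x * (1 / 2 * ((tv x)\<^sup>2 / 2)))"
    using w by (intro sum_weighted_sqrt_le) (auto simp: less_imp_le)
  also have "\<dots> = sqrt (1 / 2 * (\<Sum>x\<in>UNIV. w x * ((tv x)\<^sup>2 / 2)))"
    by (simp add: sum_distrib_left mult_ac)
  also have "\<dots> \<le> sqrt (1 / 2 * increment w (msg_negentropy w n a Ms) u)"
    unfolding tv_def using u by (intro real_sqrt_le_mono mult_left_mono increment_msg_negentropy_ge[OF wa]) auto
  finally have avg: "(\<Sum>m\<in>Ms. ?p u m * (\<Sum>x\<in>UNIV. F m x))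
      \<le> prefix_avg D n (det_error (nfold_game n f) Alice t P) u
        + sqrt (1 / 2 * increment w (msg_negentropy w n a Ms) u)" (is "_ \<le> ?B")
    by simp
  have "\<exists>m. (\<Sum>x\<in>UNIV. F m x) \<le> ?B"
  proof (rule ccontr)
    assume "\<not> ?thesis"
    then have big: "?B < (\<Sum>x\<in>UNIV. F m x)" for m by (meson not_le)
    have p1: "sum (?p u) Ms = 1" using u by (auto intro!: msg_prob_sum[OF wa])
    then obtain m0 where "m0 \<in> Ms" "?p u m0 \<noteq> 0"
      using sum.not_neutral_contains_not_neutral[of "?p u" Ms] by auto
    then have m0: "m0 \<in> Ms" "?p u m0 > 0"
      using pnn[of u m0] by auto
    have "(\<Sum>m\<in>Ms. ?p u m * ?B) < (\<Sum>m\<in>Ms. ?p u m * (\<Sum>x\<in>UNIV. F m x))"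
    proof (rule sum_strict_mono_ex1[OF fin])
      show "\<forall>m\<in>Ms. ?p u m * ?B \<le> ?p u m * (\<Sum>x\<in>UNIV. F m x)"
        by (intro ballI mult_left_mono less_imp_le[OF big] pnn)
      show "\<exists>m\<in>Ms. ?p u m * ?B < ?p u m * (\<Sum>x\<in>UNIV. F m x)"
        using m0 big by (auto intro!: bexI[of _ m0])
    qed
    moreover have "(\<Sum>m\<in>Ms. ?p u m * ?B) = ?B"
      unfolding sum_distrib_right[symmetric] p1 by simp
    ultimately show False using avg by linarith
  qed
  then obtain m where m: "(\<Sum>x\<in>UNIV. F m x) \<le> ?B" by blast
  have "(\<Sum>i\<in>UNIV. D i * det_error (single_game f) Bob (t - 1) (Q m) (fst i) (snd i)) = (\<Sum>x\<in>UNIV. F m x)"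
    unfolding F_def by (simp add: sum.cartesian_product case_prod_unfold)
  then show ?thesis
    using m is_det_protocol_fix_first_message[OF l t] by (auto simp: Q_def w_def intro!: exI[of _ "Q m"])
qed

lemma finite_nfold_inputs: "finite (inputs (nfold_game n (f :: 'x::finite \<Rightarrow> 'y::finite \<Rightarrow> 'z)))"
proof (rule finite_subset)
  show "inputs (nfold_game n f) \<subseteq> {xs. length xs = n} \<times> UNIV \<times> {1..n} \<times> {xs. length xs \<le> n}"
    by (auto simp: nfold_game_def)
  have "{xs :: 'x list. length xs \<le> n} = (\<Union>k\<le>n. {u. length u = k})" by auto
  then have "finite {xs :: 'x list. length xs \<le> n}" by simp
  then show "finite ({xs :: 'x list. length xs = n} \<times> (UNIV :: 'y set) \<times> {1..n} \<times> {xs :: 'x list. length xs \<le> n})"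
    by simp
qed

lemma classical_round_elimination:
  fixes f :: "'x::finite \<Rightarrow> 'y::finite \<Rightarrow> 'z"
  assumes n: "n \<ge> 1" and t: "t \<ge> 1" and \<delta>: "\<delta> > 0" and l: "length l = t"
    and p: "is_public_coin_protocol (nfold_game n f) Alice t l p"
    and err: "public_coin_error (nfold_game n f) Alice t p < \<delta>"
  shows "\<exists>q. is_public_coin_protocol (single_game f) Bob (t - 1) (tl l) q \<and>
    public_coin_error (single_game f) Bob (t - 1) q < \<delta> + 1 / 2 * sqrt (2 * real (hd l) * ln 2 / real n)"
proof -
  define \<delta>0 where "\<delta>0 = public_coin_error (nfold_game n f) Alice t p"
  define L where "L = real (hd l) * ln 2"
  have finp: "finite (set_pmf p)" and det: "\<And>P. P \<in> set_pmf p \<Longrightarrow> is_det_protocol (nfold_game n f) Alice t l P"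
    using p by (auto simp: is_public_coin_protocol_def)
  have prob: "measure_pmf.prob q {P. det_output P s t a b \<noteq> answer G a b}
      = measure_pmf.expectation q (\<lambda>P. det_error G s t P a b)" for q s t a b
    and G :: "('c, 'd, 'z) game"
  proof -
    have "(\<lambda>P. det_error G s t P a b) = indicator {P. det_output P s t a b \<noteq> answer G a b}"
      by (auto simp: det_error_def indicator_def)
    then show ?thesis by simp
  qed
  \<comment> \<open>The constant of the statement: \<open>L\<close> bounds the entropy of the
    message, and the factor 1/2 comes from Pinsker's inequality.\<close>
  have eq: "1 / 2 * sqrt (2 * real (hd l) * ln 2 / real n) = sqrt (1 / 2 * L / n)"
  proof -
    have "1 / 2 * L / n = (1 / 2)\<^sup>2 * (2 * real (hd l) * ln 2 / real n)"
      by (simp add: L_def power2_eq_square)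
    then show ?thesis by (simp only: real_sqrt_mult real_sqrt_abs)
  qed
  have "L \<ge> 0" by (simp add: L_def)
  have "\<exists>q. finite (set_pmf q) \<and> set_pmf q \<subseteq> {Q. is_det_protocol (single_game f) Bob (t - 1) (tl l) Q} \<and>
    (\<forall>i. measure_pmf.expectation q (\<lambda>Q. det_error (single_game f) Bob (t - 1) Q (fst i) (snd i))
      < \<delta> + 1 / 2 * sqrt (2 * real (hd l) * ln 2 / real n))"
  proof (rule round_elimination_core[where f = f and L = L and C = "1 / 2" and \<delta> = \<delta>0
        and e = "det_error (nfold_game n f) Alice t", OF finp n])
    fix a b assume ab: "(a, b) \<in> inputs (nfold_game n f)"
    have "measure_pmf.prob p {P. det_output P Alice t a b \<noteq> answer (nfold_game n f) a b} \<le> \<delta>0"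
      unfolding \<delta>0_def public_coin_error_def
      using ab finite_nfold_inputs[of n f] by (intro Max_ge) (auto intro!: image_eqI[of _ _ "(a, b)"])
    then show "(\<Sum>P\<in>set_pmf p. pmf p P * det_error (nfold_game n f) Alice t P a b) \<le> \<delta>0"
      by (simp add: prob expectation_finite_pmf[OF finp])
  next
    show "\<delta>0 + sqrt (1 / 2 * L / n) < \<delta> + 1 / 2 * sqrt (2 * real (hd l) * ln 2 / real n)"
      using err by (simp only: eq \<delta>0_def)
    have "sqrt (1 / 2 * L / n) \<ge> 0" using \<open>L \<ge> 0\<close> by simp
    then show "0 < \<delta> + 1 / 2 * sqrt (2 * real (hd l) * ln 2 / real n)"
      unfolding eq using \<delta> by linarith
  next
    fix P and D :: "'x \<times> 'y \<Rightarrow> real"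
    assume P: "P \<in> set_pmf p" and D: "\<And>i. D i > 0" "sum D UNIV = 1"
    let ?Ms = "{m :: bool list. length m = hd l}"
    let ?\<Phi> = "msg_negentropy (marginal D) n (\<lambda>v. alice_msg P v []) ?Ms"
    have a: "alice_msg P v [] \<in> ?Ms" if "length v = n" for v
    proof -
      \<comment> \<open>Bob's input with index 1 and empty prefix is compatible with every list,
        which forces the length \<open>hd l\<close> of the first message on all of them.\<close>
      have "(v, (undefined, 1, take 0 v)) \<in> inputs (nfold_game n f)"
        using that n by (auto simp: nfold_game_def)
      then have "map length (transcript P Alice v (undefined, 1, take 0 v) t) = l"
        using det[OF P] by (auto simp: is_det_protocol_def)
      then have "take 1 l = map length (transcript P Alice v (undefined, 1, take 0 v) 1)"
        using t transcript_take[of 1 t P Alice v "(undefined, 1, take 0 v)"] by (metis take_map)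
      then show ?thesis
        using t l by (cases l) (auto simp: Let_def mover_def)
    qed
    have w: "\<And>x. marginal D x > 0" "sum (marginal D) UNIV = 1"
      using D by (simp_all add: sum_marginal marginal_pos)
    have card: "card ?Ms = 2 ^ hd l"
      using card_lists_length_eq[of "UNIV :: bool set" "hd l"] by simp
    show "\<exists>\<Phi>. lavg (marginal D) n \<Phi> - \<Phi> [] \<le> L \<and>
        (\<forall>u. length u < n \<longrightarrow> 0 \<le> increment (marginal D) \<Phi> u \<and>
          (\<exists>Q\<in>{Q. is_det_protocol (single_game f) Bob (t - 1) (tl l) Q}.
            (\<Sum>i\<in>UNIV. D i * det_error (single_game f) Bob (t - 1) Q (fst i) (snd i))
             \<le> prefix_avg D n (det_error (nfold_game n f) Alice t P) u
               + sqrt (1 / 2 * increment (marginal D) \<Phi> u)))"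
    proof (intro exI[of _ ?\<Phi>] conjI allI impI)
      have "lavg (marginal D) n ?\<Phi> - ?\<Phi> [] \<le> ln (card ?Ms)"
        by (rule msg_negentropy_total[OF w _ a]) simp_all
      then show "lavg (marginal D) n ?\<Phi> - ?\<Phi> [] \<le> L"
        by (simp add: card L_def ln_realpow)
    next
      fix u :: "'x list" assume u: "length u < n"
      have "0 \<le> (\<Sum>x\<in>UNIV. marginal D x * ((\<Sum>m\<in>?Ms.
          \<bar>msg_prob (marginal D) n (\<lambda>v. alice_msg P v []) (u @ [x]) m
            - msg_prob (marginal D) n (\<lambda>v. alice_msg P v []) u m\<bar>)\<^sup>2 / 2))"
        using w by (intro sum_nonneg mult_nonneg_nonneg) (auto simp: less_imp_le)
      also have "\<dots> \<le> increment (marginal D) ?\<Phi> u"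
        by (rule increment_msg_negentropy_ge[OF w _ a u]) simp_all
      finally show "0 \<le> increment (marginal D) ?\<Phi> u" .
      show "\<exists>Q\<in>{Q. is_det_protocol (single_game f) Bob (t - 1) (tl l) Q}.
            (\<Sum>i\<in>UNIV. D i * det_error (single_game f) Bob (t - 1) Q (fst i) (snd i))
             \<le> prefix_avg D n (det_error (nfold_game n f) Alice t P) u
               + sqrt (1 / 2 * increment (marginal D) ?\<Phi> u)"
        using classical_round_elimination_step[OF det[OF P] t l D u a] by blast
    qed
  qed (auto simp: det_error_range)
  then obtain q where q: "finite (set_pmf q)"
    "set_pmf q \<subseteq> {Q. is_det_protocol (single_game f) Bob (t - 1) (tl l) Q}"
    "\<And>x y. measure_pmf.expectation q (\<lambda>Q. det_error (single_game f) Bob (t - 1) Q x y)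
      < \<delta> + 1 / 2 * sqrt (2 * real (hd l) * ln 2 / real n)"
    by auto
  have "measure_pmf.prob q {P. det_output P Bob (t - 1) x y \<noteq> answer (single_game f) x y}
      < \<delta> + 1 / 2 * sqrt (2 * real (hd l) * ln 2 / real n)" for x y
    unfolding prob by (rule q(3))
  moreover have "inputs (single_game f) = UNIV" by (simp add: single_game_def)
  ultimately have "public_coin_error (single_game f) Bob (t - 1) q
      < \<delta> + 1 / 2 * sqrt (2 * real (hd l) * ln 2 / real n)"
    unfolding public_coin_error_def by (subst Max_less_iff) auto
  then show ?thesis
    using q by (auto simp: is_public_coin_protocol_def)
qed

section \<open>Matrices over finite index sets\<close>

definition ip :: "'i set \<Rightarrow> ('i \<Rightarrow> complex) \<Rightarrow> ('i \<Rightarrow> complex) \<Rightarrow> complex" where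
  "ip I a b = (\<Sum>r\<in>I. cnj (a r) * b r)"

definition mv :: "'i set \<Rightarrow> ('i \<Rightarrow> 'i \<Rightarrow> complex) \<Rightarrow> ('i \<Rightarrow> complex) \<Rightarrow> 'i \<Rightarrow> complex" where
  "mv I U a r = (\<Sum>s\<in>I. U r s * a s)"

definition mm :: "'i set \<Rightarrow> ('i \<Rightarrow> 'i \<Rightarrow> complex) \<Rightarrow> ('i \<Rightarrow> 'i \<Rightarrow> complex) \<Rightarrow> 'i \<Rightarrow> 'i \<Rightarrow> complex" where
  "mm I U V r t = (\<Sum>s\<in>I. U r s * V s t)"

definition adj :: "('i \<Rightarrow> 'i \<Rightarrow> complex) \<Rightarrow> 'i \<Rightarrow> 'i \<Rightarrow> complex" where
  "adj U r s = cnj (U s r)"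

definition unitary_mat :: "'i set \<Rightarrow> ('i \<Rightarrow> 'i \<Rightarrow> complex) \<Rightarrow> bool" where
  "unitary_mat I U \<longleftrightarrow> (\<forall>s\<in>I. \<forall>t\<in>I. (\<Sum>r\<in>I. cnj (U r s) * U r t) = (if s = t then 1 else 0))"

lemma unitary_on_eq: "unitary_on Q U = unitary_mat (Pow Q) U"
  by (simp add: unitary_on_def unitary_mat_def)

lemma cnj_ip: "cnj (ip I a b) = ip I b a"
  by (simp add: ip_def mult.commute)

lemma ip_diff: "ip I (\<lambda>r. a r - b r) c = ip I a c - ip I b c" "ip I c (\<lambda>r. a r - b r) = ip I c a - ip I c b"
  by (simp_all add: ip_def algebra_simps sum_subtractf)

lemma ip_cong: "(\<And>r. r \<in> I \<Longrightarrow> a r = a' r) \<Longrightarrow> (\<And>r. r \<in> I \<Longrightarrow> b r = b' r) \<Longrightarrow> ip I a b = ip I a' b'"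
  by (simp add: ip_def)

lemma ip_self: "ip I a a = of_real (\<Sum>r\<in>I. (cmod (a r))\<^sup>2)"
  by (simp add: ip_def complex_norm_square mult.commute del: of_real_power)

lemma ip_self_eq_0: "finite I \<Longrightarrow> ip I a a = 0 \<longleftrightarrow> (\<forall>r\<in>I. a r = 0)"
  unfolding ip_self of_real_eq_0_iff by (subst sum_nonneg_eq_0_iff) auto

lemma ip_mv:
  assumes I: "finite I" and U: "unitary_mat I U"
  shows "ip I (mv I U a) (mv I U b) = ip I a b"
proof -
  have "ip I (mv I U a) (mv I U b) = (\<Sum>r\<in>I. \<Sum>s\<in>I. \<Sum>t\<in>I. cnj (a s) * b t * (cnj (U r s) * U r t))"
    unfolding ip_def mv_def cnj_sum sum_product by (simp add: mult_ac)
  also have "\<dots> = (\<Sum>s\<in>I. \<Sum>r\<in>I. \<Sum>t\<in>I. cnj (a s) * b t * (cnj (U r s) * U r t))"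
    by (rule sum.swap)
  also have "\<dots> = (\<Sum>s\<in>I. \<Sum>t\<in>I. cnj (a s) * b t * (\<Sum>r\<in>I. cnj (U r s) * U r t))"
    unfolding sum_distrib_left by (intro sum.cong sum.swap refl)
  also have "\<dots> = (\<Sum>s\<in>I. \<Sum>t\<in>I. cnj (a s) * b t * (if s = t then 1 else 0))"
    using U by (intro sum.cong) (auto simp: unitary_mat_def)
  also have "\<dots> = ip I a b"
    using I by (simp add: ip_def if_distrib[of "\<lambda>z. _ * z"] cong: if_cong)
  finally show ?thesis .
qed

lemma mm_assoc: "mm I (mm I A B) C = mm I A (mm I B C)"
proof (intro ext)
  fix r t
  have "mm I (mm I A B) C r t = (\<Sum>s\<in>I. \<Sum>k\<in>I. A r k * (B k s * C s t))"
    by (simp add: mm_def sum_distrib_left mult_ac)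
  also have "\<dots> = (\<Sum>k\<in>I. \<Sum>s\<in>I. A r k * (B k s * C s t))"
    by (rule sum.swap)
  finally show "mm I (mm I A B) C r t = mm I A (mm I B C) r t"
    by (simp add: mm_def sum_distrib_left)
qed

lemma mv_mm: "mv I (mm I A B) a = mv I A (mv I B a)"
proof
  fix r
  have "mv I (mm I A B) a r = (\<Sum>s\<in>I. \<Sum>k\<in>I. A r k * (B k s * a s))"
    by (simp add: mm_def mv_def sum_distrib_left mult_ac)
  also have "\<dots> = (\<Sum>k\<in>I. \<Sum>s\<in>I. A r k * (B k s * a s))"
    by (rule sum.swap)
  finally show "mv I (mm I A B) a r = mv I A (mv I B a) r"
    by (simp add: mv_def sum_distrib_left)
qed

lemma adj_mm: "adj (mm I A B) = mm I (adj B) (adj A)"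
  by (simp add: adj_def mm_def fun_eq_iff mult.commute)

lemma adj_adj [simp]: "adj (adj A) = A"
  by (simp add: adj_def fun_eq_iff)

definition is_id :: "'i set \<Rightarrow> ('i \<Rightarrow> 'i \<Rightarrow> complex) \<Rightarrow> bool" where
  "is_id I A \<longleftrightarrow> (\<forall>s\<in>I. \<forall>t\<in>I. A s t = (if s = t then 1 else 0))"

lemma unitary_mat_iff: "unitary_mat I U \<longleftrightarrow> is_id I (mm I (adj U) U)"
  by (simp add: unitary_mat_def is_id_def mm_def adj_def)

lemma mm_id_left:
  assumes "finite I" "is_id I A" "r \<in> I"
  shows "mm I A B r t = B r t"
proof -
  have "mm I A B r t = (\<Sum>s\<in>I. if r = s then B s t else 0)"
    unfolding mm_def using assms by (intro sum.cong) (auto simp: is_id_def)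
  then show ?thesis using assms by simp
qed

lemma mm_id_right:
  assumes "finite I" "is_id I A" "t \<in> I"
  shows "mm I B A r t = B r t"
proof -
  have "mm I B A r t = (\<Sum>s\<in>I. if s = t then B r s else 0)"
    unfolding mm_def using assms by (intro sum.cong) (auto simp: is_id_def)
  then show ?thesis using assms by simp
qed

lemma mm_cong: "(\<And>s. s \<in> I \<Longrightarrow> A r s = A' r s) \<Longrightarrow> (\<And>s. s \<in> I \<Longrightarrow> B s t = B' s t) \<Longrightarrow> mm I A B r t = mm I A' B' r t"
  by (simp add: mm_def)

lemma unitary_mat_mm:
  assumes "finite I" "unitary_mat I U" "unitary_mat I V"
  shows "unitary_mat I (mm I U V)"
proof -
  have "mm I (adj (mm I U V)) (mm I U V) s t = (if s = t then 1 else 0)" if "s \<in> I" "t \<in> I" for s t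
  proof -
    have "mm I (adj (mm I U V)) (mm I U V) s t = mm I (adj V) (mm I (mm I (adj U) U) V) s t"
      by (simp add: adj_mm mm_assoc)
    also have "\<dots> = mm I (adj V) V s t"
      using assms by (intro mm_cong mm_id_left) (auto simp: unitary_mat_iff)
    finally show ?thesis using assms that by (simp add: unitary_mat_iff is_id_def)
  qed
  then show ?thesis by (simp add: unitary_mat_iff is_id_def)
qed

text \<open>A left inverse of a square matrix is a right inverse. An enumeration \<open>h\<close> of
  the index set reduces this to ordinary matrices.\<close>

lemma unitary_mat_right:
  assumes I: "finite I" and U: "unitary_mat I U"
  shows "is_id I (mm I U (adj U))"
proof -
  define n where "n = card I"
  obtain h where h: "bij_betw h {0..<n} I"
    using ex_bij_betw_nat_finite[OF I] by (auto simp: n_def)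
  define A where "A = Matrix.mat n n (\<lambda>(i, j). cnj (U (h j) (h i)))"
  define B where "B = Matrix.mat n n (\<lambda>(i, j). U (h i) (h j))"
  have carrier: "A \<in> carrier_mat n n" "B \<in> carrier_mat n n" by (auto simp: A_def B_def)
  have hI: "h i \<in> I" if "i < n" for i using h that by (auto simp: bij_betw_def)
  have inj: "h i = h j \<longleftrightarrow> i = j" if "i < n" "j < n" for i j
    using h that by (auto simp: bij_betw_def inj_on_def)
  have "A * B = 1\<^sub>m n"
  proof (rule eq_matI)
    fix i j assume "i < dim_row (1\<^sub>m n :: complex mat)" "j < dim_col (1\<^sub>m n :: complex mat)"
    then have ij: "i < n" "j < n" by auto
    then have "(A * B) $$ (i, j) = (\<Sum>k\<in>{0..<n}. cnj (U (h k) (h i)) * U (h k) (h j))"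
      by (simp add: A_def B_def scalar_prod_def)
    also have "\<dots> = (\<Sum>r\<in>I. cnj (U r (h i)) * U r (h j))"
      by (rule sum.reindex_bij_betw[OF h])
    also have "\<dots> = (if i = j then 1 else 0)"
      using U hI ij inj by (simp add: unitary_mat_def)
    finally show "(A * B) $$ (i, j) = 1\<^sub>m n $$ (i, j)" using ij by simp
  qed (auto simp: A_def B_def)
  then have BA: "B * A = 1\<^sub>m n" by (rule mat_mult_left_right_inverse[OF carrier])
  have "mm I U (adj U) (h i) (h j) = (if i = j then 1 else 0)" if "i < n" "j < n" for i j
  proof -
    have "(B * A) $$ (i, j) = (\<Sum>k\<in>{0..<n}. U (h i) (h k) * cnj (U (h j) (h k)))"
      using that by (simp add: A_def B_def scalar_prod_def)
    also have "\<dots> = (\<Sum>r\<in>I. U (h i) r * cnj (U (h j) r))"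
      by (rule sum.reindex_bij_betw[OF h])
    finally show ?thesis using that by (simp add: BA mm_def adj_def)
  qed
  moreover have "\<exists>i<n. s = h i" if "s \<in> I" for s
    using h that by (auto simp: bij_betw_def)
  ultimately show ?thesis using inj unfolding is_id_def by metis
qed

text \<open>The spectrum of a complex matrix of positive dimension is not empty; the enumeration
  \<open>h\<close> transports the eigenvector, which is then normalised.\<close>

lemma ex_eigenvector:
  fixes H :: "'i \<Rightarrow> 'i \<Rightarrow> complex"
  assumes I: "finite I" "I \<noteq> {}"
  shows "\<exists>v c. ip I v v = 1 \<and> (\<forall>s\<in>I. mv I H v s = c * v s)"
proof -
  define n where "n = card I"
  have n: "n > 0" using I by (simp add: n_def card_gt_0_iff)
  obtain h where h: "bij_betw h {0..<n} I"
    using ex_bij_betw_nat_finite[OF I(1)] by (auto simp: n_def)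
  define g where "g = inv_into {0..<n} h"
  have g: "g s < n" "h (g s) = s" if "s \<in> I" for s
    using bij_betwE[OF bij_betw_inv_into[OF h]] bij_betw_inv_into_right[OF h] that by (auto simp: g_def)
  have gh: "g (h i) = i" if "i < n" for i
    using bij_betw_inv_into_left[OF h] that by (auto simp: g_def)
  define A where "A = Matrix.mat n n (\<lambda>(i, j). H (h i) (h j))"
  have A: "A \<in> carrier_mat n n" by (simp add: A_def)
  obtain c where "eigenvalue A c"
    using spectrum_non_empty[OF A n] by (auto simp: spectrum_def)
  then obtain x where x: "x \<in> carrier_vec n" "x \<noteq> 0\<^sub>v n" "A *\<^sub>v x = c \<cdot>\<^sub>v x"
    using A by (auto simp: eigenvalue_def eigenvector_def)
  define v where "v s = vec_index x (g s)" for s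
  have ev: "mv I H v s = c * v s" if "s \<in> I" for s
  proof -
    have "vec_index (A *\<^sub>v x) (g s) = (\<Sum>k\<in>{0..<n}. H s (h k) * vec_index x k)"
      using x(1) g[OF that] A by (simp add: A_def scalar_prod_def)
    also have "\<dots> = (\<Sum>k\<in>{0..<n}. H s (h k) * v (h k))"
      by (rule sum.cong) (auto simp: v_def gh)
    also have "\<dots> = mv I H v s"
      unfolding mv_def by (rule sum.reindex_bij_betw[OF h])
    finally show ?thesis using x g[OF that] by (simp add: v_def)
  qed
  obtain i where i: "i < n" "vec_index x i \<noteq> 0"
    using x(1,2) by (metis carrier_vecD eq_vecI index_zero_vec)
  have "h i \<in> I" using h i by (auto simp: bij_betw_def)
  then have "ip I v v \<noteq> 0"
    using I i by (auto simp: ip_self_eq_0 v_def gh intro!: bexI[of _ "h i"])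
  define N where "N = (\<Sum>r\<in>I. (cmod (v r))\<^sup>2)"
  have "N \<noteq> 0" using \<open>ip I v v \<noteq> 0\<close> unfolding ip_self N_def[symmetric] by simp
  moreover have "N \<ge> 0" by (simp add: N_def sum_nonneg)
  ultimately have N: "N > 0" by simp
  define v' where "v' s = v s / of_real (sqrt N)" for s
  have "ip I v' v' = ip I v v / of_real (sqrt N * sqrt N)"
    by (simp add: ip_def v'_def sum_divide_distrib del: real_sqrt_mult_self)
  also have "\<dots> = 1"
    using N unfolding ip_self N_def[symmetric] by simp
  finally have "ip I v' v' = 1" .
  moreover have "mv I H v' s = c * v' s" if "s \<in> I" for s
  proof -
    have "mv I H v' s = mv I H v s / of_real (sqrt N)"
      by (simp add: mv_def v'_def sum_divide_distrib)
    then show ?thesis using ev[OF that] by (simp add: v'_def)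
  qed
  ultimately show ?thesis by blast
qed

text \<open>Vectors with the same Gram matrix are related by a unitary; it is built as a product of
  complex Householder reflections, one for each vector.\<close>

lemma reflection:
  assumes I: "finite I" and ab: "ip I a a = ip I b b"
  shows "\<exists>H. unitary_mat I H \<and> (\<forall>r\<in>I. mv I H a r = b r) \<and>
    (\<forall>z. ip I a z = ip I b z \<longrightarrow> (\<forall>r\<in>I. mv I H z r = z r))"
proof -
  define d where "d r = a r - b r" for r
  \<comment> \<open>The usual factor |d|^2 / 2 is right only if the inner product of
    \<open>a\<close> and \<open>b\<close> is real. Dividing by <d, a> sends \<open>a\<close> to
    \<open>b\<close> by construction, and the result is unitary because
    \<open>\<kappa> + cnj \<kappa>\<close> equals |d|^2.\<close>
  define \<kappa> where "\<kappa> = ip I d a"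
  define H where "H r s = (if r = s then 1 else 0) - d r * cnj (d s) / \<kappa>" for r s
  have mvH: "mv I H z r = z r - d r * ip I d z / \<kappa>" if "r \<in> I" for z r
  proof -
    have "mv I H z r = (\<Sum>s\<in>I. (if r = s then z s else 0) - d r * (cnj (d s) * z s) / \<kappa>)"
      unfolding mv_def H_def by (intro sum.cong refl) (auto simp: left_diff_distrib)
    then show ?thesis
      using I that by (simp add: sum_subtractf ip_def sum_distrib_left sum_divide_distrib)
  qed
  have d: "ip I d z = ip I a z - ip I b z" "ip I z d = ip I z a - ip I z b" for z
    unfolding d_def by (simp_all add: ip_diff)
  have \<kappa>: "\<kappa> + cnj \<kappa> = ip I d d"
    unfolding \<kappa>_def cnj_ip d using ab by (simp add: algebra_simps cnj_ip)
  have fix_z: "mv I H z r = z r" if "r \<in> I" "ip I a z = ip I b z" for z r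
    using mvH[OF that(1)] that(2) by (simp add: d)
  show ?thesis
  proof (cases "ip I d d = 0")
    case True
    then have d0: "d r = 0" if "r \<in> I" for r
      using that I by (simp add: ip_self_eq_0)
    then have "unitary_mat I H"
      using I by (auto simp: unitary_mat_def H_def if_distrib[of cnj] if_distrib[of "\<lambda>z. _ * z"] cong: if_cong)
    moreover have "mv I H a r = b r" if "r \<in> I" for r
      using mvH[OF that] d0[OF that] by (simp add: d_def)
    ultimately show ?thesis using fix_z by blast
  next
    case False
    then have \<kappa>0: "\<kappa> \<noteq> 0" using \<kappa> by auto
    have "(\<Sum>r\<in>I. cnj (H r s) * H r t) = (if s = t then 1 else 0)" if "s \<in> I" "t \<in> I" for s t
    proof -
      have "(\<Sum>r\<in>I. cnj (H r s) * H r t) =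
          (\<Sum>r\<in>I. (if r = s then if r = t then 1 else 0 else 0) - (if r = s then d r * cnj (d t) / \<kappa> else 0)
            - (if r = t then d s * cnj (d r) / cnj \<kappa> else 0)
            + d s * cnj (d t) / (\<kappa> * cnj \<kappa>) * (cnj (d r) * d r))"
        by (rule sum.cong) (auto simp: H_def algebra_simps)
      also have "\<dots> = (if s = t then 1 else 0) - d s * cnj (d t) / \<kappa> - d s * cnj (d t) / cnj \<kappa>
          + d s * cnj (d t) / (\<kappa> * cnj \<kappa>) * ip I d d"
        using I that by (simp add: sum.distrib sum_subtractf ip_def sum_distrib_left)
      also have "\<dots> = (if s = t then 1 else 0)"
        unfolding \<kappa>[symmetric] using \<kappa>0 by (simp add: field_simps)
      finally show ?thesis .
    qed
    then have "unitary_mat I H" by (simp add: unitary_mat_def)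
    moreover have "mv I H a r = b r" if "r \<in> I" for r
      using mvH[OF that, of a] \<kappa>0 by (simp add: d_def flip: \<kappa>_def)
    ultimately show ?thesis using fix_z by blast
  qed
qed

lemma unitary_mat_id: "finite I \<Longrightarrow> unitary_mat I (\<lambda>r s. if r = s then 1 else 0)"
  by (auto simp: unitary_mat_def if_distrib[of cnj] if_distrib[of "\<lambda>z. _ * z"] cong: if_cong)

lemma isometry_extension:
  assumes I: "finite I" and J: "finite J"
    and gram: "\<And>j k. j \<in> J \<Longrightarrow> k \<in> J \<Longrightarrow> ip I (\<phi> j) (\<phi> k) = ip I (\<psi> j) (\<psi> k)"
  shows "\<exists>V. unitary_mat I V \<and> (\<forall>j\<in>J. \<forall>r\<in>I. mv I V (\<phi> j) r = \<psi> j r)"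
  using J gram
proof (induction J)
  case empty
  then show ?case using unitary_mat_id[OF I] by auto
next
  case (insert j J)
  then obtain W where W: "unitary_mat I W" "\<And>k r. k \<in> J \<Longrightarrow> r \<in> I \<Longrightarrow> mv I W (\<phi> k) r = \<psi> k r"
    by auto
  define a where "a = mv I W (\<phi> j)"
  have "ip I a a = ip I (\<psi> j) (\<psi> j)"
    using insert.prems[of j j] by (simp add: a_def ip_mv[OF I W(1)])
  from reflection[OF I this] obtain H where H: "unitary_mat I H" "\<And>r. r \<in> I \<Longrightarrow> mv I H a r = \<psi> j r"
    "\<And>z r. ip I a z = ip I (\<psi> j) z \<Longrightarrow> r \<in> I \<Longrightarrow> mv I H z r = z r"
    by auto
  have "mv I (mm I H W) (\<phi> k) r = \<psi> k r" if k: "k \<in> J" and r: "r \<in> I" for k r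
  proof -
    \<comment> \<open>Equality of the Gram matrices makes \<open>\<psi> k\<close> orthogonal to the
      direction of the reflection, so the vectors already placed stay fixed.\<close>
    have "ip I a (mv I W (\<phi> k)) = ip I (\<psi> j) (\<psi> k)"
      using insert.prems[of j k] k by (simp add: a_def ip_mv[OF I W(1)])
    also have "\<dots> = ip I (\<psi> j) (mv I W (\<phi> k))"
      using W(2)[OF k] by (intro ip_cong) auto
    finally show ?thesis
      using H(3) r W(2)[OF k r] by (simp add: mv_mm)
  qed
  moreover have "mv I (mm I H W) (\<phi> j) r = \<psi> j r" if "r \<in> I" for r
    using H(2)[OF that] by (simp add: mv_mm a_def)
  ultimately show ?case
    using unitary_mat_mm[OF I H(1) W(1)] by (intro exI[of _ "mm I H W"]) auto
qed

section \<open>Spectral decomposition\<close>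

definition spectral :: "'i set \<Rightarrow> ('i \<Rightarrow> 'i \<Rightarrow> complex) \<Rightarrow> ('i \<Rightarrow> 'i \<Rightarrow> complex) \<Rightarrow> ('i \<Rightarrow> real) \<Rightarrow> bool" where
  "spectral I H E a \<longleftrightarrow> unitary_mat I E \<and>
     (\<forall>s\<in>I. \<forall>t\<in>I. H s t = (\<Sum>j\<in>I. of_real (a j) * (E s j * cnj (E t j))))"

text \<open>Induction on the index set: an eigenvector is made column \<open>i\<close> of a unitary
  \<open>V\<close>, in whose basis the matrix splits into a real entry at \<open>i\<close> and a
  Hermitian block on \<open>I\<close>.\<close>

lemma ex_spectral:
  assumes "finite I" "\<And>s t. s \<in> I \<Longrightarrow> t \<in> I \<Longrightarrow> H s t = cnj (H t s)"
  shows "\<exists>E a. spectral I H E a"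
  using assms
proof (induction I arbitrary: H)
  case empty
  then show ?case by (auto simp: spectral_def unitary_mat_def)
next
  case (insert i I)
  define J where "J = insert i I"
  have J: "finite J" "J \<noteq> {}" "i \<in> J" "I \<subseteq> J" using insert by (auto simp: J_def)
  have H: "H s t = cnj (H t s)" if "s \<in> J" "t \<in> J" for s t
    using that unfolding J_def by (rule insert.prems)
  obtain v c where v: "ip J v v = 1" and ev: "\<And>s. s \<in> J \<Longrightarrow> mv J H v s = c * v s"
    using ex_eigenvector[OF J(1,2)] by blast
  let ?e = "\<lambda>r. if r = i then 1 else 0 :: complex"
  have "ip J ?e ?e = 1" using J by (simp add: ip_def if_distrib[of cnj] if_distrib[of "\<lambda>z. _ * z"] cong: if_cong)
  then obtain V where V: "unitary_mat J V" and Ve: "\<And>r. r \<in> J \<Longrightarrow> mv J V ?e r = v r"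
    using isometry_extension[of J "{()}" "\<lambda>_. ?e" "\<lambda>_. v"] J v by auto
  have Vi: "V r i = v r" if "r \<in> J" for r
    using Ve[OF that] J by (simp add: mv_def if_distrib[of "\<lambda>z. _ * z"] cong: if_cong)
  define K where "K = mm J (adj V) (mm J H V)"
  have Kh: "K s t = cnj (K t s)" for s t
  proof -
    have "mm J (adj V) (mm J (adj H) V) s t = mm J (adj V) (mm J H V) s t"
      by (simp add: mm_def adj_def H[symmetric])
    moreover have "adj K s t = mm J (adj V) (mm J (adj H) V) s t"
      unfolding K_def adj_mm adj_adj mm_assoc ..
    ultimately show ?thesis by (simp add: K_def adj_def)
  qed
  have Ki: "K s i = (if s = i then c else 0)" if "s \<in> J" for s
  proof -
    have "mm J H V q i = c * v q" if "q \<in> J" for q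
      using ev[OF that] Vi by (simp add: mm_def mv_def)
    then have "K s i = (\<Sum>q\<in>J. cnj (V q s) * (c * V q i))"
      by (simp add: K_def mm_def[of J "adj V"] adj_def Vi)
    also have "\<dots> = c * (\<Sum>q\<in>J. cnj (V q s) * V q i)"
      by (simp add: sum_distrib_left mult_ac)
    finally show ?thesis using V that J by (simp add: unitary_mat_def)
  qed
  have c: "of_real (Re c) = c"
    using Kh[of i i] Ki[OF J(3)] by (metis Reals_cnj_iff of_real_Re)
  obtain E a where E: "spectral I K E a"
    using insert.IH[of K] Kh by blast
  define E' where "E' s j = (if s = i then if j = i then 1 else 0 else if j = i then 0 else E s j)" for s j
  define a' where "a' j = (if j = i then Re c else a j)" for j
  have E': "unitary_mat J E'"
    unfolding unitary_mat_def
  proof (intro ballI)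
    fix s t assume st: "s \<in> J" "t \<in> J"
    have split: "(\<Sum>r\<in>J. cnj (E' r s) * E' r t) = cnj (E' i s) * E' i t + (\<Sum>r\<in>I. cnj (E' r s) * E' r t)"
      using insert.hyps by (simp add: J_def)
    show "(\<Sum>r\<in>J. cnj (E' r s) * E' r t) = (if s = t then 1 else 0)"
    proof (cases "s = i \<or> t = i")
      case True
      then have "(\<Sum>r\<in>I. cnj (E' r s) * E' r t) = 0"
        using insert.hyps by (intro sum.neutral) (auto simp: E'_def)
      then show ?thesis unfolding split using True by (auto simp: E'_def)
    next
      case False
      then have I: "s \<in> I" "t \<in> I" using st by (auto simp: J_def)
      have "(\<Sum>r\<in>I. cnj (E' r s) * E' r t) = (\<Sum>r\<in>I. cnj (E r s) * E r t)"
        using False insert.hyps by (intro sum.cong) (auto simp: E'_def)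
      then show ?thesis
        unfolding split using False E I by (simp add: E'_def spectral_def unitary_mat_def)
    qed
  qed
  have KE: "K s t = (\<Sum>j\<in>J. of_real (a' j) * (E' s j * cnj (E' t j)))" if "s \<in> J" "t \<in> J" for s t
  proof -
    have split: "(\<Sum>j\<in>J. of_real (a' j) * (E' s j * cnj (E' t j)))
        = c * (E' s i * cnj (E' t i)) + (\<Sum>j\<in>I. of_real (a j) * (E' s j * cnj (E' t j)))"
      using insert.hyps unfolding J_def
      by (simp add: a'_def c) (rule sum.cong, auto)
    consider "s = i" | "t = i" | "s \<noteq> i" "t \<noteq> i" "s \<in> I" "t \<in> I" using \<open>s \<in> J\<close> \<open>t \<in> J\<close> J_def by auto
    then show ?thesis
    proof cases
      case 1
      have "(\<Sum>j\<in>I. of_real (a j) * (E' s j * cnj (E' t j))) = 0"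
        using 1 insert.hyps by (intro sum.neutral) (auto simp: E'_def)
      moreover have "K s t = (if t = i then c else 0)"
        using Kh[of s t] Ki[OF \<open>t \<in> J\<close>] 1 c by (metis complex_cnj_complex_of_real complex_cnj_zero)
      ultimately show ?thesis unfolding split using 1 by (simp add: E'_def)
    next
      case 2
      have "(\<Sum>j\<in>I. of_real (a j) * (E' s j * cnj (E' t j))) = 0"
        using 2 insert.hyps by (intro sum.neutral) (auto simp: E'_def)
      then show ?thesis unfolding split using 2 Ki[OF \<open>s \<in> J\<close>] by (simp add: E'_def)
    next
      case 3
      have "(\<Sum>j\<in>I. of_real (a j) * (E' s j * cnj (E' t j))) = (\<Sum>j\<in>I. of_real (a j) * (E s j * cnj (E t j)))"
        using 3 insert.hyps by (intro sum.cong) (auto simp: E'_def)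
      then show ?thesis unfolding split using 3 E by (simp add: E'_def spectral_def)
    qed
  qed
  have "H s t = (\<Sum>j\<in>J. of_real (a' j) * (mm J V E' s j * cnj (mm J V E' t j)))" if st: "s \<in> J" "t \<in> J" for s t
  proof -
    define X where "X = mm J V (adj V)"
    have X: "is_id J X" unfolding X_def by (rule unitary_mat_right[OF J(1) V])
    have "H s t = mm J X H s t" by (rule mm_id_left[OF J(1) X st(1), symmetric])
    also have "\<dots> = mm J X (mm J H X) s t"
      by (intro mm_cong mm_id_right[symmetric] J X st refl)
    also have "\<dots> = mm J V (mm J K (adj V)) s t"
      by (simp add: X_def K_def mm_assoc)
    also have "\<dots> = (\<Sum>p\<in>J. \<Sum>q\<in>J. V s p * K p q * cnj (V t q))"
      by (simp add: mm_def adj_def sum_distrib_left mult_ac)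
    also have "\<dots> = (\<Sum>p\<in>J. \<Sum>q\<in>J. \<Sum>j\<in>J. of_real (a' j) * ((V s p * E' p j) * (cnj (V t q) * cnj (E' q j))))"
      by (intro sum.cong refl) (simp add: KE sum_distrib_left sum_distrib_right mult_ac)
    also have "\<dots> = (\<Sum>p\<in>J. \<Sum>j\<in>J. \<Sum>q\<in>J. of_real (a' j) * ((V s p * E' p j) * (cnj (V t q) * cnj (E' q j))))"
      by (intro sum.cong sum.swap refl)
    also have "\<dots> = (\<Sum>j\<in>J. \<Sum>p\<in>J. \<Sum>q\<in>J. of_real (a' j) * ((V s p * E' p j) * (cnj (V t q) * cnj (E' q j))))"
      by (rule sum.swap)
    also have "\<dots> = (\<Sum>j\<in>J. of_real (a' j) * (mm J V E' s j * cnj (mm J V E' t j)))"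
      unfolding mm_def cnj_sum complex_cnj_mult sum_product by (simp only: sum_distrib_left)
    finally show ?thesis .
  qed
  then have "spectral J H (mm J V E') a'"
    using unitary_mat_mm[OF J(1) V E'] by (simp add: spectral_def)
  then show ?case by (auto simp: J_def)
qed

section \<open>Entropy of density matrices\<close>

definition quad :: "'i set \<Rightarrow> ('i \<Rightarrow> 'i \<Rightarrow> complex) \<Rightarrow> ('i \<Rightarrow> complex) \<Rightarrow> real" where
  "quad I \<rho> z = Re (ip I z (mv I \<rho> z))"

definition density_mat :: "'i set \<Rightarrow> ('i \<Rightarrow> 'i \<Rightarrow> complex) \<Rightarrow> bool" where
  "density_mat I \<rho> \<longleftrightarrow> (\<forall>s\<in>I. \<forall>t\<in>I. \<rho> s t = cnj (\<rho> t s)) \<and> (\<forall>z. quad I \<rho> z \<ge> 0) \<and> (\<Sum>s\<in>I. \<rho> s s) = 1"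

text \<open>One eigensystem is fixed for each matrix, so that the entropy and the square root are
  built from the same eigenvectors.\<close>

definition eigensystem :: "'i set \<Rightarrow> ('i \<Rightarrow> 'i \<Rightarrow> complex) \<Rightarrow> ('i \<Rightarrow> 'i \<Rightarrow> complex) \<times> ('i \<Rightarrow> real)" where
  "eigensystem I \<rho> = (SOME (E, a). spectral I \<rho> E a)"

definition eigbasis where "eigbasis I \<rho> = fst (eigensystem I \<rho>)"
definition eigval where "eigval I \<rho> = snd (eigensystem I \<rho>)"

text \<open>Minus the von Neumann entropy, in nats.\<close>

definition negentropy :: "'i set \<Rightarrow> ('i \<Rightarrow> 'i \<Rightarrow> complex) \<Rightarrow> real" where
  "negentropy I \<rho> = (\<Sum>j\<in>I. eigval I \<rho> j * ln (eigval I \<rho> j))"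

abbreviation (input) column :: "('i \<Rightarrow> 'j \<Rightarrow> complex) \<Rightarrow> 'j \<Rightarrow> 'i \<Rightarrow> complex" where
  "column E j \<equiv> (\<lambda>s. E s j)"

lemma density_matD:
  assumes "density_mat I \<rho>"
  shows "s \<in> I \<Longrightarrow> t \<in> I \<Longrightarrow> \<rho> s t = cnj (\<rho> t s)" "quad I \<rho> z \<ge> 0" "(\<Sum>s\<in>I. \<rho> s s) = 1"
  using assms unfolding density_mat_def by blast+

lemma spectral_eigensystem:
  assumes "finite I" "density_mat I \<rho>"
  shows "spectral I \<rho> (eigbasis I \<rho>) (eigval I \<rho>)"
proof -
  have "\<exists>E a. spectral I \<rho> E a"
    using assms(1) density_matD(1)[OF assms(2)] by (rule ex_spectral)
  then have "case eigensystem I \<rho> of (E, a) \<Rightarrow> spectral I \<rho> E a"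
    unfolding eigensystem_def by (intro someI_ex[of "\<lambda>p. case p of (E, a) \<Rightarrow> spectral I \<rho> E a"]) auto
  then show ?thesis by (simp add: eigbasis_def eigval_def case_prod_unfold)
qed

lemma quad_spectral:
  assumes "spectral I \<rho> E a"
  shows "quad I \<rho> z = (\<Sum>j\<in>I. a j * (cmod (ip I (column E j) z))\<^sup>2)"
proof -
  have "ip I z (mv I \<rho> z) = (\<Sum>s\<in>I. \<Sum>t\<in>I. \<Sum>j\<in>I. of_real (a j) * ((cnj (z s) * E s j) * (cnj (E t j) * z t)))"
    unfolding ip_def mv_def sum_distrib_left using assms
    by (intro sum.cong refl) (simp add: spectral_def sum_distrib_left sum_distrib_right mult_ac)
  also have "\<dots> = (\<Sum>s\<in>I. \<Sum>j\<in>I. \<Sum>t\<in>I. of_real (a j) * ((cnj (z s) * E s j) * (cnj (E t j) * z t)))"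
    by (intro sum.cong sum.swap refl)
  also have "\<dots> = (\<Sum>j\<in>I. \<Sum>s\<in>I. \<Sum>t\<in>I. of_real (a j) * ((cnj (z s) * E s j) * (cnj (E t j) * z t)))"
    by (rule sum.swap)
  also have "\<dots> = (\<Sum>j\<in>I. of_real (a j) * (cnj (ip I (column E j) z) * ip I (column E j) z))"
    unfolding cnj_ip unfolding ip_def sum_product by (simp only: sum_distrib_left)
  also have "\<dots> = (\<Sum>j\<in>I. of_real (a j * (cmod (ip I (column E j) z))\<^sup>2))"
    by (simp add: complex_norm_square mult.commute del: of_real_power)
  finally show ?thesis by (simp add: quad_def)
qed

section \<open>Overlaps of orthonormal bases and distributions of eigenvalues\<close>

lemma unitary_mat_adj: "finite I \<Longrightarrow> unitary_mat I U \<Longrightarrow> unitary_mat I (adj U)"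
  using unitary_mat_right[of I U] by (simp add: unitary_mat_iff)

lemma parseval:
  assumes "finite I" "unitary_mat I E"
  shows "(\<Sum>j\<in>I. (cmod (ip I (column E j) z))\<^sup>2) = (\<Sum>r\<in>I. (cmod (z r))\<^sup>2)"
proof -
  have "ip I (mv I (adj E) z) (mv I (adj E) z) = ip I z z"
    by (rule ip_mv[OF assms(1) unitary_mat_adj[OF assms]])
  moreover have "mv I (adj E) z j = ip I (column E j) z" for j
    by (simp add: mv_def adj_def ip_def)
  ultimately show ?thesis unfolding ip_self of_real_eq_iff by simp
qed

lemma column_norm: "unitary_mat I G \<Longrightarrow> k \<in> I \<Longrightarrow> (\<Sum>r\<in>I. (cmod (G r k))\<^sup>2) = 1"
proof -
  assume "unitary_mat I G" "k \<in> I"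
  then have "ip I (column G k) (column G k) = 1" by (simp add: ip_def unitary_mat_def)
  then show ?thesis unfolding ip_self by (simp only: of_real_eq_1_iff)
qed

text \<open>By Parseval in either basis, the squared overlaps form a doubly stochastic
  matrix.\<close>

lemma overlap_sums:
  assumes "finite I" "unitary_mat I E" "unitary_mat I G" "k \<in> I"
  shows "(\<Sum>j\<in>I. (cmod (ip I (column E j) (column G k)))\<^sup>2) = 1"
    "(\<Sum>j\<in>I. (cmod (ip I (column E k) (column G j)))\<^sup>2) = 1"
proof -
  show "(\<Sum>j\<in>I. (cmod (ip I (column E j) (column G k)))\<^sup>2) = 1"
    using parseval[OF assms(1,2)] column_norm[OF assms(3,4)] by simp
  have "cmod (ip I (column E k) (column G j)) = cmod (ip I (column G j) (column E k))" for j
    by (metis cnj_ip complex_mod_cnj)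
  then show "(\<Sum>j\<in>I. (cmod (ip I (column E k) (column G j)))\<^sup>2) = 1"
    using parseval[OF assms(1,3)] column_norm[OF assms(2,4)] by simp
qed

lemma eigval_nonneg_sum:
  assumes I: "finite I" and \<rho>: "density_mat I \<rho>" and E: "spectral I \<rho> E a"
  shows "\<And>k. k \<in> I \<Longrightarrow> a k = quad I \<rho> (column E k)" "\<And>k. k \<in> I \<Longrightarrow> a k \<ge> 0" "sum a I = 1"
proof -
  show *: "a k = quad I \<rho> (column E k)" if "k \<in> I" for k
  proof -
    have "ip I (column E j) (column E k) = (if j = k then 1 else 0)" if "j \<in> I" for j
      using E \<open>k \<in> I\<close> that by (simp add: spectral_def unitary_mat_def ip_def)
    then have "quad I \<rho> (column E k) = (\<Sum>j\<in>I. if j = k then a j else 0)"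
      unfolding quad_spectral[OF E] by (intro sum.cong) auto
    then show ?thesis using I that by simp
  qed
  show "a k \<ge> 0" if "k \<in> I" for k
    using *[OF that] density_matD(2)[OF \<rho>] by simp
  have "(\<Sum>s\<in>I. \<rho> s s) = (\<Sum>s\<in>I. \<Sum>j\<in>I. of_real (a j * (cmod (E s j))\<^sup>2))"
    using E by (intro sum.cong) (auto simp: spectral_def complex_norm_square simp del: of_real_power)
  also have "\<dots> = (\<Sum>j\<in>I. \<Sum>s\<in>I. of_real (a j * (cmod (E s j))\<^sup>2))"
    by (rule sum.swap)
  also have "\<dots> = of_real (\<Sum>j\<in>I. a j * (\<Sum>s\<in>I. (cmod (E s j))\<^sup>2))"
    by (simp add: sum_distrib_left)
  also have "\<dots> = of_real (sum a I)"
    using E by (intro arg_cong[of _ _ of_real] sum.cong) (auto simp: spectral_def column_norm)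
  finally show "sum a I = 1"
    using density_matD(3)[OF \<rho>] by (metis of_real_eq_1_iff)
qed

text \<open>The relative entropy of density matrices with eigenvalues \<open>a\<close> and \<open>b\<close> is the classical relative
  entropy of the distributions \<open>a j * ov j k\<close> and \<open>b k * ov j k\<close> (Nussbaum and Szkola), where
  \<open>ov j k\<close> is the squared overlap of the eigenvectors.\<close>

context
  fixes I :: "'i set" and a b :: "'i \<Rightarrow> real" and ov :: "'i \<Rightarrow> 'i \<Rightarrow> real"
  assumes I: "finite I" and a: "\<And>j. j \<in> I \<Longrightarrow> a j \<ge> 0" "sum a I = 1"
    and b: "\<And>j. j \<in> I \<Longrightarrow> b j \<ge> 0" "sum b I = 1"
    and ov: "\<And>j k. ov j k \<ge> 0" "\<And>j. j \<in> I \<Longrightarrow> (\<Sum>k\<in>I. ov j k) = 1" "\<And>k. k \<in> I \<Longrightarrow> (\<Sum>j\<in>I. ov j k) = 1"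
    and ac: "\<And>k. k \<in> I \<Longrightarrow> b k = 0 \<Longrightarrow> (\<Sum>j\<in>I. a j * ov j k) = 0"
begin

text \<open>With \<rho> and \<sigma> the two density matrices, the left side is tr(\<rho> ln \<rho>)
  - tr(\<rho> ln \<sigma>), since \<open>\<Sum>j\<in>I. a j * ov j k\<close> is the quadratic form
  of \<rho> at the eigenvector \<open>k\<close> of \<sigma>. On the right \<open>ov j k\<close> has
  cancelled from the likelihood ratio.\<close>

lemma relative_entropy_pair:
  "(\<Sum>j\<in>I. a j * ln (a j)) - (\<Sum>k\<in>I. (\<Sum>j\<in>I. a j * ov j k) * ln (b k))
    = (\<Sum>(j, k)\<in>I \<times> I. a j * ov j k * (ln (a j) - ln (b k)))"
proof -
  have "(\<Sum>(j, k)\<in>I \<times> I. a j * ov j k * (ln (a j) - ln (b k)))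
      = (\<Sum>j\<in>I. \<Sum>k\<in>I. a j * ln (a j) * ov j k) - (\<Sum>j\<in>I. \<Sum>k\<in>I. a j * ov j k * ln (b k))"
    unfolding sum.cartesian_product[symmetric] by (simp add: algebra_simps sum_subtractf)
  also have "(\<Sum>j\<in>I. \<Sum>k\<in>I. a j * ln (a j) * ov j k) = (\<Sum>j\<in>I. a j * ln (a j))"
    unfolding sum_distrib_left[symmetric] using ov by (intro sum.cong) auto
  also have "(\<Sum>j\<in>I. \<Sum>k\<in>I. a j * ov j k * ln (b k)) = (\<Sum>k\<in>I. \<Sum>j\<in>I. a j * ov j k * ln (b k))"
    by (rule sum.swap)
  finally show ?thesis by (simp add: sum_distrib_right)
qed

lemma pair_weights:
  "\<And>i. i \<in> I \<times> I \<Longrightarrow> (case i of (j, k) \<Rightarrow> a j * ov j k) \<ge> 0"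
  "(\<Sum>(j, k)\<in>I \<times> I. a j * ov j k) = 1"
  using a ov by (auto simp: sum.cartesian_product[symmetric] sum_distrib_left[symmetric])

text \<open>The assumption \<open>ac\<close> amounts to absolute continuity of the first
  distribution with respect to the second.\<close>

lemma pair_weights_pos:
  assumes "j \<in> I" "k \<in> I" "a j * ov j k > 0"
  shows "a j > 0" "b k > 0"
proof -
  show "a j > 0" using a(1)[OF assms(1)] assms(3) by (cases "a j = 0") auto
  have "(\<Sum>j\<in>I. a j * ov j k) > 0"
    using assms a ov I by (intro sum_pos2[of I j]) auto
  then show "b k > 0" using ac[OF assms(2)] b(1)[OF assms(2)] by (cases "b k = 0") auto
qed

lemma pair_jensen:
  assumes r: "\<And>j k. j \<in> I \<Longrightarrow> k \<in> I \<Longrightarrow> r j k \<ge> (0::real)"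
    "\<And>j k. j \<in> I \<Longrightarrow> k \<in> I \<Longrightarrow> a j > 0 \<Longrightarrow> b k > 0 \<Longrightarrow> r j k > 0"
  shows "0 < (\<Sum>(j, k)\<in>I \<times> I. a j * ov j k * r j k)"
    "(\<Sum>(j, k)\<in>I \<times> I. a j * ov j k * ln (r j k)) \<le> ln (\<Sum>(j, k)\<in>I \<times> I. a j * ov j k * r j k)"
proof -
  have fin: "finite (I \<times> I)" using I by simp
  have w: "a (fst i) * ov (fst i) (snd i) \<ge> 0" "r (fst i) (snd i) \<ge> 0" if "i \<in> I \<times> I" for i
    using that a(1) ov(1) r(1) by auto
  have pos: "r (fst i) (snd i) > 0" if "i \<in> I \<times> I" "a (fst i) * ov (fst i) (snd i) > 0" for i
    using that pair_weights_pos[of "fst i" "snd i"] r(2)[of "fst i" "snd i"] by auto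
  have sum: "(\<Sum>i\<in>I \<times> I. a (fst i) * ov (fst i) (snd i)) = 1"
    using pair_weights(2) by (simp add: case_prod_unfold)
  show "0 < (\<Sum>(j, k)\<in>I \<times> I. a j * ov j k * r j k)"
    using jensen_ln(1)[OF fin w(1) sum w(2) pos] by (simp add: case_prod_unfold)
  show "(\<Sum>(j, k)\<in>I \<times> I. a j * ov j k * ln (r j k)) \<le> ln (\<Sum>(j, k)\<in>I \<times> I. a j * ov j k * r j k)"
    using jensen_ln(2)[OF fin w(1) sum w(2) pos] by (simp add: case_prod_unfold)
qed

text \<open>Jensen for the square root of the inverse likelihood ratio bounds the relative entropy
  below by - 2 ln F, and - ln(F^2) \<ge> 1 - F^2. Here F is the Bhattacharyya coefficient of the two
  distributions, which is the trace of the product of the two matrix square roots.\<close>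

lemma relative_entropy_ge_fidelity:
  "1 - (\<Sum>(j, k)\<in>I \<times> I. sqrt (a j * b k) * ov j k)\<^sup>2
    \<le> (\<Sum>j\<in>I. a j * ln (a j)) - (\<Sum>k\<in>I. (\<Sum>j\<in>I. a j * ov j k) * ln (b k))"
proof -
  define F where "F = (\<Sum>(j, k)\<in>I \<times> I. sqrt (a j * b k) * ov j k)"
  have FF: "F = (\<Sum>(j, k)\<in>I \<times> I. a j * ov j k * sqrt (b k / a j))"
    unfolding F_def
  proof (intro sum.cong refl, clarify)
    fix j k assume "j \<in> I" "k \<in> I"
    then have "sqrt (a j) * sqrt (a j) = a j" using a by simp
    then show "sqrt (a j * b k) * ov j k = a j * ov j k * sqrt (b k / a j)"
      by (cases "a j = 0") (auto simp: real_sqrt_mult real_sqrt_divide field_simps)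
  qed
  have F: "F > 0" "(\<Sum>(j, k)\<in>I \<times> I. a j * ov j k * ln (sqrt (b k / a j))) \<le> ln F"
    unfolding FF by (rule pair_jensen[of "\<lambda>j k. sqrt (b k / a j)"]; use a b in simp)+
  have "(\<Sum>(j, k)\<in>I \<times> I. a j * ov j k * (ln (a j) - ln (b k)))
      = (\<Sum>(j, k)\<in>I \<times> I. - 2 * (a j * ov j k * ln (sqrt (b k / a j))))"
  proof (intro sum.cong refl, clarify)
    fix j k assume jk: "j \<in> I" "k \<in> I"
    show "a j * ov j k * (ln (a j) - ln (b k)) = - 2 * (a j * ov j k * ln (sqrt (b k / a j)))"
    proof (cases "a j * ov j k > 0")
      case True
      from pair_weights_pos[OF jk this] have "ln (sqrt (b k / a j)) = (ln (b k) - ln (a j)) / 2"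
        by (simp add: ln_sqrt ln_div)
      then show ?thesis by (simp only:) (simp add: algebra_simps)
    next
      case False
      then have "a j * ov j k = 0" using a(1)[OF jk(1)] ov(1)[of j k] by (meson antisym_conv mult_nonneg_nonneg not_less)
      then show ?thesis by auto
    qed
  qed
  also have "\<dots> = - 2 * (\<Sum>(j, k)\<in>I \<times> I. a j * ov j k * ln (sqrt (b k / a j)))"
    by (simp add: sum_distrib_left case_prod_unfold)
  also have "\<dots> \<ge> - 2 * ln F"
    using F(2) by simp
  moreover have "2 * ln F = ln (F\<^sup>2)" using F(1) by (simp add: ln_realpow)
  moreover have "ln (F\<^sup>2) \<le> F\<^sup>2 - 1" using F(1) by (intro ln_le_minus_one) auto
  ultimately show ?thesis
    unfolding relative_entropy_pair F_def[symmetric] by linarith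
qed

text \<open>Nonnegativity of relative entropy: Jensen for the inverse likelihood ratio, whose mean
  is at most 1. It can be less than 1 because pairs with \<open>a j = 0\<close> drop out.\<close>

lemma gibbs:
  "(\<Sum>k\<in>I. (\<Sum>j\<in>I. a j * ov j k) * ln (b k)) \<le> (\<Sum>j\<in>I. a j * ln (a j))"
proof -
  have "(\<Sum>(j, k)\<in>I \<times> I. a j * ov j k * (b k / a j)) \<le> (\<Sum>(j, k)\<in>I \<times> I. b k * ov j k)"
    using a b ov by (intro sum_mono) (auto simp: mult_ac)
  also have "\<dots> = (\<Sum>j\<in>I. \<Sum>k\<in>I. b k * ov j k)"
    by (simp add: sum.cartesian_product)
  also have "\<dots> = (\<Sum>k\<in>I. \<Sum>j\<in>I. b k * ov j k)"
    by (rule sum.swap)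
  also have "\<dots> = 1"
    unfolding sum_distrib_left[symmetric] using b ov by simp
  finally have le1: "(\<Sum>(j, k)\<in>I \<times> I. a j * ov j k * (b k / a j)) \<le> 1" .
  have r: "\<And>j k. j \<in> I \<Longrightarrow> k \<in> I \<Longrightarrow> b k / a j \<ge> 0"
    "\<And>j k. j \<in> I \<Longrightarrow> k \<in> I \<Longrightarrow> a j > 0 \<Longrightarrow> b k > 0 \<Longrightarrow> b k / a j > 0"
    using a b by auto
  note J = pair_jensen[of "\<lambda>j k. b k / a j", OF r]
  have "ln (\<Sum>(j, k)\<in>I \<times> I. a j * ov j k * (b k / a j)) \<le> 0"
    using J(1) le1 by (simp add: ln_le_zero_iff)
  then have "(\<Sum>(j, k)\<in>I \<times> I. a j * ov j k * ln (b k / a j)) \<le> 0"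
    using J(2) by linarith
  moreover have "(\<Sum>(j, k)\<in>I \<times> I. a j * ov j k * (ln (a j) - ln (b k)))
      = (\<Sum>(j, k)\<in>I \<times> I. - (a j * ov j k * ln (b k / a j)))"
  proof (intro sum.cong refl, clarify)
    fix j k assume jk: "j \<in> I" "k \<in> I"
    show "a j * ov j k * (ln (a j) - ln (b k)) = - (a j * ov j k * ln (b k / a j))"
    proof (cases "a j * ov j k > 0")
      case True
      from pair_weights_pos[OF jk this] have "ln (b k / a j) = ln (b k) - ln (a j)"
        by (simp add: ln_div)
      then show ?thesis by (simp only:) (simp add: algebra_simps)
    next
      case False
      then have "a j * ov j k = 0" using a(1)[OF jk(1)] ov(1)[of j k] by (meson antisym_conv mult_nonneg_nonneg not_less)
      then show ?thesis by auto
    qed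
  qed
  moreover have "\<dots> = - (\<Sum>(j, k)\<in>I \<times> I. a j * ov j k * ln (b k / a j))"
    by (simp add: sum_negf case_prod_unfold)
  ultimately show ?thesis using relative_entropy_pair by linarith
qed

text \<open>Jensen in the other direction: relative entropy is at most the logarithm of the mean
  likelihood ratio, the Renyi divergence of order 2. This turns an operator inequality between
  density matrices into an entropy bound without operator monotonicity of the logarithm.\<close>

lemma relative_entropy_le:
  assumes "(\<Sum>j\<in>I. a j * (\<Sum>k\<in>I. a j * ov j k / b k)) \<le> C"
  shows "(\<Sum>j\<in>I. a j * ln (a j)) \<le> (\<Sum>k\<in>I. (\<Sum>j\<in>I. a j * ov j k) * ln (b k)) + ln C"
proof -
  have r: "\<And>j k. j \<in> I \<Longrightarrow> k \<in> I \<Longrightarrow> a j / b k \<ge> 0"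
    "\<And>j k. j \<in> I \<Longrightarrow> k \<in> I \<Longrightarrow> a j > 0 \<Longrightarrow> b k > 0 \<Longrightarrow> a j / b k > 0"
    using a b by auto
  note J = pair_jensen[of "\<lambda>j k. a j / b k", OF r]
  have "(\<Sum>(j, k)\<in>I \<times> I. a j * ov j k * (a j / b k)) = (\<Sum>j\<in>I. a j * (\<Sum>k\<in>I. a j * ov j k / b k))"
    unfolding sum.cartesian_product[symmetric] by (simp add: sum_distrib_left mult_ac)
  then have "ln (\<Sum>(j, k)\<in>I \<times> I. a j * ov j k * (a j / b k)) \<le> ln C"
    using J(1) assms by simp
  then have "(\<Sum>(j, k)\<in>I \<times> I. a j * ov j k * ln (a j / b k)) \<le> ln C"
    using J(2) by linarith
  moreover have "(\<Sum>(j, k)\<in>I \<times> I. a j * ov j k * (ln (a j) - ln (b k)))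
      = (\<Sum>(j, k)\<in>I \<times> I. a j * ov j k * ln (a j / b k))"
  proof (intro sum.cong refl, clarify)
    fix j k assume jk: "j \<in> I" "k \<in> I"
    show "a j * ov j k * (ln (a j) - ln (b k)) = a j * ov j k * ln (a j / b k)"
    proof (cases "a j * ov j k > 0")
      case True
      from pair_weights_pos[OF jk this] show ?thesis by (simp add: ln_div)
    next
      case False
      then have "a j * ov j k = 0" using a(1)[OF jk(1)] ov(1)[of j k] by (meson antisym_conv mult_nonneg_nonneg not_less)
      then show ?thesis by auto
    qed
  qed
  ultimately show ?thesis using relative_entropy_pair by linarith
qed

end

subsection \<open>Canonical purifications\<close>

text \<open>The matrix square root of \<open>\<rho>\<close>, read as a vector of a doubled system, is a purification of \<open>\<rho>\<close>.\<close>

definition sqrt_mat :: "'i set \<Rightarrow> ('i \<Rightarrow> 'i \<Rightarrow> complex) \<Rightarrow> 'i \<Rightarrow> 'i \<Rightarrow> complex" where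
  "sqrt_mat I \<rho> s t = (\<Sum>j\<in>I. of_real (sqrt (eigval I \<rho> j)) * (eigbasis I \<rho> s j * cnj (eigbasis I \<rho> t j)))"

text \<open>The inner product of the canonical purifications, equal to the trace of the product of
  the square roots.\<close>

definition affinity :: "'i set \<Rightarrow> ('i \<Rightarrow> 'i \<Rightarrow> complex) \<Rightarrow> ('i \<Rightarrow> 'i \<Rightarrow> complex) \<Rightarrow> complex" where
  "affinity I \<rho> \<sigma> = (\<Sum>s\<in>I. \<Sum>t\<in>I. cnj (sqrt_mat I \<rho> s t) * sqrt_mat I \<sigma> s t)"

text \<open>The sum over \<open>r\<close> traces out the second copy of the system; orthonormality
  of the eigenvectors reduces it to the spectral decomposition.\<close>

lemma sqrt_mat_gram:
  assumes I: "finite I" and \<rho>: "density_mat I \<rho>" and st: "s \<in> I" "t \<in> I"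
  shows "(\<Sum>r\<in>I. sqrt_mat I \<rho> s r * cnj (sqrt_mat I \<rho> t r)) = \<rho> s t"
proof -
  define E where "E = eigbasis I \<rho>"
  define a where "a = eigval I \<rho>"
  have sp: "spectral I \<rho> E a" unfolding E_def a_def by (rule spectral_eigensystem[OF I \<rho>])
  note a = eigval_nonneg_sum[OF I \<rho> sp]
  have "(\<Sum>r\<in>I. sqrt_mat I \<rho> s r * cnj (sqrt_mat I \<rho> t r))
      = (\<Sum>r\<in>I. \<Sum>j\<in>I. \<Sum>k\<in>I. (of_real (sqrt (a j)) * of_real (sqrt (a k)) * E s j * cnj (E t k)) * (cnj (E r j) * E r k))"
    unfolding sqrt_mat_def E_def a_def cnj_sum sum_product by (intro sum.cong refl) (simp add: mult_ac)
  also have "\<dots> = (\<Sum>j\<in>I. \<Sum>r\<in>I. \<Sum>k\<in>I. (of_real (sqrt (a j)) * of_real (sqrt (a k)) * E s j * cnj (E t k)) * (cnj (E r j) * E r k))"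
    by (rule sum.swap)
  also have "\<dots> = (\<Sum>j\<in>I. \<Sum>k\<in>I. (of_real (sqrt (a j)) * of_real (sqrt (a k)) * E s j * cnj (E t k)) * (\<Sum>r\<in>I. cnj (E r j) * E r k))"
    unfolding sum_distrib_left by (intro sum.cong sum.swap refl)
  also have "\<dots> = (\<Sum>j\<in>I. \<Sum>k\<in>I. if j = k then of_real (a j) * (E s j * cnj (E t k)) else 0)"
  proof (intro sum.cong refl)
    fix j k assume jk: "j \<in> I" "k \<in> I"
    have "complex_of_real (sqrt (a j)) * of_real (sqrt (a j)) = of_real (a j)"
      using a(2)[OF jk(1)] by (simp flip: of_real_mult)
    then show "(of_real (sqrt (a j)) * of_real (sqrt (a k)) * E s j * cnj (E t k)) * (\<Sum>r\<in>I. cnj (E r j) * E r k)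
        = (if j = k then of_real (a j) * (E s j * cnj (E t k)) else 0)"
      using sp jk by (cases "j = k") (simp_all add: spectral_def unitary_mat_def)
  qed
  also have "\<dots> = (\<Sum>j\<in>I. of_real (a j) * (E s j * cnj (E t j)))"
    using I by simp
  also have "\<dots> = \<rho> s t" using sp st by (simp add: spectral_def)
  finally show ?thesis .
qed

text \<open>Expanding both roots in their eigenbases produces each overlap together with its
  conjugate; so the affinity is real and is exactly the coefficient occurring in
  \<open>relative_entropy_ge_fidelity\<close>.\<close>

lemma affinity_eq:
  assumes I: "finite I"
  shows "affinity I \<rho> \<sigma> = of_real (\<Sum>(j, k)\<in>I \<times> I. sqrt (eigval I \<rho> j * eigval I \<sigma> k) *
    (cmod (ip I (column (eigbasis I \<rho>) j) (column (eigbasis I \<sigma>) k)))\<^sup>2)"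
proof -
  define E where "E = eigbasis I \<rho>"
  define G where "G = eigbasis I \<sigma>"
  define x where "x j k = complex_of_real (sqrt (eigval I \<rho> j) * sqrt (eigval I \<sigma> k))" for j k
  have "affinity I \<rho> \<sigma> = (\<Sum>s\<in>I. \<Sum>t\<in>I. \<Sum>j\<in>I. \<Sum>k\<in>I. x j k * ((cnj (E s j) * G s k) * (E t j * cnj (G t k))))"
    unfolding affinity_def sqrt_mat_def E_def G_def x_def cnj_sum sum_product
    by (intro sum.cong refl) (simp add: mult_ac)
  also have "\<dots> = (\<Sum>s\<in>I. \<Sum>t\<in>I. \<Sum>i\<in>I\<times>I. x (fst i) (snd i) * ((cnj (E s (fst i)) * G s (snd i)) * (E t (fst i) * cnj (G t (snd i)))))"
    by (simp add: sum.cartesian_product case_prod_unfold)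
  also have "\<dots> = (\<Sum>s\<in>I. \<Sum>i\<in>I\<times>I. \<Sum>t\<in>I. x (fst i) (snd i) * ((cnj (E s (fst i)) * G s (snd i)) * (E t (fst i) * cnj (G t (snd i)))))"
    by (intro sum.cong sum.swap refl)
  also have "\<dots> = (\<Sum>i\<in>I\<times>I. \<Sum>s\<in>I. \<Sum>t\<in>I. x (fst i) (snd i) * ((cnj (E s (fst i)) * G s (snd i)) * (E t (fst i) * cnj (G t (snd i)))))"
    by (rule sum.swap)
  also have "\<dots> = (\<Sum>i\<in>I\<times>I. x (fst i) (snd i) * (ip I (column E (fst i)) (column G (snd i)) * cnj (ip I (column E (fst i)) (column G (snd i)))))"
    unfolding ip_def cnj_sum sum_product by (simp add: sum_distrib_left)
  also have "\<dots> = (\<Sum>i\<in>I\<times>I. of_real (sqrt (eigval I \<rho> (fst i) * eigval I \<sigma> (snd i)) * (cmod (ip I (column E (fst i)) (column G (snd i))))\<^sup>2))"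
    by (simp add: x_def complex_norm_square real_sqrt_mult del: of_real_power)
  finally show ?thesis by (simp add: E_def G_def case_prod_unfold)
qed

section \<open>Mixtures of density matrices\<close>

lemma quad_mixture:
  assumes "\<And>s t. s \<in> I \<Longrightarrow> t \<in> I \<Longrightarrow> \<rho> s t = (\<Sum>x\<in>X. of_real (w x) * \<rho>' x s t)"
  shows "quad I \<rho> z = (\<Sum>x\<in>X. w x * quad I (\<rho>' x) z)"
proof -
  have "ip I z (mv I \<rho> z) = (\<Sum>s\<in>I. \<Sum>t\<in>I. \<Sum>x\<in>X. of_real (w x) * (cnj (z s) * (\<rho>' x s t * z t)))"
    unfolding ip_def mv_def sum_distrib_left
    by (intro sum.cong refl) (simp add: assms sum_distrib_left sum_distrib_right mult_ac)
  also have "\<dots> = (\<Sum>s\<in>I. \<Sum>x\<in>X. \<Sum>t\<in>I. of_real (w x) * (cnj (z s) * (\<rho>' x s t * z t)))"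
    by (intro sum.cong sum.swap refl)
  also have "\<dots> = (\<Sum>x\<in>X. \<Sum>s\<in>I. \<Sum>t\<in>I. of_real (w x) * (cnj (z s) * (\<rho>' x s t * z t)))"
    by (rule sum.swap)
  also have "\<dots> = (\<Sum>x\<in>X. of_real (w x) * ip I z (mv I (\<rho>' x) z))"
    by (simp add: ip_def mv_def sum_distrib_left)
  finally show ?thesis by (simp add: quad_def)
qed

text \<open>The right side is the Holevo quantity, which is the mean relative entropy of the
  components to their average, because the cross terms average to
  \<open>negentropy I \<rho>\<close>. Each relative entropy is then bounded below through the
  overlap.\<close>

lemma negentropy_increment:
  assumes I: "finite I" and X: "finite X" and w: "\<And>x. x \<in> X \<Longrightarrow> w x > 0"
    and \<rho>: "density_mat I \<rho>" and \<rho>': "\<And>x. x \<in> X \<Longrightarrow> density_mat I (\<rho>' x)"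
    and mix: "\<And>s t. s \<in> I \<Longrightarrow> t \<in> I \<Longrightarrow> \<rho> s t = (\<Sum>x\<in>X. of_real (w x) * \<rho>' x s t)"
  shows "(\<Sum>x\<in>X. w x * (1 - (cmod (affinity I (\<rho>' x) \<rho>))\<^sup>2)) \<le> (\<Sum>x\<in>X. w x * negentropy I (\<rho>' x)) - negentropy I \<rho>"
proof -
  define G where "G = eigbasis I \<rho>"
  define b where "b = eigval I \<rho>"
  have G: "spectral I \<rho> G b" unfolding G_def b_def by (rule spectral_eigensystem[OF I \<rho>])
  note b = eigval_nonneg_sum[OF I \<rho> G]
  have qmix: "b k = (\<Sum>x\<in>X. w x * quad I (\<rho>' x) (column G k))" if "k \<in> I" for k
    unfolding b(1)[OF that] by (rule quad_mixture[OF mix])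
  have step: "1 - (cmod (affinity I (\<rho>' x) \<rho>))\<^sup>2 \<le> negentropy I (\<rho>' x) - (\<Sum>k\<in>I. quad I (\<rho>' x) (column G k) * ln (b k))"
    if x: "x \<in> X" for x
  proof -
    define E where "E = eigbasis I (\<rho>' x)"
    define a where "a = eigval I (\<rho>' x)"
    have E: "spectral I (\<rho>' x) E a" unfolding E_def a_def by (rule spectral_eigensystem[OF I \<rho>'[OF x]])
    note a = eigval_nonneg_sum[OF I \<rho>'[OF x] E]
    define ov where "ov j k = (cmod (ip I (column E j) (column G k)))\<^sup>2" for j k
    have q: "quad I (\<rho>' x) (column G k) = (\<Sum>j\<in>I. a j * ov j k)" for k
      unfolding quad_spectral[OF E] ov_def ..
    have U: "unitary_mat I E" "unitary_mat I G" using E G by (auto simp: spectral_def)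
    have "1 - (\<Sum>(j, k)\<in>I \<times> I. sqrt (a j * b k) * ov j k)\<^sup>2
        \<le> (\<Sum>j\<in>I. a j * ln (a j)) - (\<Sum>k\<in>I. (\<Sum>j\<in>I. a j * ov j k) * ln (b k))"
    proof (rule relative_entropy_ge_fidelity[OF I a(2,3) b(2,3)])
      show "(\<Sum>k\<in>I. ov j k) = 1" "(\<Sum>j'\<in>I. ov j' j) = 1" if "j \<in> I" for j
        using overlap_sums[OF I U that] by (simp_all add: ov_def)
      fix k assume k: "k \<in> I" "b k = 0"
      \<comment> \<open>All weights are positive, so a vector on which the form of the average
        vanishes makes the form of every component vanish.\<close>
      have "\<forall>x\<in>X. w x * quad I (\<rho>' x) (column G k) = 0"
        using qmix[OF k(1)] k(2) X w density_matD(2)[OF \<rho>']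
        by (subst sum_nonneg_eq_0_iff[symmetric]) (auto simp: less_imp_le)
      then show "(\<Sum>j\<in>I. a j * ov j k) = 0"
        using x w[OF x] by (auto simp flip: q)
    qed (auto simp: ov_def)
    moreover have "(cmod (affinity I (\<rho>' x) \<rho>))\<^sup>2 = (\<Sum>(j, k)\<in>I \<times> I. sqrt (a j * b k) * ov j k)\<^sup>2"
      unfolding affinity_eq[OF I] norm_of_real power2_abs a_def b_def E_def G_def ov_def ..
    ultimately show ?thesis
      by (simp add: negentropy_def q flip: a_def)
  qed
  have "(\<Sum>x\<in>X. w x * (1 - (cmod (affinity I (\<rho>' x) \<rho>))\<^sup>2))
      \<le> (\<Sum>x\<in>X. w x * (negentropy I (\<rho>' x) - (\<Sum>k\<in>I. quad I (\<rho>' x) (column G k) * ln (b k))))"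
    using step w by (intro sum_mono mult_left_mono) (auto simp: less_imp_le)
  also have "\<dots> = (\<Sum>x\<in>X. w x * negentropy I (\<rho>' x)) - (\<Sum>x\<in>X. \<Sum>k\<in>I. w x * quad I (\<rho>' x) (column G k) * ln (b k))"
    by (simp add: right_diff_distrib sum_subtractf sum_distrib_left mult_ac)
  also have "(\<Sum>x\<in>X. \<Sum>k\<in>I. w x * quad I (\<rho>' x) (column G k) * ln (b k))
      = (\<Sum>k\<in>I. \<Sum>x\<in>X. w x * quad I (\<rho>' x) (column G k) * ln (b k))"
    by (rule sum.swap)
  also have "\<dots> = negentropy I \<rho>"
    unfolding negentropy_def b_def[symmetric] sum_distrib_right[symmetric]
    by (intro sum.cong refl) (simp flip: qmix)
  finally show ?thesis .
qed

lemma ip_cauchy_schwarz: "(cmod (ip I a b))\<^sup>2 \<le> (\<Sum>r\<in>I. (cmod (a r))\<^sup>2) * (\<Sum>r\<in>I. (cmod (b r))\<^sup>2)"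
proof -
  have "cmod (ip I a b) \<le> (\<Sum>r\<in>I. cmod (a r) * cmod (b r))"
    unfolding ip_def by (rule order_trans[OF norm_sum]) (simp add: norm_mult)
  then have "(cmod (ip I a b))\<^sup>2 \<le> (\<Sum>r\<in>I. cmod (a r) * cmod (b r))\<^sup>2"
    by (intro power_mono) auto
  also have "\<dots> \<le> (\<Sum>r\<in>I. (cmod (a r))\<^sup>2) * (\<Sum>r\<in>I. (cmod (b r))\<^sup>2)"
    by (rule Cauchy_Schwarz_ineq_sum)
  finally show ?thesis .
qed

lemma sqrt_mat_norm:
  assumes "finite I" "density_mat I \<rho>"
  shows "(\<Sum>s\<in>I. \<Sum>t\<in>I. (cmod (sqrt_mat I \<rho> s t))\<^sup>2) = 1"
proof -
  have "complex_of_real (\<Sum>s\<in>I. \<Sum>t\<in>I. (cmod (sqrt_mat I \<rho> s t))\<^sup>2)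
      = (\<Sum>s\<in>I. \<Sum>t\<in>I. sqrt_mat I \<rho> s t * cnj (sqrt_mat I \<rho> s t))"
    by (simp add: complex_norm_square del: of_real_power)
  also have "\<dots> = 1"
    using sqrt_mat_gram[OF assms] density_matD(3)[OF assms(2)] by simp
  finally show ?thesis by (simp only: of_real_eq_1_iff)
qed

lemma affinity_le_1:
  assumes "finite I" "density_mat I \<rho>" "density_mat I \<sigma>"
  shows "(cmod (affinity I \<rho> \<sigma>))\<^sup>2 \<le> 1"
proof -
  have "affinity I \<rho> \<sigma> = ip (I \<times> I) (\<lambda>i. sqrt_mat I \<rho> (fst i) (snd i)) (\<lambda>i. sqrt_mat I \<sigma> (fst i) (snd i))"
    by (simp add: affinity_def ip_def sum.cartesian_product case_prod_unfold)
  moreover have "(\<Sum>i\<in>I\<times>I. (cmod (sqrt_mat I \<tau> (fst i) (snd i)))\<^sup>2) = 1" if "density_mat I \<tau>" for \<tau>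
    using sqrt_mat_norm[OF assms(1) that] by (simp add: sum.cartesian_product case_prod_unfold)
  ultimately show ?thesis
    using ip_cauchy_schwarz[of "I \<times> I" "\<lambda>i. sqrt_mat I \<rho> (fst i) (snd i)" "\<lambda>i. sqrt_mat I \<sigma> (fst i) (snd i)"] assms
    by simp
qed

lemma density_mat_mixture:
  fixes w :: "'x \<Rightarrow> real"
  assumes X: "finite X" and w: "\<And>x. x \<in> X \<Longrightarrow> w x \<ge> 0" "sum w X = 1"
    and \<rho>': "\<And>x. x \<in> X \<Longrightarrow> density_mat I (\<rho>' x)"
    and mix: "\<And>s t. s \<in> I \<Longrightarrow> t \<in> I \<Longrightarrow> \<rho> s t = (\<Sum>x\<in>X. of_real (w x) * \<rho>' x s t)"
  shows "density_mat I \<rho>"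
  unfolding density_mat_def
proof (intro conjI ballI allI)
  fix s t assume st: "s \<in> I" "t \<in> I"
  have "cnj (\<rho> t s) = (\<Sum>x\<in>X. of_real (w x) * cnj (\<rho>' x t s))"
    using st by (simp add: mix)
  also have "\<dots> = \<rho> s t"
    unfolding mix[OF st] using st density_matD(1)[OF \<rho>'] by (intro sum.cong refl) metis
  finally show "\<rho> s t = cnj (\<rho> t s)" ..
next
  fix z
  have "quad I \<rho> z = (\<Sum>x\<in>X. w x * quad I (\<rho>' x) z)"
    by (rule quad_mixture[OF mix])
  also have "\<dots> \<ge> 0"
    by (intro sum_nonneg mult_nonneg_nonneg w density_matD(2)[OF \<rho>'])
  finally show "quad I \<rho> z \<ge> 0" .
next
  have "(\<Sum>s\<in>I. \<rho> s s) = (\<Sum>s\<in>I. \<Sum>x\<in>X. of_real (w x) * \<rho>' x s s)"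
    using mix by simp
  also have "\<dots> = (\<Sum>x\<in>X. \<Sum>s\<in>I. of_real (w x) * \<rho>' x s s)"
    by (rule sum.swap)
  also have "\<dots> = (\<Sum>x\<in>X. of_real (w x) * (\<Sum>s\<in>I. \<rho>' x s s))"
    by (simp add: sum_distrib_left)
  also have "\<dots> = of_real (sum w X)"
    using density_matD(3)[OF \<rho>'] by simp
  finally show "(\<Sum>s\<in>I. \<rho> s s) = 1" using w by simp
qed

section \<open>Entropy of composite systems of qubits\<close>

lemma sum_Pow_Un:
  assumes "finite A" "finite B" "A \<inter> B = {}"
  shows "(\<Sum>S\<in>Pow (A \<union> B). g S) = (\<Sum>R\<in>Pow A. \<Sum>T\<in>Pow B. g (R \<union> T))"
proof -
  have "bij_betw (\<lambda>(R, T). R \<union> T) (Pow A \<times> Pow B) (Pow (A \<union> B))"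
    by (rule bij_betw_byWitness[where f' = "\<lambda>S. (S \<inter> A, S \<inter> B)"]) (use assms in auto)
  from sum.reindex_bij_betw[OF this, of g] show ?thesis
    by (simp add: sum.cartesian_product case_prod_unfold)
qed

text \<open>Serves all sums over a register of which the part \<open>A\<close> is in the fixed basis
  state \<open>m\<close>.\<close>

lemma sum_slice:
  assumes fin: "finite A" "finite B" "A \<inter> B = {}" and m: "m \<subseteq> A"
    and h: "\<And>S. S \<subseteq> A \<union> B \<Longrightarrow> S \<inter> A \<noteq> m \<Longrightarrow> h S = 0"
  shows "(\<Sum>S\<in>Pow (A \<union> B). h S) = (\<Sum>T\<in>Pow B. h (m \<union> T))"
proof -
  have "(\<Sum>S\<in>Pow (A \<union> B). h S) = (\<Sum>R\<in>Pow A. if R = m then \<Sum>T\<in>Pow B. h (R \<union> T) else 0)"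
    unfolding sum_Pow_Un[OF fin]
  proof (intro sum.cong refl)
    fix R assume R: "R \<in> Pow A"
    show "(\<Sum>T\<in>Pow B. h (R \<union> T)) = (if R = m then \<Sum>T\<in>Pow B. h (R \<union> T) else 0)"
    proof (cases "R = m")
      case False
      have "h (R \<union> T) = 0" if "T \<in> Pow B" for T
      proof (rule h)
        have "(R \<union> T) \<inter> A = R" using R that fin by auto
        then show "(R \<union> T) \<inter> A \<noteq> m" using False by simp
        show "R \<union> T \<subseteq> A \<union> B" using R that by auto
      qed
      then show ?thesis using False by simp
    qed simp
  qed
  then show ?thesis using m fin by simp
qed

text \<open>The basis state \<open>m\<close> of \<open>A\<close> tensored with the vector
  \<open>z\<close> of \<open>B\<close>.\<close>

definition tens :: "nat set \<Rightarrow> nat set \<Rightarrow> nat set \<Rightarrow> amplitudes \<Rightarrow> amplitudes" where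
  "tens A B m z S = (if S \<inter> A = m then z (S \<inter> B) else 0)"

context
  fixes A B :: "nat set" and \<rho> \<sigma> :: qmatrix
  assumes fin: "finite A" "finite B" and disj: "A \<inter> B = {}"
    and \<rho>: "density_mat (Pow (A \<union> B)) \<rho>"
    and marg: "\<And>k k'. k \<subseteq> B \<Longrightarrow> k' \<subseteq> B \<Longrightarrow> (\<Sum>m\<in>Pow A. \<rho> (m \<union> k) (m \<union> k')) = \<sigma> k k'"
begin

lemma tens_Un: "m \<subseteq> A \<Longrightarrow> k \<subseteq> B \<Longrightarrow> tens A B m z (m \<union> k) = z k"
proof -
  assume "m \<subseteq> A" "k \<subseteq> B"
  then have "(m \<union> k) \<inter> A = m" "(m \<union> k) \<inter> B = k" using disj by auto
  then show ?thesis by (simp add: tens_def)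
qed

lemma sum_tens:
  assumes "m \<subseteq> A" "\<And>S. tens A B m z S = 0 \<Longrightarrow> h S = 0"
  shows "(\<Sum>S\<in>Pow (A \<union> B). h S) = (\<Sum>k\<in>Pow B. h (m \<union> k))"
  by (rule sum_slice[OF fin disj assms(1)]) (auto intro: assms(2) simp: tens_def)

text \<open>A partial trace: the quadratic form of the marginal is a sum over an orthonormal basis
  of the system that is traced out.\<close>

lemma quad_marginal: "quad (Pow B) \<sigma> z = (\<Sum>m\<in>Pow A. quad (Pow (A \<union> B)) \<rho> (tens A B m z))"
proof -
  have one: "ip (Pow (A \<union> B)) (tens A B m z) (mv (Pow (A \<union> B)) \<rho> (tens A B m z))
      = (\<Sum>k\<in>Pow B. \<Sum>k'\<in>Pow B. cnj (z k) * (\<rho> (m \<union> k) (m \<union> k') * z k'))" if m: "m \<subseteq> A" for m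
  proof -
    have "mv (Pow (A \<union> B)) \<rho> (tens A B m z) S = (\<Sum>k'\<in>Pow B. \<rho> S (m \<union> k') * z k')" for S
      unfolding mv_def using m by (subst sum_tens[OF m, where z = z]) (auto simp: tens_Un)
    then show ?thesis
      unfolding ip_def using m by (subst sum_tens[OF m, where z = z]) (auto simp: tens_Un sum_distrib_left)
  qed
  have "(\<Sum>m\<in>Pow A. ip (Pow (A \<union> B)) (tens A B m z) (mv (Pow (A \<union> B)) \<rho> (tens A B m z)))
      = (\<Sum>m\<in>Pow A. \<Sum>k\<in>Pow B. \<Sum>k'\<in>Pow B. cnj (z k) * (\<rho> (m \<union> k) (m \<union> k') * z k'))"
    using one by (intro sum.cong) auto
  also have "\<dots> = (\<Sum>k\<in>Pow B. \<Sum>m\<in>Pow A. \<Sum>k'\<in>Pow B. cnj (z k) * (\<rho> (m \<union> k) (m \<union> k') * z k'))"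
    by (rule sum.swap)
  also have "\<dots> = (\<Sum>k\<in>Pow B. \<Sum>k'\<in>Pow B. \<Sum>m\<in>Pow A. cnj (z k) * (\<rho> (m \<union> k) (m \<union> k') * z k'))"
    by (intro sum.cong sum.swap refl)
  also have "\<dots> = (\<Sum>k\<in>Pow B. \<Sum>k'\<in>Pow B. cnj (z k) * ((\<Sum>m\<in>Pow A. \<rho> (m \<union> k) (m \<union> k')) * z k'))"
    by (simp add: sum_distrib_left sum_distrib_right)
  also have "\<dots> = ip (Pow B) z (mv (Pow B) \<sigma> z)"
    by (simp add: ip_def mv_def marg sum_distrib_left)
  finally show ?thesis by (simp add: quad_def flip: Re_sum)
qed

lemma density_mat_marginal: "density_mat (Pow B) \<sigma>"
  unfolding density_mat_def
proof (intro conjI ballI allI)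
  fix s t assume st: "s \<in> Pow B" "t \<in> Pow B"
  have "\<rho> (m \<union> s) (m \<union> t) = cnj (\<rho> (m \<union> t) (m \<union> s))" if "m \<in> Pow A" for m
    using st that by (intro density_matD(1)[OF \<rho>]) auto
  then have "(\<Sum>m\<in>Pow A. \<rho> (m \<union> s) (m \<union> t)) = cnj (\<Sum>m\<in>Pow A. \<rho> (m \<union> t) (m \<union> s))"
    unfolding cnj_sum by (intro sum.cong) auto
  then show "\<sigma> s t = cnj (\<sigma> t s)" using st marg[of s t] marg[of t s] by (metis PowD)
next
  fix z show "quad (Pow B) \<sigma> z \<ge> 0"
    unfolding quad_marginal by (intro sum_nonneg density_matD(2)[OF \<rho>])
next
  have "(\<Sum>s\<in>Pow B. \<sigma> s s) = (\<Sum>s\<in>Pow B. \<Sum>m\<in>Pow A. \<rho> (m \<union> s) (m \<union> s))"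
    by (simp add: marg)
  also have "\<dots> = (\<Sum>m\<in>Pow A. \<Sum>s\<in>Pow B. \<rho> (m \<union> s) (m \<union> s))"
    by (rule sum.swap)
  also have "\<dots> = 1"
    using density_matD(3)[OF \<rho>] by (simp add: sum_Pow_Un[OF fin disj])
  finally show "(\<Sum>s\<in>Pow B. \<sigma> s s) = 1" .
qed

text \<open>Subadditivity of the entropy and the Araki--Lieb inequality, with $|A|$ as a bound for the
  entropy of \<open>A\<close>. Both compare \<open>\<rho>\<close> with the product of the maximally mixed state of \<open>A\<close> and \<open>\<sigma>\<close>;
  the second one uses that $\rho \le 2^{|A|} I \otimes \sigma$.\<close>

lemma negentropy_marginal_bounds:
  "negentropy (Pow B) \<sigma> - card A * ln 2 \<le> negentropy (Pow (A \<union> B)) \<rho>"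
  "negentropy (Pow (A \<union> B)) \<rho> \<le> negentropy (Pow B) \<sigma> + card A * ln 2"
proof -
  let ?I = "Pow (A \<union> B)"
  have finI: "finite ?I" "finite (Pow B)" using fin by auto
  define f where "f = eigbasis (Pow B) \<sigma>"
  define s where "s = eigval (Pow B) \<sigma>"
  have f: "spectral (Pow B) \<sigma> f s"
    unfolding f_def s_def by (rule spectral_eigensystem[OF finI(2) density_mat_marginal])
  note s = eigval_nonneg_sum[OF finI(2) density_mat_marginal f]
  define E where "E = eigbasis ?I \<rho>"
  define a where "a = eigval ?I \<rho>"
  have E: "spectral ?I \<rho> E a" unfolding E_def a_def by (rule spectral_eigensystem[OF finI(1) \<rho>])
  note a = eigval_nonneg_sum[OF finI(1) \<rho> E]
  define d where "d = (2::real) ^ card A"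
  have d: "d > 0" "ln d = card A * ln 2" "real (card (Pow A)) = d"
    using fin by (auto simp: d_def ln_realpow card_Pow)
  \<comment> \<open>Columns of \<open>G\<close> and values of \<open>b\<close> are the eigenvectors
    and eigenvalues of the maximally mixed state of \<open>A\<close> tensored with
    \<open>\<sigma>\<close>: basis states of \<open>A\<close> combined with eigenvectors of
    \<open>\<sigma>\<close>.\<close>
  define G where "G S T = tens A B (T \<inter> A) (column f (T \<inter> B)) S" for S T
  define b where "b T = s (T \<inter> B) / d" for T
  have GUn: "column G (m \<union> k) = tens A B m (column f k)" "b (m \<union> k) = s k / d" if "m \<subseteq> A" "k \<subseteq> B" for m k
  proof -
    have "(m \<union> k) \<inter> A = m" "(m \<union> k) \<inter> B = k" using disj that by auto
    then show "column G (m \<union> k) = tens A B m (column f k)" "b (m \<union> k) = s k / d" by (auto simp: G_def b_def)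
  qed
  have G: "unitary_mat ?I G"
    unfolding unitary_mat_def
  proof (intro ballI)
    fix S T assume ST: "S \<in> ?I" "T \<in> ?I"
    have "(\<Sum>R\<in>?I. cnj (G R S) * G R T) = (\<Sum>k\<in>Pow B. cnj (G (S \<inter> A \<union> k) S) * G (S \<inter> A \<union> k) T)"
      by (rule sum_tens[of "S \<inter> A" "column f (S \<inter> B)"]) (auto simp: G_def)
    also have "\<dots> = (\<Sum>k\<in>Pow B. if S \<inter> A = T \<inter> A then cnj (f k (S \<inter> B)) * f k (T \<inter> B) else 0)"
    proof (intro sum.cong refl)
      fix k assume "k \<in> Pow B"
      then have "(S \<inter> A \<union> k) \<inter> A = S \<inter> A" "(S \<inter> A \<union> k) \<inter> B = k" using disj by auto
      then show "cnj (G (S \<inter> A \<union> k) S) * G (S \<inter> A \<union> k) T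
          = (if S \<inter> A = T \<inter> A then cnj (f k (S \<inter> B)) * f k (T \<inter> B) else 0)"
        by (cases "S \<inter> A = T \<inter> A") (auto simp: G_def tens_def)
    qed
    also have "\<dots> = (if S \<inter> A = T \<inter> A \<and> S \<inter> B = T \<inter> B then 1 else 0)"
      using f by (cases "S \<inter> A = T \<inter> A") (simp_all add: spectral_def unitary_mat_def)
    also have "(S \<inter> A = T \<inter> A \<and> S \<inter> B = T \<inter> B) = (S = T)" using ST by auto
    finally show "(\<Sum>R\<in>?I. cnj (G R S) * G R T) = (if S = T then 1 else 0)" .
  qed
  have b: "b T \<ge> 0" for T
    using s(2)[of "T \<inter> B"] d by (simp add: b_def)
  have sumb: "sum b ?I = 1"
  proof -
    have "sum b ?I = (\<Sum>m\<in>Pow A. \<Sum>k\<in>Pow B. s k / d)"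
      unfolding sum_Pow_Un[OF fin disj] by (intro sum.cong refl) (simp add: GUn)
    then show ?thesis
      using s(3) d by (simp add: sum_divide_distrib[symmetric])
  qed
  define ov where "ov j k = (cmod (ip ?I (column E j) (column G k)))\<^sup>2" for j k
  have q: "quad ?I \<rho> (column G T) = (\<Sum>j\<in>?I. a j * ov j T)" for T
    unfolding quad_spectral[OF E] ov_def ..
  have qs: "(\<Sum>m\<in>Pow A. quad ?I \<rho> (column G (m \<union> k))) = s k" if "k \<subseteq> B" for k
    using that s(1)[of k] by (simp add: GUn quad_marginal)
  have U: "unitary_mat ?I E" using E by (simp add: spectral_def)
  have rows: "(\<Sum>k\<in>?I. ov j k) = 1" "(\<Sum>i\<in>?I. ov i j) = 1" if "j \<in> ?I" for j
    using overlap_sums[OF finI(1) U G that] by (simp_all add: ov_def)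
  have ac: "(\<Sum>j\<in>?I. a j * ov j T) = 0" if T: "T \<in> ?I" "b T = 0" for T
  proof -
    have "s (T \<inter> B) = 0" using T d by (simp add: b_def)
    then have "\<forall>m\<in>Pow A. quad ?I \<rho> (column G (m \<union> (T \<inter> B))) = 0"
      using qs[of "T \<inter> B"] fin density_matD(2)[OF \<rho>] by (subst sum_nonneg_eq_0_iff[symmetric]) auto
    moreover have "T \<inter> A \<union> (T \<inter> B) = T" using T by auto
    ultimately have "quad ?I \<rho> (column G T) = 0" by (metis Int_lower2 PowI)
    then show ?thesis by (simp add: q)
  qed
  have ov0: "ov j k \<ge> 0" for j k by (simp add: ov_def)
  note re = finI(1) a(2,3) b sumb ov0 rows ac
  \<comment> \<open>The logarithm of the product state splits, so its expectation in
    \<open>\<rho>\<close> depends on the marginal only.\<close>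
  have cross: "(\<Sum>T\<in>?I. (\<Sum>j\<in>?I. a j * ov j T) * ln (b T)) = negentropy (Pow B) \<sigma> - ln d"
  proof -
    have "(\<Sum>T\<in>?I. (\<Sum>j\<in>?I. a j * ov j T) * ln (b T))
        = (\<Sum>m\<in>Pow A. \<Sum>k\<in>Pow B. quad ?I \<rho> (column G (m \<union> k)) * ln (s k / d))"
      unfolding q[symmetric] sum_Pow_Un[OF fin disj] by (intro sum.cong refl) (simp add: GUn)
    also have "\<dots> = (\<Sum>k\<in>Pow B. \<Sum>m\<in>Pow A. quad ?I \<rho> (column G (m \<union> k)) * ln (s k / d))"
      by (rule sum.swap)
    also have "\<dots> = (\<Sum>k\<in>Pow B. s k * ln (s k / d))"
      unfolding sum_distrib_right[symmetric] by (intro sum.cong refl) (simp add: qs)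
    also have "\<dots> = (\<Sum>k\<in>Pow B. s k * ln (s k) - s k * ln d)"
    proof (intro sum.cong refl)
      fix k assume "k \<in> Pow B"
      then show "s k * ln (s k / d) = s k * ln (s k) - s k * ln d"
        using s(2)[of k] d by (cases "s k = 0") (auto simp: ln_div algebra_simps)
    qed
    also have "\<dots> = negentropy (Pow B) \<sigma> - ln d"
      using s(3) by (simp add: sum_subtractf negentropy_def s_def sum_distrib_right[symmetric])
    finally show ?thesis .
  qed
  have nega: "negentropy ?I \<rho> = (\<Sum>j\<in>?I. a j * ln (a j))"
    by (simp add: negentropy_def a_def)
  show "negentropy (Pow B) \<sigma> - card A * ln 2 \<le> negentropy ?I \<rho>"
    using gibbs[of ?I a b ov, OF re] unfolding nega cross d(2) .
  \<comment> \<open>The form in which \<open>\<rho>\<close> \<le> 2^|A| I \<otimes>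
    \<open>\<sigma>\<close> enters: one eigenvector of \<open>\<rho>\<close> against one basis state
    of \<open>A\<close>.\<close>
  have slice: "(\<Sum>k\<in>Pow B. a j * ov j (m \<union> k) / s k) \<le> 1" if j: "j \<in> ?I" and m: "m \<in> Pow A" for j m
  proof -
    define c where "c k = ip ?I (tens A B m (column f k)) (column E j)" for k
    \<comment> \<open>The inverse of \<open>\<sigma>\<close> on its support (division by 0 yields
      0), applied to the \<open>m\<close>-slice of the eigenvector \<open>j\<close>. For this test
      vector both the inner product with the eigenvector and the quadratic form of
      \<open>\<sigma>\<close> equal \<open>Q\<close>, so \<open>a j\<close> times Q^2 is at most
      Q.\<close>
    define z where "z = mv (Pow B) f (\<lambda>k. c k / of_real (s k))"
    define Q where "Q = (\<Sum>k\<in>Pow B. (cmod (c k))\<^sup>2 / s k)"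
    have Q0: "Q \<ge> 0" unfolding Q_def using s by (intro sum_nonneg divide_nonneg_nonneg) auto
    have ovc: "ov j (m \<union> k) = (cmod (c k))\<^sup>2" if "k \<in> Pow B" for k
    proof -
      have "ov j (m \<union> k) = (cmod (ip ?I (column E j) (tens A B m (column f k))))\<^sup>2"
        using GUn(1)[of m k] m that by (simp add: ov_def)
      also have "\<dots> = (cmod (cnj (c k)))\<^sup>2" by (simp only: c_def cnj_ip)
      finally show ?thesis by simp
    qed
    have ipz: "ip (Pow B) (column f k) z = c k / of_real (s k)" if "k \<in> Pow B" for k
    proof -
      have id: "is_id (Pow B) (mm (Pow B) (adj f) f)"
        using f by (simp add: spectral_def unitary_mat_iff)
      have "ip (Pow B) (column f k) z = mv (Pow B) (adj f) z k"
        by (simp add: ip_def mv_def adj_def)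
      also have "\<dots> = mv (Pow B) (mm (Pow B) (adj f) f) (\<lambda>k. c k / of_real (s k)) k"
        by (simp add: z_def mv_mm)
      also have "\<dots> = (\<Sum>k'\<in>Pow B. if k = k' then c k' / of_real (s k') else 0)"
        unfolding mv_def using id that by (intro sum.cong) (auto simp: is_id_def)
      finally show ?thesis using finI(2) that by simp
    qed
    have "quad (Pow B) \<sigma> z = (\<Sum>k\<in>Pow B. s k * (cmod (c k / of_real (s k)))\<^sup>2)"
      unfolding quad_spectral[OF f] by (intro sum.cong) (auto simp: ipz)
    also have "\<dots> = Q"
      unfolding Q_def
    proof (intro sum.cong refl)
      fix k assume "k \<in> Pow B"
      then have "s k \<ge> 0" by (rule s(2))
      then show "s k * (cmod (c k / of_real (s k)))\<^sup>2 = (cmod (c k))\<^sup>2 / s k"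
        by (cases "s k = 0") (auto simp: norm_divide power_divide power2_eq_square)
    qed
    finally have qz: "quad (Pow B) \<sigma> z = Q" .
    have "ip ?I (column E j) (tens A B m z) = (\<Sum>k\<in>Pow B. c k / of_real (s k) * ip ?I (column E j) (tens A B m (column f k)))"
    proof -
      have "tens A B m z S = (\<Sum>k\<in>Pow B. c k / of_real (s k) * tens A B m (column f k) S)" for S
        by (simp add: tens_def z_def mv_def mult.commute)
      then have "ip ?I (column E j) (tens A B m z)
          = (\<Sum>S\<in>?I. \<Sum>k\<in>Pow B. c k / of_real (s k) * (cnj (E S j) * tens A B m (column f k) S))"
        by (simp add: ip_def sum_distrib_left mult_ac)
      also have "\<dots> = (\<Sum>k\<in>Pow B. \<Sum>S\<in>?I. c k / of_real (s k) * (cnj (E S j) * tens A B m (column f k) S))"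
        by (rule sum.swap)
      finally show ?thesis by (simp add: ip_def sum_distrib_left)
    qed
    also have "\<dots> = (\<Sum>k\<in>Pow B. c k / of_real (s k) * cnj (c k))"
      by (simp only: c_def cnj_ip)
    also have "\<dots> = of_real Q"
      by (simp add: Q_def complex_norm_square del: of_real_power)
    finally have ipE: "ip ?I (column E j) (tens A B m z) = of_real Q" .
    have "a j * Q\<^sup>2 \<le> quad ?I \<rho> (tens A B m z)"
    proof -
      have "a j * Q\<^sup>2 = a j * (cmod (ip ?I (column E j) (tens A B m z)))\<^sup>2"
        by (simp add: ipE)
      also have "\<dots> \<le> quad ?I \<rho> (tens A B m z)"
        unfolding quad_spectral[OF E] by (rule member_le_sum[OF j _ finI(1)]) (intro mult_nonneg_nonneg a(2), auto)
      finally show ?thesis .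
    qed
    also have "\<dots> \<le> (\<Sum>m\<in>Pow A. quad ?I \<rho> (tens A B m z))"
      by (rule member_le_sum[OF m]) (use density_matD(2)[OF \<rho>] fin in auto)
    also have "\<dots> = Q" using qz by (simp add: quad_marginal)
    finally have "(a j * Q) * Q \<le> 1 * Q" by (simp add: power2_eq_square mult_ac)
    then have "a j * Q \<le> 1"
      using Q0 by (cases "Q = 0") (auto simp: mult_le_cancel_right)
    moreover have "(\<Sum>k\<in>Pow B. a j * ov j (m \<union> k) / s k) = a j * Q"
      unfolding Q_def sum_distrib_left by (intro sum.cong) (auto simp: ovc)
    ultimately show ?thesis by simp
  qed
  \<comment> \<open>There are \<open>d\<close> slices, each at most 1 and scaled by \<open>d\<close>
    from the eigenvalues \<open>s k / d\<close>; in the end ln(d^2) - ln d leaves a single ln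
    d.\<close>
  have "(\<Sum>j\<in>?I. a j * (\<Sum>T\<in>?I. a j * ov j T / b T)) \<le> (\<Sum>j\<in>?I. a j * d\<^sup>2)"
  proof (intro sum_mono mult_left_mono a(2))
    fix j assume j: "j \<in> ?I"
    have "(\<Sum>T\<in>?I. a j * ov j T / b T) = (\<Sum>m\<in>Pow A. d * (\<Sum>k\<in>Pow B. a j * ov j (m \<union> k) / s k))"
      unfolding sum_Pow_Un[OF fin disj] sum_distrib_left by (intro sum.cong refl) (simp add: GUn)
    also have "\<dots> \<le> (\<Sum>m\<in>Pow A. d * 1)"
      using d slice[OF j] by (intro sum_mono mult_left_mono) auto
    also have "\<dots> = d\<^sup>2"
      using d by (simp add: power2_eq_square)
    finally show "(\<Sum>T\<in>?I. a j * ov j T / b T) \<le> d\<^sup>2" .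
  qed
  also have "\<dots> = d\<^sup>2"
    using a(3) by (simp add: sum_distrib_right[symmetric])
  finally have "(\<Sum>j\<in>?I. a j * (\<Sum>T\<in>?I. a j * ov j T / b T)) \<le> d\<^sup>2" .
  from relative_entropy_le[of ?I a b ov, OF re this]
  have "negentropy ?I \<rho> \<le> negentropy (Pow B) \<sigma> - ln d + ln (d\<^sup>2)"
    unfolding nega cross .
  then show "negentropy ?I \<rho> \<le> negentropy (Pow B) \<sigma> + card A * ln 2"
    using d by (simp add: ln_realpow)
qed

end

section \<open>The information in a quantum message\<close>

definition prefix_state :: "('x::finite \<Rightarrow> real) \<Rightarrow> nat \<Rightarrow> ('x list \<Rightarrow> qmatrix) \<Rightarrow> 'x list \<Rightarrow> qmatrix" where
  "prefix_state w n R u S T =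
     (\<Sum>v | length v = n - length u. of_real (prod_list (map w v)) * R (u @ v) S T)"

context
  fixes w :: "'x::finite \<Rightarrow> real" and n :: nat and R :: "'x list \<Rightarrow> qmatrix"
    and A B :: "nat set" and \<sigma> :: qmatrix
  assumes w: "\<And>x. w x > 0" "sum w UNIV = 1"
    and fin: "finite A" "finite B" and disj: "A \<inter> B = {}"
    and R: "\<And>xs. length xs = n \<Longrightarrow> density_mat (Pow (A \<union> B)) (R xs)"
    and marg: "\<And>xs k k'. length xs = n \<Longrightarrow> k \<subseteq> B \<Longrightarrow> k' \<subseteq> B \<Longrightarrow>
      (\<Sum>m\<in>Pow A. R xs (m \<union> k) (m \<union> k')) = \<sigma> k k'"
begin

lemma prefix_weights:
  "prod_list (map w v) \<ge> 0" "(\<Sum>v | length v = k. prod_list (map w v)) = 1"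
proof -
  show "prod_list (map w v) \<ge> 0"
    by (rule prod_list_map_nonneg) (simp add: w less_imp_le)
  show "(\<Sum>v | length v = k. prod_list (map w v)) = 1"
    using lavg_const[OF w(2), of k 1] by (simp add: lavg_def)
qed

lemma density_mat_prefix_state:
  assumes "length u \<le> n"
  shows "density_mat (Pow (A \<union> B)) (prefix_state w n R u)"
proof (rule density_mat_mixture[where X = "{v. length v = n - length u}" and w = "\<lambda>v. prod_list (map w v)"
      and \<rho>' = "\<lambda>v. R (u @ v)"])
  show "\<And>v. v \<in> {v. length v = n - length u} \<Longrightarrow> density_mat (Pow (A \<union> B)) (R (u @ v))"
    using assms by (intro R) auto
qed (use prefix_weights in \<open>auto simp: prefix_state_def\<close>)

lemma prefix_state_split:
  assumes "length u < n"
  shows "prefix_state w n R u S T = (\<Sum>x\<in>UNIV. of_real (w x) * prefix_state w n R (u @ [x]) S T)"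
proof -
  have "n - length u = Suc (n - Suc (length u))" using assms by simp
  then show ?thesis
    by (simp add: prefix_state_def sum_lists_Suc sum_distrib_left mult_ac)
qed

lemma prefix_state_marginal:
  assumes "length u \<le> n" "k \<subseteq> B" "k' \<subseteq> B"
  shows "(\<Sum>m\<in>Pow A. prefix_state w n R u (m \<union> k) (m \<union> k')) = \<sigma> k k'"
proof -
  have "(\<Sum>m\<in>Pow A. prefix_state w n R u (m \<union> k) (m \<union> k'))
      = (\<Sum>v | length v = n - length u. \<Sum>m\<in>Pow A. of_real (prod_list (map w v)) * R (u @ v) (m \<union> k) (m \<union> k'))"
    unfolding prefix_state_def by (rule sum.swap)
  also have "\<dots> = (\<Sum>v | length v = n - length u. of_real (prod_list (map w v)) * \<sigma> k k')"
    unfolding sum_distrib_left[symmetric] using assms marg by (intro sum.cong) auto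
  also have "\<dots> = of_real (\<Sum>v | length v = n - length u. prod_list (map w v)) * \<sigma> k k'"
    by (simp add: sum_distrib_right)
  finally show ?thesis by (simp add: prefix_weights)
qed

lemma increment_negentropy_ge:
  assumes "length u < n"
  shows "(\<Sum>x\<in>UNIV. w x * (1 - (cmod (affinity (Pow (A \<union> B)) (prefix_state w n R (u @ [x])) (prefix_state w n R u)))\<^sup>2))
    \<le> increment w (\<lambda>u. negentropy (Pow (A \<union> B)) (prefix_state w n R u)) u"
  unfolding increment_def using fin w assms
  by (intro negentropy_increment density_mat_prefix_state) (auto intro: prefix_state_split)

text \<open>The reduced state \<open>\<sigma>\<close> of \<open>B\<close> is the same for all lists,
  so its entropy cancels between the end and the start. What remains is card A times ln 2 from each
  of the two inequalities, whence the factor 2.\<close>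

lemma negentropy_total:
  "lavg w n (\<lambda>u. negentropy (Pow (A \<union> B)) (prefix_state w n R u))
    - negentropy (Pow (A \<union> B)) (prefix_state w n R []) \<le> 2 * (card A * ln 2)"
proof -
  have bounds: "negentropy (Pow B) \<sigma> - card A * ln 2 \<le> negentropy (Pow (A \<union> B)) (prefix_state w n R u)"
    "negentropy (Pow (A \<union> B)) (prefix_state w n R u) \<le> negentropy (Pow B) \<sigma> + card A * ln 2"
    if "length u \<le> n" for u
    using negentropy_marginal_bounds[OF fin disj density_mat_prefix_state[OF that] prefix_state_marginal[OF that]]
    by blast+
  have "lavg w n (\<lambda>u. negentropy (Pow (A \<union> B)) (prefix_state w n R u))
      \<le> lavg w n (\<lambda>u. negentropy (Pow B) \<sigma> + card A * ln 2)"
    using w bounds by (intro lavg_mono) (auto simp: less_imp_le)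
  also have "\<dots> = negentropy (Pow B) \<sigma> + card A * ln 2"
    using w by (simp add: lavg_const)
  finally show ?thesis using bounds(1)[of "[]"] by simp
qed

end

section \<open>Local operations on qubits\<close>

lemma apply_on_mv: "apply_on Q U \<psi> S = mv (Pow Q) U (\<lambda>T. \<psi> ((S - Q) \<union> T)) (S \<inter> Q)"
  by (simp add: apply_on_def mv_def)

text \<open>Stated at a single \<open>S\<close>, so that the factor may depend on the qubits outside
  \<open>Q\<close>.\<close>

lemma apply_on_scale:
  assumes "\<And>T. T \<subseteq> Q \<Longrightarrow> \<psi> ((S - Q) \<union> T) = c * \<phi> ((S - Q) \<union> T)"
  shows "apply_on Q U \<psi> S = c * apply_on Q U \<phi> S"
  unfolding apply_on_def sum_distrib_left by (intro sum.cong refl) (simp add: assms mult_ac)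

lemma apply_on_zero:
  assumes "\<And>T. T \<subseteq> Q \<Longrightarrow> \<psi> ((S - Q) \<union> T) = 0"
  shows "apply_on Q U \<psi> S = 0"
  unfolding apply_on_def by (simp add: assms)

text \<open>For fixed qubits outside \<open>Q\<close> the operation is a unitary on a fibre on which
  \<open>c\<close> is constant. Weight 1 gives invariance of inner products; the indicator of a
  measurement result gives invariance of its probability under operations elsewhere.\<close>

lemma apply_on_ip:
  fixes c :: "nat set \<Rightarrow> complex"
  assumes V: "finite V" "Q \<subseteq> V" and U: "unitary_on Q U"
    and c: "\<And>S T. T \<subseteq> Q \<Longrightarrow> c ((S - Q) \<union> T) = c S"
  shows "(\<Sum>S\<in>Pow V. c S * (cnj (apply_on Q U a S) * apply_on Q U b S)) = (\<Sum>S\<in>Pow V. c S * (cnj (a S) * b S))"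
proof -
  have eq: "V = (V - Q) \<union> Q" using V by auto
  have fin: "finite (V - Q)" "finite Q" "(V - Q) \<inter> Q = {}" using V by (auto intro: finite_subset)
  have sp: "(\<Sum>S\<in>Pow V. g S) = (\<Sum>R\<in>Pow (V - Q). \<Sum>T\<in>Pow Q. g (R \<union> T))" for g :: "nat set \<Rightarrow> complex"
    by (subst eq) (rule sum_Pow_Un[OF fin])
  show ?thesis
    unfolding sp
  proof (rule sum.cong[OF refl])
    fix R assume R: "R \<in> Pow (V - Q)"
    have ap: "apply_on Q U z (R \<union> T) = mv (Pow Q) U (\<lambda>T. z (R \<union> T)) T" if "T \<in> Pow Q" for T z
    proof -
      have "(R \<union> T) - Q = R" "(R \<union> T) \<inter> Q = T" using R that by auto
      then show ?thesis by (simp add: apply_on_mv)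
    qed
    have cR: "c (R \<union> T) = c R" if "T \<in> Pow Q" for T
    proof -
      have "R - Q = R" using R by auto
      then show ?thesis using c[of T R] that by simp
    qed
    have "(\<Sum>T\<in>Pow Q. c (R \<union> T) * (cnj (apply_on Q U a (R \<union> T)) * apply_on Q U b (R \<union> T)))
        = c R * ip (Pow Q) (mv (Pow Q) U (\<lambda>T. a (R \<union> T))) (mv (Pow Q) U (\<lambda>T. b (R \<union> T)))"
      unfolding ip_def sum_distrib_left by (intro sum.cong refl) (simp add: ap cR)
    also have "\<dots> = c R * ip (Pow Q) (\<lambda>T. a (R \<union> T)) (\<lambda>T. b (R \<union> T))"
      using U fin(2) by (subst ip_mv) (auto simp: unitary_on_eq)
    also have "\<dots> = (\<Sum>T\<in>Pow Q. c (R \<union> T) * (cnj (a (R \<union> T)) * b (R \<union> T)))"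
      unfolding ip_def sum_distrib_left by (intro sum.cong refl) (simp add: cR)
    finally show "(\<Sum>T\<in>Pow Q. c (R \<union> T) * (cnj (apply_on Q U a (R \<union> T)) * apply_on Q U b (R \<union> T)))
        = (\<Sum>T\<in>Pow Q. c (R \<union> T) * (cnj (a (R \<union> T)) * b (R \<union> T)))" .
  qed
qed

lemma ip_apply_on:
  assumes "finite V" "Q \<subseteq> V" "unitary_on Q U"
  shows "ip (Pow V) (apply_on Q U a) (apply_on Q U b) = ip (Pow V) a b"
  using apply_on_ip[OF assms, of "\<lambda>_. 1"] by (simp add: ip_def)

lemma apply_on_mm:
  "apply_on Q (mm (Pow Q) U V) \<psi> = apply_on Q U (apply_on Q V \<psi>)"
proof
  fix S
  have "apply_on Q V \<psi> ((S - Q) \<union> T) = mv (Pow Q) V (\<lambda>T. \<psi> ((S - Q) \<union> T)) T" if "T \<in> Pow Q" for T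
  proof -
    have "((S - Q) \<union> T) - Q = S - Q" "((S - Q) \<union> T) \<inter> Q = T" using that by auto
    then show ?thesis by (simp add: apply_on_mv)
  qed
  then show "apply_on Q (mm (Pow Q) U V) \<psi> S = apply_on Q U (apply_on Q V \<psi>) S"
    unfolding apply_on_mv[of Q "mm (Pow Q) U V"] apply_on_mv[of Q U] mv_mm
    by (simp add: mv_def[of _ U])
qed

lemma apply_on_commute:
  assumes "Q \<inter> R = {}"
  shows "apply_on Q U (apply_on R V \<psi>) = apply_on R V (apply_on Q U \<psi>)"
proof
  fix S
  have 1: "((S - Q) \<union> T) \<inter> R = S \<inter> R" "((S - Q) \<union> T) - R = (S - Q - R) \<union> T" if "T \<in> Pow Q" for T
    using assms that by auto
  have 2: "((S - R) \<union> T') \<inter> Q = S \<inter> Q" "((S - R) \<union> T' - Q) \<union> T = (S - Q - R) \<union> T \<union> T'"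
    if "T' \<in> Pow R" for T T'
    using assms that by auto
  have "apply_on Q U (apply_on R V \<psi>) S
      = (\<Sum>T\<in>Pow Q. \<Sum>T'\<in>Pow R. U (S \<inter> Q) T * V (S \<inter> R) T' * \<psi> ((S - Q - R) \<union> T \<union> T'))"
    unfolding apply_on_def by (intro sum.cong refl) (simp add: 1 sum_distrib_left mult_ac)
  also have "\<dots> = (\<Sum>T'\<in>Pow R. \<Sum>T\<in>Pow Q. U (S \<inter> Q) T * V (S \<inter> R) T' * \<psi> ((S - Q - R) \<union> T \<union> T'))"
    by (rule sum.swap)
  also have "\<dots> = apply_on R V (apply_on Q U \<psi>) S"
    unfolding apply_on_def by (intro sum.cong refl) (simp add: 2 sum_distrib_left mult_ac)
  finally show "apply_on Q U (apply_on R V \<psi>) S = apply_on R V (apply_on Q U \<psi>) S" .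
qed

text \<open>The operation \<open>F\<close> on \<open>R\<close>, controlled by the basis state of the qubits outside \<open>R\<close>, as an
  operation on a larger set of qubits.\<close>

definition ctrl :: "nat set \<Rightarrow> (nat set \<Rightarrow> qmatrix) \<Rightarrow> qmatrix" where
  "ctrl R F S T = (if S - R = T - R then F (S - R) (S \<inter> R) (T \<inter> R) else 0)"

lemma sum_ctrl:
  assumes Q: "finite Q" "R \<subseteq> Q" and S: "S \<subseteq> Q"
    and h: "\<And>T. T \<subseteq> Q \<Longrightarrow> T - R \<noteq> S - R \<Longrightarrow> h T = 0"
  shows "(\<Sum>T\<in>Pow Q. h T) = (\<Sum>T\<in>Pow R. h ((S - R) \<union> T))"
proof -
  have eq: "Q = (Q - R) \<union> R" using Q by auto
  have "(\<Sum>T\<in>Pow ((Q - R) \<union> R). h T) = (\<Sum>T\<in>Pow R. h ((S - R) \<union> T))"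
  proof (rule sum_slice)
    show "finite (Q - R)" "finite R" "(Q - R) \<inter> R = {}" using Q by (auto intro: finite_subset)
    show "S - R \<subseteq> Q - R" using S by auto
    fix T assume T: "T \<subseteq> (Q - R) \<union> R" "T \<inter> (Q - R) \<noteq> S - R"
    moreover have "T \<inter> (Q - R) = T - R" using T(1) by auto
    ultimately show "h T = 0" using h[of T] Q by auto
  qed
  then show ?thesis using eq by simp
qed

lemma apply_on_ctrl:
  assumes Q: "finite Q" "R \<subseteq> Q"
  shows "apply_on Q (ctrl R F) \<psi> S = apply_on R (F (S \<inter> Q - R)) \<psi> S"
proof -
  have "apply_on Q (ctrl R F) \<psi> S
      = (\<Sum>T\<in>Pow R. ctrl R F (S \<inter> Q) ((S \<inter> Q - R) \<union> T) * \<psi> ((S - Q) \<union> ((S \<inter> Q - R) \<union> T)))"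
    unfolding apply_on_def by (rule sum_ctrl[OF Q]) (auto simp: ctrl_def)
  also have "\<dots> = apply_on R (F (S \<inter> Q - R)) \<psi> S"
    unfolding apply_on_def
  proof (intro sum.cong refl)
    fix T assume T: "T \<in> Pow R"
    have "((S \<inter> Q - R) \<union> T) - R = S \<inter> Q - R" "((S \<inter> Q - R) \<union> T) \<inter> R = T"
      "(S - Q) \<union> ((S \<inter> Q - R) \<union> T) = (S - R) \<union> T" "S \<inter> Q \<inter> R = S \<inter> R"
      using T Q by auto
    then show "ctrl R F (S \<inter> Q) ((S \<inter> Q - R) \<union> T) * \<psi> ((S - Q) \<union> ((S \<inter> Q - R) \<union> T))
        = F (S \<inter> Q - R) (S \<inter> R) T * \<psi> ((S - R) \<union> T)"
      by (simp add: ctrl_def)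
  qed
  finally show ?thesis .
qed

lemma unitary_on_ctrl:
  assumes Q: "finite Q" "R \<subseteq> Q" and F: "\<And>\<beta>. unitary_on R (F \<beta>)"
  shows "unitary_on Q (ctrl R F)"
  unfolding unitary_on_def
proof (intro ballI)
  fix S T assume ST: "S \<in> Pow Q" "T \<in> Pow Q"
  have "(\<Sum>X\<in>Pow Q. cnj (ctrl R F X S) * ctrl R F X T)
      = (\<Sum>X\<in>Pow R. cnj (ctrl R F ((S - R) \<union> X) S) * ctrl R F ((S - R) \<union> X) T)"
    by (rule sum_ctrl[OF Q]) (use ST in \<open>auto simp: ctrl_def\<close>)
  also have "\<dots> = (\<Sum>X\<in>Pow R. if S - R = T - R then cnj (F (S - R) X (S \<inter> R)) * F (S - R) X (T \<inter> R) else 0)"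
  proof (intro sum.cong refl)
    fix X assume "X \<in> Pow R"
    then have "((S - R) \<union> X) - R = S - R" "((S - R) \<union> X) \<inter> R = X" by auto
    then show "cnj (ctrl R F ((S - R) \<union> X) S) * ctrl R F ((S - R) \<union> X) T
        = (if S - R = T - R then cnj (F (S - R) X (S \<inter> R)) * F (S - R) X (T \<inter> R) else 0)"
      by (cases "S - R = T - R") (auto simp: ctrl_def)
  qed
  also have "\<dots> = (if S - R = T - R \<and> S \<inter> R = T \<inter> R then 1 else 0)"
    using F[of "S - R"] by (cases "S - R = T - R") (simp_all add: unitary_on_def)
  also have "(S - R = T - R \<and> S \<inter> R = T \<inter> R) = (S = T)" by blast
  finally show "(\<Sum>X\<in>Pow Q. cnj (ctrl R F X S) * ctrl R F X T) = (if S = T then 1 else 0)" .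
qed

text \<open>No-signalling: an operation outside \<open>K\<close> acts unitarily on the vectors whose
  inner products are the entries of the reduced density matrix.\<close>

lemma density_apply_on:
  assumes V: "finite V" "K \<subseteq> V" "Q \<subseteq> V - K" and U: "unitary_on Q U"
  shows "density V K (apply_on Q U \<psi>) = density V K \<psi>"
proof (intro ext)
  fix S T
  show "density V K (apply_on Q U \<psi>) S T = density V K \<psi> S T"
  proof (cases "S \<subseteq> K \<and> T \<subseteq> K")
    case True
    have ap: "apply_on Q U \<psi> (S \<union> R) = apply_on Q U (\<lambda>R. \<psi> (S \<union> R)) R" if "S \<subseteq> K" for S R
    proof -
      have "(S \<union> R) \<inter> Q = R \<inter> Q" "(S \<union> R - Q) \<union> X = S \<union> ((R - Q) \<union> X)" for X
        using that V by auto
      then show ?thesis by (simp add: apply_on_def)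
    qed
    have "ip (Pow (V - K)) (apply_on Q U (\<lambda>R. \<psi> (T \<union> R))) (apply_on Q U (\<lambda>R. \<psi> (S \<union> R)))
        = ip (Pow (V - K)) (\<lambda>R. \<psi> (T \<union> R)) (\<lambda>R. \<psi> (S \<union> R))"
      using V U by (intro ip_apply_on) auto
    then show ?thesis
      using True by (simp add: density_def ip_def ap mult.commute)
  next
    case False
    then show ?thesis unfolding density_def by (simp only: if_False)
  qed
qed

section \<open>Measurements\<close>

lemma incorrect_prob_eq:
  assumes V: "finite (all_qubits P)" "measured P \<subseteq> all_qubits P"
  shows "incorrect_prob G s t P a b = (\<Sum>S\<in>Pow (all_qubits P).
    of_bool (decode P (S \<inter> measured P) \<noteq> answer G a b) * (cmod (qstate P s a b (Suc t) S))\<^sup>2)"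
proof -
  let ?V = "all_qubits P" and ?M = "measured P"
  have eq: "?V = ?M \<union> (?V - ?M)" using V by auto
  have "(\<Sum>S\<in>Pow (?M \<union> (?V - ?M)). of_bool (decode P (S \<inter> ?M) \<noteq> answer G a b) * (cmod (qstate P s a b (Suc t) S))\<^sup>2)
      = (\<Sum>S\<in>Pow ?M. \<Sum>R\<in>Pow (?V - ?M). of_bool (decode P ((S \<union> R) \<inter> ?M) \<noteq> answer G a b) * (cmod (qstate P s a b (Suc t) (S \<union> R)))\<^sup>2)"
    using V by (intro sum_Pow_Un) (auto intro: finite_subset)
  also have "\<dots> = (\<Sum>S\<in>Pow ?M. if decode P S \<noteq> answer G a b then outcome_prob ?V ?M (qstate P s a b (Suc t)) S else 0)"
  proof (intro sum.cong refl)
    fix S assume S: "S \<in> Pow ?M"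
    have "(S \<union> R) \<inter> ?M = S" if "R \<in> Pow (?V - ?M)" for R using S that by auto
    then show "(\<Sum>R\<in>Pow (?V - ?M). of_bool (decode P ((S \<union> R) \<inter> ?M) \<noteq> answer G a b) * (cmod (qstate P s a b (Suc t) (S \<union> R)))\<^sup>2)
        = (if decode P S \<noteq> answer G a b then outcome_prob ?V ?M (qstate P s a b (Suc t)) S else 0)"
      by (simp add: outcome_prob_def)
  qed
  also have "\<dots> = incorrect_prob G s t P a b"
    unfolding incorrect_prob_def using V
    by (subst sum.inter_filter[symmetric]) (auto intro: finite_subset simp: Pow_def)
  finally show ?thesis using eq by simp
qed

text \<open>By AM-GM the mixed term \<open>2 * s\<close> of the squared bound is at most p(1 - p) +
  q(1 - q), and the sum simplifies to 1 - (p - q)^2.\<close>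

lemma outcome_difference_real:
  fixes p q F :: real
  assumes p: "0 \<le> p" "p \<le> 1" and q: "0 \<le> q" "q \<le> 1" and F: "0 \<le> F" "F \<le> sqrt p * sqrt q + sqrt (1 - p) * sqrt (1 - q)"
  shows "\<bar>p - q\<bar> \<le> sqrt (1 - F\<^sup>2)"
proof (rule real_le_rsqrt)
  define s where "s = sqrt p * sqrt q * sqrt (1 - p) * sqrt (1 - q)"
  have "F\<^sup>2 \<le> (sqrt p * sqrt q + sqrt (1 - p) * sqrt (1 - q))\<^sup>2"
    using F by (intro power_mono) auto
  also have "\<dots> = p * q + (1 - p) * (1 - q) + 2 * s"
    using p q by (simp add: power2_sum power_mult_distrib s_def)
  finally have 1: "F\<^sup>2 \<le> p * q + (1 - p) * (1 - q) + 2 * s" .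
  have "0 \<le> (sqrt p * sqrt (1 - p) - sqrt q * sqrt (1 - q))\<^sup>2" by simp
  also have "\<dots> = p * (1 - p) + q * (1 - q) - 2 * s"
    using p q by (simp add: power2_diff power_mult_distrib s_def)
  finally have "2 * s \<le> p * (1 - p) + q * (1 - q)" by simp
  then have "F\<^sup>2 \<le> p * q + (1 - p) * (1 - q) + (p * (1 - p) + q * (1 - q))" using 1 by simp
  also have "\<dots> = 1 - (p - q)\<^sup>2" by (simp add: power2_eq_square algebra_simps)
  finally show "\<bar>p - q\<bar>\<^sup>2 \<le> 1 - F\<^sup>2" by simp
qed

text \<open>Split the inner product according to the event and apply Cauchy--Schwarz to each part;
  the squared norms of the parts are the outcome probabilities.\<close>

lemma outcome_difference:
  assumes I: "finite I" and a: "(\<Sum>i\<in>I. (cmod (a i))\<^sup>2) = 1" and b: "(\<Sum>i\<in>I. (cmod (b i))\<^sup>2) = 1"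
  shows "\<bar>(\<Sum>i\<in>I. of_bool (E i) * (cmod (a i))\<^sup>2) - (\<Sum>i\<in>I. of_bool (E i) * (cmod (b i))\<^sup>2)\<bar>
    \<le> sqrt (1 - (cmod (ip I a b))\<^sup>2)"
proof (rule outcome_difference_real)
  let ?J = "{i\<in>I. E i}" and ?N = "{i\<in>I. \<not> E i}"
  have split: "(\<Sum>i\<in>I. g i) = (\<Sum>i\<in>?J. g i) + (\<Sum>i\<in>?N. g i)" for g :: "'a \<Rightarrow> 'b::comm_monoid_add"
  proof -
    have "I = ?J \<union> ?N" by auto
    then show ?thesis using I by (subst sum.union_disjoint[symmetric]) auto
  qed
  have J: "(\<Sum>i\<in>I. of_bool (E i) * g i) = (\<Sum>i\<in>?J. g i)" for g :: "'a \<Rightarrow> real"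
    unfolding split[of "\<lambda>i. of_bool (E i) * g i"] by simp
  let ?p = "\<Sum>i\<in>I. of_bool (E i) * (cmod (a i))\<^sup>2" and ?q = "\<Sum>i\<in>I. of_bool (E i) * (cmod (b i))\<^sup>2"
  have p: "(\<Sum>i\<in>?N. (cmod (a i))\<^sup>2) = 1 - ?p" and q: "(\<Sum>i\<in>?N. (cmod (b i))\<^sup>2) = 1 - ?q"
    using a b unfolding J split[of "\<lambda>i. (cmod (a i))\<^sup>2"] split[of "\<lambda>i. (cmod (b i))\<^sup>2"] by linarith+
  show "0 \<le> ?p" "0 \<le> ?q" by (auto intro!: sum_nonneg)
  have "0 \<le> 1 - ?p" "0 \<le> 1 - ?q" unfolding p[symmetric] q[symmetric] by (auto intro!: sum_nonneg)
  then show "?p \<le> 1" "?q \<le> 1" by auto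
  have cs: "cmod (ip X a b) \<le> sqrt (\<Sum>r\<in>X. (cmod (a r))\<^sup>2) * sqrt (\<Sum>r\<in>X. (cmod (b r))\<^sup>2)" for X
    unfolding real_sqrt_mult[symmetric] by (rule real_le_rsqrt[OF ip_cauchy_schwarz])
  have "cmod (ip I a b) \<le> cmod (ip ?J a b) + cmod (ip ?N a b)"
    unfolding ip_def split[of "\<lambda>r. cnj (a r) * b r"] by (rule norm_triangle_ineq)
  also have "\<dots> \<le> sqrt ?p * sqrt ?q + sqrt (1 - ?p) * sqrt (1 - ?q)"
    using cs[of ?J] cs[of ?N] unfolding p q J by (intro add_mono)
  finally show "cmod (ip I a b) \<le> sqrt ?p * sqrt ?q + sqrt (1 - ?p) * sqrt (1 - ?q)" .
qed simp

section \<open>The state in which the first message is sent\<close>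

text \<open>Until a message is sent the state is a product. \<open>alice_state\<close> is Alice's
  factor after her first operation and \<open>bob_state\<close> Bob's initial factor, both as
  functions that ignore all other qubits.\<close>

definition alice_state :: "('a, 'b, 'z) qprotocol \<Rightarrow> 'a \<Rightarrow> amplitudes" where
  "alice_state P a = apply_on (own P Alice) (op P 0) (\<lambda>S.
     if S \<inter> inp P Alice = alice_code P a then work P Alice (S \<inter> (own P Alice - inp P Alice)) else 0)"

definition bob_state :: "('a, 'b, 'z) qprotocol \<Rightarrow> 'b \<Rightarrow> amplitudes" where
  "bob_state P b S = (if S \<inter> inp P Bob = bob_code P b then work P Bob (S \<inter> (own P Bob - inp P Bob)) else 0)"

lemma sum_basis_tensor_unit:
  assumes "finite A" "I \<subseteq> A" "x \<subseteq> I" "unit_state (A - I) \<psi>"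
  shows "(\<Sum>S\<in>Pow A. (cmod (if S \<inter> I = x then \<psi> (S \<inter> (A - I)) else 0))\<^sup>2) = 1"
proof -
  have eq: "A = I \<union> (A - I)" using assms by auto
  have "(\<Sum>S\<in>Pow (I \<union> (A - I)). (cmod (if S \<inter> I = x then \<psi> (S \<inter> (A - I)) else 0))\<^sup>2)
      = (\<Sum>T\<in>Pow (A - I). (cmod (if (x \<union> T) \<inter> I = x then \<psi> ((x \<union> T) \<inter> (A - I)) else 0))\<^sup>2)"
    using assms by (intro sum_slice) (auto intro: finite_subset)
  also have "\<dots> = (\<Sum>T\<in>Pow (A - I). (cmod (\<psi> T))\<^sup>2)"
  proof (intro sum.cong refl)
    fix T assume "T \<in> Pow (A - I)"
    then have "(x \<union> T) \<inter> I = x" "(x \<union> T) \<inter> (A - I) = T" using assms by auto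
    then show "(cmod (if (x \<union> T) \<inter> I = x then \<psi> ((x \<union> T) \<inter> (A - I)) else 0))\<^sup>2 = (cmod (\<psi> T))\<^sup>2" by simp
  qed
  also have "\<dots> = 1" using assms by (simp add: unit_state_def)
  finally show ?thesis using eq by simp
qed

lemma norm_apply_on:
  assumes "finite V" "Q \<subseteq> V" "unitary_on Q U"
  shows "(\<Sum>S\<in>Pow V. (cmod (apply_on Q U \<psi> S))\<^sup>2) = (\<Sum>S\<in>Pow V. (cmod (\<psi> S))\<^sup>2)"
  using ip_apply_on[OF assms, of \<psi> \<psi>] unfolding ip_self of_real_eq_iff .

context
  fixes G :: "('a, 'b, 'z) game" and t :: nat and P :: "('a, 'b, 'z) qprotocol"
  assumes P: "is_coinless_protocol G Alice t P"
begin

lemma coinlessD: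
  "finite (own P Alice)" "finite (own P Bob)" "own P Alice \<inter> own P Bob = {}"
  "inp P Alice \<subseteq> own P Alice" "inp P Bob \<subseteq> own P Bob"
  "(a, b) \<in> inputs G \<Longrightarrow> alice_code P a \<subseteq> inp P Alice" "(a, b) \<in> inputs G \<Longrightarrow> bob_code P b \<subseteq> inp P Bob"
  "unit_state (own P Alice - inp P Alice) (work P Alice)" "unit_state (own P Bob - inp P Bob) (work P Bob)"
  "k \<le> t \<Longrightarrow> unitary_on (held P Alice k (mover Alice k)) (op P k)"
  "k < t \<Longrightarrow> msg P k \<subseteq> held P Alice k (mover Alice k)"
  "measured P \<subseteq> held P Alice t (mover Alice t)"
proof -
  have "alice_code P ` fst ` inputs G \<subseteq> Pow (inp P Alice)" "bob_code P ` snd ` inputs G \<subseteq> Pow (inp P Bob)"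
    using P by (simp_all only: is_coinless_protocol_def)
  then show "(a, b) \<in> inputs G \<Longrightarrow> alice_code P a \<subseteq> inp P Alice"
    "(a, b) \<in> inputs G \<Longrightarrow> bob_code P b \<subseteq> inp P Bob"
    by (force simp: image_subset_iff)+
qed (use P in \<open>simp_all add: is_coinless_protocol_def\<close>)

lemma finite_all_qubits: "finite (all_qubits P)"
  using coinlessD by (simp add: all_qubits_def)

lemma held_subset: "k \<le> t \<Longrightarrow> held P Alice k q \<subseteq> all_qubits P"
proof (induction k arbitrary: q)
  case 0
  then show ?case by (cases q) (auto simp: all_qubits_def)
next
  case (Suc k)
  then have "msg P k \<subseteq> all_qubits P"
    using coinlessD(11)[of k] by (meson Suc_le_lessD Suc_leD order_trans)
  then show ?case using Suc by auto
qed

lemma measured_subset: "measured P \<subseteq> all_qubits P"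
  using coinlessD(12) held_subset[of t] by blast

text \<open>States are functions on all sets of numbers; independence of foreign qubits lets the
  states of \<open>P\<close> be read inside the larger register of the new protocol.\<close>

lemma qstate_restrict: "k \<le> Suc t \<Longrightarrow> qstate P Alice a b k S = qstate P Alice a b k (S \<inter> all_qubits P)"
proof (induction k arbitrary: S)
  case 0
  have "S \<inter> all_qubits P \<inter> inp P q = S \<inter> inp P q" "S \<inter> all_qubits P \<inter> (own P q - inp P q) = S \<inter> (own P q - inp P q)" for q
    using coinlessD(4,5) by (cases q; auto simp: all_qubits_def)+
  then show ?case by (simp add: init_state_def)
next
  case (Suc k)
  let ?Q = "held P Alice k (mover Alice k)"
  have Q: "?Q \<subseteq> all_qubits P" using Suc.prems by (intro held_subset) auto
  have "S \<inter> ?Q = S \<inter> all_qubits P \<inter> ?Q" using Q by auto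
  moreover have "qstate P Alice a b k ((S - ?Q) \<union> T) = qstate P Alice a b k ((S \<inter> all_qubits P - ?Q) \<union> T)" if "T \<subseteq> ?Q" for T
  proof -
    have "((S - ?Q) \<union> T) \<inter> all_qubits P = ((S \<inter> all_qubits P - ?Q) \<union> T) \<inter> all_qubits P" by auto
    then show ?thesis using Suc.IH[of "(S - ?Q) \<union> T"] Suc.IH[of "(S \<inter> all_qubits P - ?Q) \<union> T"] Suc.prems by simp
  qed
  ultimately show ?case by (simp add: apply_on_def)
qed

lemma alice_state_restrict: "alice_state P a S = alice_state P a (S \<inter> own P Alice)"
proof -
  let ?A = "own P Alice"
  have "((S - ?A) \<union> T) \<inter> inp P Alice = ((S \<inter> ?A - ?A) \<union> T) \<inter> inp P Alice"
    "((S - ?A) \<union> T) \<inter> (?A - inp P Alice) = ((S \<inter> ?A - ?A) \<union> T) \<inter> (?A - inp P Alice)" for T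
    using coinlessD(4) by auto
  then show ?thesis
    unfolding alice_state_def apply_on_def by (simp only: Int_assoc Int_absorb)
qed

lemma bob_state_restrict: "bob_state P b S = bob_state P b (S \<inter> own P Bob)"
proof -
  have "S \<inter> own P Bob \<inter> inp P Bob = S \<inter> inp P Bob"
    "S \<inter> own P Bob \<inter> (own P Bob - inp P Bob) = S \<inter> (own P Bob - inp P Bob)"
    using coinlessD(5) by auto
  then show ?thesis by (simp add: bob_state_def)
qed

lemma bob_state_norm: "(a, b) \<in> inputs G \<Longrightarrow> (\<Sum>S\<in>Pow (own P Bob). (cmod (bob_state P b S))\<^sup>2) = 1"
  unfolding bob_state_def by (intro sum_basis_tensor_unit coinlessD)

lemma alice_state_norm: "(a, b) \<in> inputs G \<Longrightarrow> (\<Sum>S\<in>Pow (own P Alice). (cmod (alice_state P a S))\<^sup>2) = 1"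
proof -
  assume ab: "(a, b) \<in> inputs G"
  have U: "unitary_on (own P Alice) (op P 0)"
    using coinlessD(10)[of 0] by (simp add: mover_def)
  show ?thesis
    unfolding alice_state_def norm_apply_on[OF coinlessD(1) order_refl U]
    by (intro sum_basis_tensor_unit coinlessD(1,4,8) coinlessD(6)[OF ab])
qed

lemma qstate_1: "qstate P Alice a b 1 S = alice_state P a S * bob_state P b S"
proof -
  let ?A = "own P Alice"
  have "qstate P Alice a b 1 S = apply_on ?A (op P 0) (init_state P a b) S"
    by (simp add: mover_def)
  also have "\<dots> = bob_state P b S * alice_state P a S"
    unfolding alice_state_def
  proof (rule apply_on_scale)
    fix T assume "T \<subseteq> ?A"
    then have "((S - ?A) \<union> T) \<inter> inp P Bob = S \<inter> inp P Bob"
      "((S - ?A) \<union> T) \<inter> (own P Bob - inp P Bob) = S \<inter> (own P Bob - inp P Bob)"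
      using coinlessD(3,5) by auto
    then show "init_state P a b ((S - ?A) \<union> T) = bob_state P b S *
        (if ((S - ?A) \<union> T) \<inter> inp P Alice = alice_code P a then work P Alice (((S - ?A) \<union> T) \<inter> (?A - inp P Alice)) else 0)"
      by (simp add: init_state_def bob_state_def)
  qed
  finally show ?thesis by simp
qed

text \<open>Bob's factor has norm 1 and disappears when his qubits are traced out. This transfers
  the condition on the safe overhead to \<open>alice_state\<close>.\<close>

lemma density_qstate_1:
  assumes Q: "Q \<subseteq> own P Alice" and ab: "(a, b) \<in> inputs G"
  shows "density (all_qubits P) Q (qstate P Alice a b 1) = density (own P Alice) Q (alice_state P a)"
proof (intro ext)
  fix S T
  let ?A = "own P Alice" and ?B = "own P Bob"
  show "density (all_qubits P) Q (qstate P Alice a b 1) S T = density ?A Q (alice_state P a) S T"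
  proof (cases "S \<subseteq> Q \<and> T \<subseteq> Q")
    case True
    have eq: "all_qubits P - Q = (?A - Q) \<union> ?B" using Q coinlessD(3) by (auto simp: all_qubits_def)
    have "(\<Sum>R\<in>Pow ((?A - Q) \<union> ?B). qstate P Alice a b 1 (S \<union> R) * cnj (qstate P Alice a b 1 (T \<union> R)))
        = (\<Sum>R\<in>Pow (?A - Q). \<Sum>R'\<in>Pow ?B. qstate P Alice a b 1 (S \<union> (R \<union> R')) * cnj (qstate P Alice a b 1 (T \<union> (R \<union> R'))))"
      using coinlessD(1-3) by (intro sum_Pow_Un) auto
    also have "\<dots> = (\<Sum>R\<in>Pow (?A - Q). \<Sum>R'\<in>Pow ?B. alice_state P a (S \<union> R) * cnj (alice_state P a (T \<union> R)) *
        of_real ((cmod (bob_state P b R'))\<^sup>2))"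
    proof (intro sum.cong refl)
      fix R R' assume R: "R \<in> Pow (?A - Q)" "R' \<in> Pow ?B"
      have "qstate P Alice a b 1 (X \<union> (R \<union> R')) = alice_state P a (X \<union> R) * bob_state P b R'" if "X \<subseteq> Q" for X
      proof -
        have "(X \<union> (R \<union> R')) \<inter> ?A = (X \<union> R) \<inter> ?A" "(X \<union> (R \<union> R')) \<inter> ?B = R' \<inter> ?B"
          using R that Q coinlessD(3) by auto
        then show ?thesis
          unfolding qstate_1 by (metis alice_state_restrict bob_state_restrict)
      qed
      then show "qstate P Alice a b 1 (S \<union> (R \<union> R')) * cnj (qstate P Alice a b 1 (T \<union> (R \<union> R')))
          = alice_state P a (S \<union> R) * cnj (alice_state P a (T \<union> R)) * of_real ((cmod (bob_state P b R'))\<^sup>2)"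
        using True by (simp add: complex_norm_square mult_ac del: of_real_power)
    qed
    also have "\<dots> = (\<Sum>R\<in>Pow (?A - Q). alice_state P a (S \<union> R) * cnj (alice_state P a (T \<union> R)) *
        of_real (\<Sum>R'\<in>Pow ?B. (cmod (bob_state P b R'))\<^sup>2))"
      by (simp add: sum_distrib_left)
    finally show ?thesis
      unfolding bob_state_norm[OF ab] using True by (simp add: density_def eq)
  next
    case False
    then show ?thesis unfolding density_def by (simp only: if_False)
  qed
qed

end

lemma density_marginal:
  assumes A: "finite A" and M: "Q \<subseteq> M" "M \<subseteq> A" and k: "k \<subseteq> Q" "k' \<subseteq> Q"
  shows "(\<Sum>m\<in>Pow (M - Q). density A M \<psi> (m \<union> k) (m \<union> k')) = density A Q \<psi> k k'"
proof -
  have eq: "A - Q = (M - Q) \<union> (A - M)" using M by auto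
  have "density A Q \<psi> k k' = (\<Sum>R\<in>Pow ((M - Q) \<union> (A - M)). \<psi> (k \<union> R) * cnj (\<psi> (k' \<union> R)))"
    using k by (simp add: density_def eq)
  also have "\<dots> = (\<Sum>m\<in>Pow (M - Q). \<Sum>R\<in>Pow (A - M). \<psi> (k \<union> (m \<union> R)) * cnj (\<psi> (k' \<union> (m \<union> R))))"
    using A M by (intro sum_Pow_Un) (auto intro: finite_subset)
  also have "\<dots> = (\<Sum>m\<in>Pow (M - Q). density A M \<psi> (m \<union> k) (m \<union> k'))"
    using k M by (intro sum.cong refl) (auto simp: density_def Un_ac)
  finally show ?thesis ..
qed

lemma density_mat_density:
  assumes A: "finite A" "M \<subseteq> A" and norm: "(\<Sum>S\<in>Pow A. (cmod (\<psi> S))\<^sup>2) = 1"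
  shows "density_mat (Pow M) (density A M \<psi>)"
  unfolding density_mat_def
proof (intro conjI ballI allI)
  fix S T
  show "density A M \<psi> S T = cnj (density A M \<psi> T S)"
    by (auto simp: density_def mult.commute)
next
  fix z
  have "ip (Pow M) z (mv (Pow M) (density A M \<psi>) z)
      = (\<Sum>S\<in>Pow M. \<Sum>T\<in>Pow M. \<Sum>R\<in>Pow (A - M). (cnj (z S) * \<psi> (S \<union> R)) * (cnj (\<psi> (T \<union> R)) * z T))"
    unfolding ip_def mv_def sum_distrib_left
    by (intro sum.cong refl) (auto simp: density_def sum_distrib_left sum_distrib_right mult_ac)
  also have "\<dots> = (\<Sum>S\<in>Pow M. \<Sum>R\<in>Pow (A - M). \<Sum>T\<in>Pow M. (cnj (z S) * \<psi> (S \<union> R)) * (cnj (\<psi> (T \<union> R)) * z T))"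
    by (intro sum.cong sum.swap refl)
  also have "\<dots> = (\<Sum>R\<in>Pow (A - M). \<Sum>S\<in>Pow M. \<Sum>T\<in>Pow M. (cnj (z S) * \<psi> (S \<union> R)) * (cnj (\<psi> (T \<union> R)) * z T))"
    by (rule sum.swap)
  also have "\<dots> = (\<Sum>R\<in>Pow (A - M). cnj (ip (Pow M) (\<lambda>S. \<psi> (S \<union> R)) z) * ip (Pow M) (\<lambda>S. \<psi> (S \<union> R)) z)"
    unfolding cnj_ip unfolding ip_def sum_product ..
  also have "\<dots> = of_real (\<Sum>R\<in>Pow (A - M). (cmod (ip (Pow M) (\<lambda>S. \<psi> (S \<union> R)) z))\<^sup>2)"
    by (simp add: complex_norm_square mult.commute del: of_real_power)
  finally show "quad (Pow M) (density A M \<psi>) z \<ge> 0"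
    by (simp add: quad_def sum_nonneg)
next
  have eq: "A = M \<union> (A - M)" using A by auto
  have "(\<Sum>S\<in>Pow M. density A M \<psi> S S) = of_real (\<Sum>S\<in>Pow M. \<Sum>R\<in>Pow (A - M). (cmod (\<psi> (S \<union> R)))\<^sup>2)"
    by (simp add: density_def complex_norm_square del: of_real_power)
  also have "(\<Sum>S\<in>Pow M. \<Sum>R\<in>Pow (A - M). (cmod (\<psi> (S \<union> R)))\<^sup>2) = (\<Sum>S\<in>Pow (M \<union> (A - M)). (cmod (\<psi> S))\<^sup>2)"
    using A by (intro sum_Pow_Un[symmetric]) (auto intro: finite_subset)
  also have "\<dots> = 1" using norm eq by simp
  finally show "(\<Sum>S\<in>Pow M. density A M \<psi> S S) = 1" by simp
qed

section \<open>The quantum protocol without the first message\<close>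

text \<open>Bob prepares \<open>\<Phi>\<close>, a purification of the average state of Alice's first message \<open>M\<close>, on \<open>M\<close> and
  on as many new qubits \<open>K\<close>, and sends \<open>K\<close> as the safe overhead of his message. Alice treats
  \<open>\<Phi>\<close> as if it were the purification \<open>\<Psi> x\<close> of the state of \<open>M\<close> for her input \<open>x\<close>, and unitarily
  completes it to the state she would have after her first message, in a superposition over the
  remaining components \<open>v\<close> of her input, of which she keeps a copy in \<open>Z\<close>.\<close>

primrec run :: "('a, 'b, 'z) qprotocol \<Rightarrow> amplitudes \<Rightarrow> nat \<Rightarrow> amplitudes" where
  "run P \<psi> 0 = \<psi>"
| "run P \<psi> (Suc k) = apply_on (held P Alice (Suc k) (mover Alice (Suc k))) (op P (Suc k)) (run P \<psi> k)"

lemma Int_replace_outside: "T \<subseteq> Q \<Longrightarrow> Q \<inter> X = {} \<Longrightarrow> ((S - Q) \<union> T) \<inter> X = S \<inter> X"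
  by blast

lemma Int_replace_inside: "T \<subseteq> Q \<Longrightarrow> X \<subseteq> Q \<Longrightarrow> ((S - Q) \<union> T) \<inter> X = T \<inter> X"
  by blast

text \<open>The prefix is hidden in \<open>a\<close> and \<open>b\<close>: \<open>a x v\<close>
  stands for Alice's list with next letter \<open>x\<close> and completion \<open>v\<close>, the
  latter of law \<open>w\<close>. \<open>IA\<close> and \<open>IB\<close> are the new input
  registers, \<open>Z\<close> stores \<open>v\<close>, and \<open>K\<close> is a copy of
  \<open>M\<close> under \<open>\<kappa>\<close> for the purifying half. The purifications are kept
  abstract; the assumption on \<open>\<Psi>\<close> says that its reduced state on \<open>M\<close>
  is the message state averaged over \<open>v\<close>.\<close>

locale quantum_round =
  fixes G :: "('a, 'b, 'z) game" and t :: nat and P :: "('a, 'b, 'z) qprotocol"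
    and f :: "'x::finite \<Rightarrow> 'y::finite \<Rightarrow> 'z"
    and a :: "'x \<Rightarrow> 'v \<Rightarrow> 'a" and b :: "'y \<Rightarrow> 'b" and V :: "'v set" and w :: "'v \<Rightarrow> real"
    and \<Phi> :: qmatrix and \<Psi> :: "'x \<Rightarrow> qmatrix"
    and M K IA IB Z :: "nat set" and \<kappa> :: "nat \<Rightarrow> nat"
    and ca :: "'x \<Rightarrow> nat set" and cb :: "'y \<Rightarrow> nat set" and cz :: "'v \<Rightarrow> nat set"
  assumes P: "is_coinless_protocol G Alice t P" and t: "t \<ge> 1"
    and ab: "\<And>x y v. v \<in> V \<Longrightarrow> (a x v, b y) \<in> inputs G"
    and answer: "\<And>x y v. v \<in> V \<Longrightarrow> answer G (a x v) (b y) = f x y"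
    and finV: "finite V" and w: "\<And>v. v \<in> V \<Longrightarrow> w v \<ge> 0" "sum w V = 1"
    and M: "M = msg P 0"
    and \<Phi>: "(\<Sum>S\<in>Pow M. \<Sum>T\<in>Pow M. (cmod (\<Phi> S T))\<^sup>2) = 1"
    and \<Psi>: "\<And>x S S'. S \<subseteq> M \<Longrightarrow> S' \<subseteq> M \<Longrightarrow> (\<Sum>T\<in>Pow M. \<Psi> x S T * cnj (\<Psi> x S' T))
      = (\<Sum>v\<in>V. of_real (w v) * density (own P Alice) M (alice_state P (a x v)) S S')"
    and K: "inj_on \<kappa> M" "K = \<kappa> ` M"
    and finI: "finite IA" "finite IB" "finite Z"
    and fresh: "all_qubits P \<inter> K = {}" "all_qubits P \<inter> IA = {}" "all_qubits P \<inter> IB = {}" "all_qubits P \<inter> Z = {}"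
      "K \<inter> IA = {}" "K \<inter> IB = {}" "K \<inter> Z = {}" "IA \<inter> IB = {}" "IA \<inter> Z = {}" "IB \<inter> Z = {}"
    and codes: "\<And>x. ca x \<subseteq> IA" "inj ca" "\<And>y. cb y \<subseteq> IB" "inj cb" "\<And>v. v \<in> V \<Longrightarrow> cz v \<subseteq> Z" "inj_on cz V"
begin

text \<open>Alice's old qubits after the first message, her old input qubits included. Together with
  \<open>Z\<close> and \<open>K\<close> they form \<open>R\<close>, on which she completes her
  state.\<close>

definition A where "A = own P Alice - M"
definition B where "B = own P Bob"
definition R where "R = A \<union> Z \<union> K"
definition kinv where "kinv T = {q \<in> M. \<kappa> q \<in> T}"
definition univ where "univ = IA \<union> IB \<union> K \<union> Z \<union> all_qubits P"

lemma M_subset: "M \<subseteq> own P Alice"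
  using coinlessD(11)[OF P, of 0] t by (simp add: M mover_def)

lemma own_Alice: "own P Alice = A \<union> M"
  using M_subset by (auto simp: A_def)

lemma all_qubits: "all_qubits P = A \<union> M \<union> B"
  using M_subset by (auto simp: all_qubits_def A_def B_def)

lemma dj:
  "A \<inter> M = {}" "A \<inter> B = {}" "M \<inter> B = {}"
  "A \<inter> K = {}" "A \<inter> IA = {}" "A \<inter> IB = {}" "A \<inter> Z = {}"
  "M \<inter> K = {}" "M \<inter> IA = {}" "M \<inter> IB = {}" "M \<inter> Z = {}"
  "B \<inter> K = {}" "B \<inter> IA = {}" "B \<inter> IB = {}" "B \<inter> Z = {}"
  "K \<inter> IA = {}" "K \<inter> IB = {}" "K \<inter> Z = {}" "IA \<inter> IB = {}" "IA \<inter> Z = {}" "IB \<inter> Z = {}"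
proof -
  show "A \<inter> M = {}" by (auto simp: A_def)
  show "A \<inter> B = {}" "M \<inter> B = {}"
    using coinlessD(3)[OF P] M_subset by (auto simp: A_def B_def)
qed (use fresh in \<open>auto simp: all_qubits\<close>)

lemma fin: "finite A" "finite B" "finite M" "finite K" "finite IA" "finite IB" "finite Z" "finite R"
proof -
  show "finite M" "finite A" "finite B" "finite IA" "finite IB" "finite Z"
    using finite_subset[OF M_subset coinlessD(1)[OF P]] coinlessD(1,2)[OF P] finI by (auto simp: A_def B_def)
  then show "finite K" by (subst K(2)) simp
  then show "finite R" using \<open>finite A\<close> \<open>finite Z\<close> by (simp add: R_def)
qed

lemma R_disjoint: "R \<inter> IA = {}" "R \<inter> IB = {}" "R \<inter> B = {}" "R \<inter> M = {}" "A \<union> Z \<subseteq> R" "K \<subseteq> R"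
  using dj by (auto simp: R_def)

lemma B_disjoint: "B \<inter> IA = {}" "B \<inter> IB = {}" "B \<inter> (A \<union> Z) = {}" "B \<inter> M = {}" "B \<inter> K = {}"
  using dj by auto

lemma finite_univ: "finite univ"
  using fin by (simp add: univ_def all_qubits)

lemma V_nonempty: "V \<noteq> {}"
  using w by auto

lemma bob_norm: "(\<Sum>S\<in>Pow B. (cmod (bob_state P (b y) S))\<^sup>2) = 1"
  using bob_state_norm[OF P] ab V_nonempty unfolding B_def by blast

lemma bob_restrict: "bob_state P (b y) S = bob_state P (b y) (S \<inter> B)"
  using bob_state_restrict[OF P] by (simp add: B_def)

lemma sum_kinv: "(\<Sum>T\<in>Pow K. g (kinv T)) = (\<Sum>T\<in>Pow M. g T)"
proof (rule sum.reindex_bij_witness[where i = "\<lambda>T. \<kappa> ` T" and j = kinv])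
  fix T assume "T \<in> Pow K"
  then show "\<kappa> ` kinv T = T" by (auto simp: kinv_def K(2))
next
  fix T assume "T \<in> Pow M"
  then show "kinv (\<kappa> ` T) = T" using K(1) by (auto simp: kinv_def inj_on_def)
qed (auto simp: kinv_def K(2))

subsection \<open>Alice's and Bob's first operations\<close>

definition dz where "dz = inv_into V cz"
text \<open>The amplitudes of the superposition of the codes \<open>cz v\<close> in which
  \<open>v\<close> has probability \<open>w v\<close>.\<close>

definition coef :: "nat set \<Rightarrow> complex" where
  "coef z = (if z \<in> cz ` V then of_real (sqrt (w (dz z))) else 0)"

lemma sum_coef: "(\<Sum>z\<in>Pow Z. of_real ((cmod (coef z))\<^sup>2) * g (dz z)) = (\<Sum>v\<in>V. of_real (w v) * g v)"
  for g :: "'v \<Rightarrow> 'c::real_algebra_1"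
proof -
  have dz: "dz (cz v) = v" if "v \<in> V" for v
    using that codes(6) by (simp add: dz_def inv_into_f_f)
  have "(\<Sum>z\<in>Pow Z. of_real ((cmod (coef z))\<^sup>2) * g (dz z)) = (\<Sum>z\<in>cz ` V. of_real ((cmod (coef z))\<^sup>2) * g (dz z))"
    using fin(7) codes(5) by (intro sum.mono_neutral_right) (auto simp: coef_def)
  also have "\<dots> = (\<Sum>v\<in>V. of_real ((cmod (coef (cz v)))\<^sup>2) * g (dz (cz v)))"
    by (simp add: sum.reindex[OF codes(6)])
  also have "\<dots> = (\<Sum>v\<in>V. of_real (w v) * g v)"
    using w(1) by (intro sum.cong) (auto simp: dz coef_def)
  finally show ?thesis .
qed

text \<open>For a basis state \<open>m\<close> of the message, held by Bob, the corresponding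
  component on \<open>R\<close> of a purification, before (\<open>source\<close>) and after
  (\<open>target\<close>) Alice's completion. In \<open>source\<close> only \<open>K\<close> is
  occupied; in \<open>target\<close> the qubits of \<open>K\<close> are back at 0.\<close>

definition source where
  "source x m r = (if r \<inter> (A \<union> Z) = {} then \<Psi> x m (kinv (r \<inter> K)) else 0)"
definition target where
  "target x m r = (if r \<inter> K = {} then coef (r \<inter> Z) * alice_state P (a x (dz (r \<inter> Z))) (m \<union> (r \<inter> A)) else 0)"

lemma gram_source:
  assumes m: "m \<subseteq> M" "m' \<subseteq> M"
  shows "ip (Pow R) (source x m) (source x m')
    = (\<Sum>v\<in>V. of_real (w v) * density (own P Alice) M (alice_state P (a x v)) m' m)"
proof -
  have "ip (Pow R) (source x m) (source x m') = (\<Sum>T\<in>Pow K. cnj (source x m ({} \<union> T)) * source x m' ({} \<union> T))"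
    unfolding ip_def R_def using fin dj by (intro sum_slice) (auto simp: source_def)
  also have "\<dots> = (\<Sum>T\<in>Pow K. \<Psi> x m' (kinv T) * cnj (\<Psi> x m (kinv T)))"
  proof (intro sum.cong refl)
    fix T assume "T \<in> Pow K"
    then have "T \<inter> (A \<union> Z) = {}" "T \<inter> K = T" using dj by auto
    then show "cnj (source x m ({} \<union> T)) * source x m' ({} \<union> T) = \<Psi> x m' (kinv T) * cnj (\<Psi> x m (kinv T))"
      by (simp add: source_def)
  qed
  also have "\<dots> = (\<Sum>T\<in>Pow M. \<Psi> x m' T * cnj (\<Psi> x m T))"
    by (rule sum_kinv)
  finally show ?thesis using \<Psi>[OF m(2,1)] by simp
qed

text \<open>The record of \<open>v\<close> in \<open>Z\<close> makes different completions
  orthogonal, so the superposition has the mixture over \<open>v\<close> as its reduced state on the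
  message, and the Gram matrix agrees with that of \<open>source\<close>.\<close>

lemma gram_target:
  assumes m: "m \<subseteq> M" "m' \<subseteq> M"
  shows "ip (Pow R) (target x m) (target x m')
    = (\<Sum>v\<in>V. of_real (w v) * density (own P Alice) M (alice_state P (a x v)) m' m)"
proof -
  have eq: "R = K \<union> (Z \<union> A)" by (auto simp: R_def)
  have "ip (Pow R) (target x m) (target x m')
      = (\<Sum>U\<in>Pow (Z \<union> A). cnj (target x m ({} \<union> U)) * target x m' ({} \<union> U))"
    unfolding ip_def eq using fin dj by (intro sum_slice) (auto simp: target_def)
  also have "\<dots> = (\<Sum>z\<in>Pow Z. \<Sum>s\<in>Pow A. cnj (target x m ({} \<union> (z \<union> s))) * target x m' ({} \<union> (z \<union> s)))"
    using fin dj by (intro sum_Pow_Un) auto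
  also have "\<dots> = (\<Sum>z\<in>Pow Z. of_real ((cmod (coef z))\<^sup>2) *
      density (own P Alice) M (alice_state P (a x (dz z))) m' m)"
  proof (rule sum.cong[OF refl])
    fix z assume z: "z \<in> Pow Z"
    have "own P Alice - M = A" by (simp add: A_def)
    moreover have "cnj (target x m ({} \<union> (z \<union> s))) * target x m' ({} \<union> (z \<union> s))
        = of_real ((cmod (coef z))\<^sup>2) *
          (alice_state P (a x (dz z)) (m' \<union> s) * cnj (alice_state P (a x (dz z)) (m \<union> s)))" if "s \<in> Pow A" for s
    proof -
      have "(z \<union> s) \<inter> K = {}" "(z \<union> s) \<inter> Z = z" "(z \<union> s) \<inter> A = s" using z that dj by auto
      then show ?thesis
        by (simp add: target_def complex_norm_square mult_ac del: of_real_power)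
    qed
    ultimately show "(\<Sum>s\<in>Pow A. cnj (target x m ({} \<union> (z \<union> s))) * target x m' ({} \<union> (z \<union> s)))
        = of_real ((cmod (coef z))\<^sup>2) * density (own P Alice) M (alice_state P (a x (dz z))) m' m"
      using m by (simp add: density_def sum_distrib_left del: of_real_power)
  qed
  also have "\<dots> = (\<Sum>v\<in>V. of_real (w v) * density (own P Alice) M (alice_state P (a x v)) m' m)"
    by (rule sum_coef)
  finally show ?thesis .
qed

text \<open>Purifications of the same state differ by a unitary on the purifying system; this
  unitary rebuilds Alice's side from \<open>K\<close>.\<close>

definition VA where
  "VA x = (SOME U. unitary_on R U \<and> (\<forall>m\<in>Pow M. \<forall>r\<in>Pow R. mv (Pow R) U (source x m) r = target x m r))"

lemma VA: "unitary_on R (VA x)" "m \<subseteq> M \<Longrightarrow> r \<subseteq> R \<Longrightarrow> mv (Pow R) (VA x) (source x m) r = target x m r"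
proof -
  have "\<exists>U. unitary_mat (Pow R) U \<and> (\<forall>m\<in>Pow M. \<forall>r\<in>Pow R. mv (Pow R) U (source x m) r = target x m r)"
    using fin by (intro isometry_extension) (auto simp: gram_source gram_target)
  from someI_ex[OF this[folded unitary_on_eq]]
  show "unitary_on R (VA x)" "m \<subseteq> M \<Longrightarrow> r \<subseteq> R \<Longrightarrow> mv (Pow R) (VA x) (source x m) r = target x m r"
    by (auto simp: VA_def)
qed

text \<open>Bob's old input qubits are now work qubits in state 0, so his whole old initial state,
  code word included, has to be created for the given \<open>y\<close>.\<close>

definition VB where
  "VB y = (SOME U. unitary_on B U \<and>
    (\<forall>S\<in>Pow B. mv (Pow B) U (\<lambda>T. if T = {} then 1 else 0) S = bob_state P (b y) S))"

lemma VB: "unitary_on B (VB y)" "S \<subseteq> B \<Longrightarrow> mv (Pow B) (VB y) (\<lambda>T. if T = {} then 1 else 0) S = bob_state P (b y) S"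
proof -
  let ?e = "\<lambda>T :: nat set. if T = {} then 1 else 0 :: complex"
  have "ip (Pow B) ?e ?e = 1"
    using fin by (simp add: ip_def if_distrib[of cnj] if_distrib[of "\<lambda>z. _ * z"] cong: if_cong)
  moreover have "ip (Pow B) (bob_state P (b y)) (bob_state P (b y)) = 1"
    unfolding ip_self bob_norm by simp
  ultimately have "\<exists>U. unitary_mat (Pow B) U \<and>
      (\<forall>j\<in>{()}. \<forall>S\<in>Pow B. mv (Pow B) U ?e S = bob_state P (b y) S)"
    using fin by (intro isometry_extension) auto
  then have "\<exists>U. unitary_on B U \<and> (\<forall>S\<in>Pow B. mv (Pow B) U ?e S = bob_state P (b y) S)"
    by (simp add: unitary_on_eq)
  from someI_ex[OF this]
  show "unitary_on B (VB y)" "S \<subseteq> B \<Longrightarrow> mv (Pow B) (VB y) ?e S = bob_state P (b y) S"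
    by (auto simp: VB_def)
qed

text \<open>The state of \<open>M\<close> and \<open>K\<close> is a parameter
  \<open>\<Theta>\<close>: the new protocol starts with \<open>\<Phi>\<close>, while the analysis
  compares it with a fictitious run from \<open>\<Psi> x\<close>.\<close>

definition start where
  "start \<Theta> x y S = (if S \<inter> IA = ca x \<and> S \<inter> IB = cb y \<and> S \<inter> (A \<union> Z) = {} \<and> S \<inter> B = {}
    then \<Theta> (S \<inter> M) (kinv (S \<inter> K)) else 0 :: complex)"

definition prepared where
  "prepared \<Theta> x y S = (if S \<inter> IA = ca x \<and> S \<inter> IB = cb y \<and> S \<inter> (A \<union> Z) = {}
    then \<Theta> (S \<inter> M) (kinv (S \<inter> K)) * bob_state P (b y) S else 0 :: complex)"

text \<open>The state of the given protocol when its first message is sent, in superposition over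
  the completions recorded in \<open>Z\<close>, with \<open>K\<close> back at 0.\<close>

definition ideal where
  "ideal x y S = (if S \<inter> IA = ca x \<and> S \<inter> IB = cb y \<and> S \<inter> K = {}
    then coef (S \<inter> Z) * qstate P Alice (a x (dz (S \<inter> Z))) (b y) 1 S else 0)"

lemma apply_VB: "apply_on B (VB y) (start \<Theta> x y) = prepared \<Theta> x y"
proof
  fix S
  define c where "c = (if S \<inter> IA = ca x \<and> S \<inter> IB = cb y \<and> S \<inter> (A \<union> Z) = {}
    then \<Theta> (S \<inter> M) (kinv (S \<inter> K)) else 0 :: complex)"
  have "start \<Theta> x y ((S - B) \<union> T) = c * (if T = {} then 1 else 0)" if "T \<subseteq> B" for T
  proof -
    have e: "((S - B) \<union> T) \<inter> IA = S \<inter> IA" "((S - B) \<union> T) \<inter> IB = S \<inter> IB" "((S - B) \<union> T) \<inter> (A \<union> Z) = S \<inter> (A \<union> Z)"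
      "((S - B) \<union> T) \<inter> B = T" "((S - B) \<union> T) \<inter> M = S \<inter> M" "((S - B) \<union> T) \<inter> K = S \<inter> K"
      using that B_disjoint by (simp_all add: Int_replace_outside Int_replace_inside Int_absorb2)
    show ?thesis unfolding start_def c_def e by auto
  qed
  then have "apply_on B (VB y) (start \<Theta> x y) S = c * mv (Pow B) (VB y) (\<lambda>T. if T = {} then 1 else 0) (S \<inter> B)"
    unfolding apply_on_def mv_def sum_distrib_left by (intro sum.cong refl) (simp add: mult_ac)
  also have "\<dots> = c * bob_state P (b y) S"
    using VB(2)[of "S \<inter> B" y] bob_restrict[of y S] by simp
  finally show "apply_on B (VB y) (start \<Theta> x y) S = prepared \<Theta> x y S"
    by (simp add: prepared_def c_def)
qed

lemma apply_VA: "apply_on R (VA x) (prepared (\<Psi> x) x y) = ideal x y"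
proof
  fix S
  define c where "c = (if S \<inter> IA = ca x \<and> S \<inter> IB = cb y then bob_state P (b y) S else 0)"
  have "prepared (\<Psi> x) x y ((S - R) \<union> T) = c * source x (S \<inter> M) T" if "T \<subseteq> R" for T
  proof -
    have "((S - R) \<union> T) \<inter> IA = S \<inter> IA" "((S - R) \<union> T) \<inter> IB = S \<inter> IB" "((S - R) \<union> T) \<inter> (A \<union> Z) = T \<inter> (A \<union> Z)"
      "((S - R) \<union> T) \<inter> B = S \<inter> B" "((S - R) \<union> T) \<inter> M = S \<inter> M" "((S - R) \<union> T) \<inter> K = T \<inter> K"
      using that R_disjoint by (simp_all add: Int_replace_outside Int_replace_inside)
    then show ?thesis
      using bob_restrict[of y "(S - R) \<union> T"] bob_restrict[of y S]
      by (simp add: prepared_def c_def source_def)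
  qed
  then have "apply_on R (VA x) (prepared (\<Psi> x) x y) S = c * mv (Pow R) (VA x) (source x (S \<inter> M)) (S \<inter> R)"
    unfolding apply_on_def mv_def sum_distrib_left by (intro sum.cong refl) (simp add: mult_ac)
  also have "\<dots> = c * target x (S \<inter> M) (S \<inter> R)"
    using VA(2)[of "S \<inter> M" "S \<inter> R"] by simp
  also have "\<dots> = ideal x y S"
  proof -
    have "S \<inter> R \<inter> K = S \<inter> K" "S \<inter> R \<inter> Z = S \<inter> Z" "(S \<inter> M) \<union> (S \<inter> R \<inter> A) = S \<inter> own P Alice"
      unfolding R_def own_Alice by auto
    then show ?thesis
      unfolding ideal_def qstate_1[OF P] by (simp add: target_def c_def flip: alice_state_restrict[OF P])
  qed
  finally show "apply_on R (VA x) (prepared (\<Psi> x) x y) S = ideal x y S" .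
qed

lemma univ_split: "univ = (IA \<union> IB \<union> A \<union> Z \<union> B) \<union> (M \<union> K)"
  by (auto simp: univ_def all_qubits)

lemma start_slice:
  assumes h: "\<And>S. S \<subseteq> univ \<Longrightarrow> start \<Theta> x y S = 0 \<Longrightarrow> h S = 0"
  shows "(\<Sum>S\<in>Pow univ. h S) = (\<Sum>m\<in>Pow M. \<Sum>T\<in>Pow K. h (ca x \<union> cb y \<union> (m \<union> T)))"
proof -
  have "(\<Sum>S\<in>Pow univ. h S) = (\<Sum>U\<in>Pow (M \<union> K). h ((ca x \<union> cb y) \<union> U))"
    unfolding univ_split
  proof (rule sum_slice)
    show "(IA \<union> IB \<union> A \<union> Z \<union> B) \<inter> (M \<union> K) = {}" using dj by auto
    show "ca x \<union> cb y \<subseteq> IA \<union> IB \<union> A \<union> Z \<union> B" using codes by blast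
    fix S assume S: "S \<subseteq> IA \<union> IB \<union> A \<union> Z \<union> B \<union> (M \<union> K)" "S \<inter> (IA \<union> IB \<union> A \<union> Z \<union> B) \<noteq> ca x \<union> cb y"
    have "start \<Theta> x y S = 0"
      unfolding start_def using S(2) by (auto simp: Int_Un_distrib)
    then show "h S = 0" using h S(1) by (simp add: univ_split)
  qed (use fin in auto)
  also have "\<dots> = (\<Sum>m\<in>Pow M. \<Sum>T\<in>Pow K. h ((ca x \<union> cb y) \<union> (m \<union> T)))"
    using fin dj by (intro sum_Pow_Un) auto
  finally show ?thesis .
qed

lemma start_Un:
  assumes "m \<subseteq> M" "T \<subseteq> K"
  shows "start \<Theta> x y (ca x \<union> cb y \<union> (m \<union> T)) = \<Theta> m (kinv T)"
proof -
  let ?S = "ca x \<union> cb y \<union> (m \<union> T)"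
  have "?S \<inter> IA = ca x" "?S \<inter> IB = cb y" "?S \<inter> (A \<union> Z) = {}" "?S \<inter> B = {}" "?S \<inter> M = m" "?S \<inter> K = T"
  proof -
    note c = codes(1)[of x] codes(3)[of y] assms
    show "?S \<inter> IA = ca x" using c dj(9,16,19) by blast
    show "?S \<inter> IB = cb y" using c dj(10,17,19) by blast
    show "?S \<inter> (A \<union> Z) = {}" using c dj(1,4,5,6,11,18,20,21) by blast
    show "?S \<inter> B = {}" using c dj(3,12,13,14) by blast
    show "?S \<inter> M = m" using c dj(8,9,10) by blast
    show "?S \<inter> K = T" using c dj(8,16,17) by blast
  qed
  then show ?thesis by (simp add: start_def)
qed

lemma ip_start: "ip (Pow univ) (start \<Theta> x y) (start \<Theta>' x y) = (\<Sum>m\<in>Pow M. \<Sum>T\<in>Pow M. cnj (\<Theta> m T) * \<Theta>' m T)"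
proof -
  have "ip (Pow univ) (start \<Theta> x y) (start \<Theta>' x y) = (\<Sum>m\<in>Pow M. \<Sum>T\<in>Pow K. cnj (\<Theta> m (kinv T)) * \<Theta>' m (kinv T))"
    unfolding ip_def by (subst start_slice[of \<Theta> x y]) (auto simp: start_Un)
  also have "\<dots> = (\<Sum>m\<in>Pow M. \<Sum>T\<in>Pow M. cnj (\<Theta> m T) * \<Theta>' m T)"
    by (rule sum.cong[OF refl], rule sum_kinv)
  finally show ?thesis .
qed

text \<open>Unit vectors whose input registers are in the basis state of the inputs. Unitaries that
  avoid these registers preserve this, and security is a consequence.\<close>

definition supported where
  "supported x y \<psi> \<longleftrightarrow> (\<forall>S. \<psi> S \<noteq> 0 \<longrightarrow> S \<inter> IA = ca x \<and> S \<inter> IB = cb y) \<and> (\<Sum>S\<in>Pow univ. (cmod (\<psi> S))\<^sup>2) = 1"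

lemma supported_start:
  assumes "(\<Sum>S\<in>Pow M. \<Sum>T\<in>Pow M. (cmod (\<Theta> S T))\<^sup>2) = 1"
  shows "supported x y (start \<Theta> x y)"
proof -
  have "complex_of_real (\<Sum>S\<in>Pow univ. (cmod (start \<Theta> x y S))\<^sup>2) = of_real (\<Sum>S\<in>Pow M. \<Sum>T\<in>Pow M. (cmod (\<Theta> S T))\<^sup>2)"
    unfolding ip_self[symmetric] ip_start by (simp add: complex_norm_square mult.commute del: of_real_power)
  then show ?thesis
    unfolding of_real_eq_iff assms by (simp add: supported_def start_def)
qed

lemma supported_apply_on:
  assumes \<psi>: "supported x y \<psi>" and Q: "Q \<subseteq> univ" "Q \<inter> IA = {}" "Q \<inter> IB = {}" and U: "unitary_on Q U"
  shows "supported x y (apply_on Q U \<psi>)"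
  unfolding supported_def norm_apply_on[OF finite_univ Q(1) U]
proof (intro conjI allI impI)
  show "(\<Sum>S\<in>Pow univ. (cmod (\<psi> S))\<^sup>2) = 1" using \<psi> by (simp add: supported_def)
  fix S assume "apply_on Q U \<psi> S \<noteq> 0"
  then obtain T where T: "T \<subseteq> Q" "\<psi> ((S - Q) \<union> T) \<noteq> 0"
    using apply_on_zero by metis
  then have "((S - Q) \<union> T) \<inter> IA = ca x" "((S - Q) \<union> T) \<inter> IB = cb y"
    using \<psi> by (auto simp: supported_def)
  moreover have "((S - Q) \<union> T) \<inter> IA = S \<inter> IA" "((S - Q) \<union> T) \<inter> IB = S \<inter> IB"
    using T Q by auto
  ultimately show "S \<inter> IA = ca x" "S \<inter> IB = cb y" by auto
qed

lemma subset_univ: "B \<subseteq> univ" "M \<subseteq> univ" "R \<subseteq> univ" "IA \<subseteq> univ" "IB \<subseteq> univ" "K \<subseteq> univ"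
  "R \<inter> IA = {}" "R \<inter> IB = {}" "B \<inter> IA = {}" "B \<inter> IB = {}"
  using dj by (auto simp: univ_def all_qubits R_def)

lemma supported_prepared:
  assumes "(\<Sum>S\<in>Pow M. \<Sum>T\<in>Pow M. (cmod (\<Theta> S T))\<^sup>2) = 1"
  shows "supported x y (prepared \<Theta> x y)" "supported x y (apply_on R (VA x) (prepared \<Theta> x y))"
proof -
  show *: "supported x y (prepared \<Theta> x y)"
    unfolding apply_VB[symmetric] using subset_univ
    by (intro supported_apply_on supported_start assms VB) auto
  show "supported x y (apply_on R (VA x) (prepared \<Theta> x y))"
    using subset_univ by (intro supported_apply_on * VA) auto
qed

lemma held_univ: "k \<le> t \<Longrightarrow> held P Alice k q \<subseteq> univ" "k \<le> t \<Longrightarrow> held P Alice k q \<inter> IA = {}"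
  "k \<le> t \<Longrightarrow> held P Alice k q \<inter> IB = {}" "k \<le> t \<Longrightarrow> held P Alice k q \<inter> (K \<union> Z) = {}"
  using held_subset[OF P, of k q] fresh by (auto simp: univ_def)

lemma supported_run: "supported x y \<psi> \<Longrightarrow> k \<le> t \<Longrightarrow> supported x y (run P \<psi> k)"
proof (induction k)
  case (Suc k)
  then show ?case
    unfolding run.simps by (intro supported_apply_on held_univ coinlessD(10)[OF P]) auto
qed simp

lemma supported_density:
  assumes "supported x y \<psi>"
  shows "density univ (IA \<union> IB) \<psi> = (\<lambda>S T. if S = ca x \<union> cb y \<and> T = ca x \<union> cb y then 1 else 0)"
proof (intro ext)
  fix S T
  let ?c = "ca x \<union> cb y" and ?I = "IA \<union> IB"
  have zero: "\<psi> (S \<union> U) = 0" if "S \<subseteq> ?I" "S \<noteq> ?c" "U \<subseteq> univ - ?I" for S U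
  proof (rule ccontr)
    assume "\<psi> (S \<union> U) \<noteq> 0"
    then have "(S \<union> U) \<inter> IA = ca x" "(S \<union> U) \<inter> IB = cb y" using assms by (auto simp: supported_def)
    then show False using that by blast
  qed
  have c: "?c \<subseteq> ?I" using codes by blast
  have one: "(\<Sum>U\<in>Pow (univ - ?I). \<psi> (?c \<union> U) * cnj (\<psi> (?c \<union> U))) = 1"
  proof -
    have eq: "univ = ?I \<union> (univ - ?I)" using subset_univ by auto
    have "(\<Sum>U\<in>Pow (univ - ?I). \<psi> (?c \<union> U) * cnj (\<psi> (?c \<union> U))) = (\<Sum>S\<in>Pow (?I \<union> (univ - ?I)). \<psi> S * cnj (\<psi> S))"
    proof (rule sum_slice[symmetric])
      fix S assume "S \<subseteq> ?I \<union> (univ - ?I)" "S \<inter> ?I \<noteq> ?c"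
      then have "\<psi> (S \<inter> ?I \<union> (S - ?I)) = 0" by (intro zero) auto
      moreover have "S \<inter> ?I \<union> (S - ?I) = S" by auto
      ultimately show "\<psi> S * cnj (\<psi> S) = 0" by simp
    qed (use finite_univ fin c in auto)
    also have "\<dots> = of_real (\<Sum>S\<in>Pow univ. (cmod (\<psi> S))\<^sup>2)"
      using eq by (simp add: complex_norm_square del: of_real_power)
    also have "(\<Sum>S\<in>Pow univ. (cmod (\<psi> S))\<^sup>2) = 1" using assms by (simp add: supported_def)
    finally show ?thesis by simp
  qed
  show "density univ ?I \<psi> S T = (if S = ?c \<and> T = ?c then 1 else 0)"
  proof (cases "S = ?c \<and> T = ?c")
    case True
    then show ?thesis using one c by (simp add: density_def)
  next
    case False
    show ?thesis
    proof (cases "S \<subseteq> ?I \<and> T \<subseteq> ?I")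
      case True
      then have "(\<Sum>U\<in>Pow (univ - ?I). \<psi> (S \<union> U) * cnj (\<psi> (T \<union> U))) = 0"
        using False zero by (intro sum.neutral) auto
      then have "density univ ?I \<psi> S T = 0" using True by (simp add: density_def)
      then show ?thesis using False by (simp only: if_False)
    next
      case f: False
      show ?thesis unfolding density_def using f False by (simp only: if_False)
    qed
  qed
qed


subsection \<open>The new protocol\<close>

text \<open>Step \<open>k\<close> performs the old step \<open>k + 1\<close>; in steps 0 and 1 it is
  preceded by Bob's preparation and Alice's completion, which read the inputs by inverting the
  codes. A constant family in \<open>ctrl\<close> extends an operation by the identity to the new
  qubits.\<close>

definition new_op :: "nat \<Rightarrow> qmatrix" where
  "new_op k = (if k = 0 then
       mm (Pow (B \<union> M \<union> K \<union> IB)) (ctrl (B \<union> M) (\<lambda>_. op P 1)) (ctrl B (\<lambda>\<beta>. VB (inv_into UNIV cb (\<beta> \<inter> IB))))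
     else if k = 1 then
       mm (Pow (held P Alice 2 Alice \<union> Z \<union> IA \<union> K)) (ctrl (held P Alice 2 Alice) (\<lambda>_. op P 2))
         (ctrl R (\<lambda>\<beta>. VA (inv_into UNIV ca (\<beta> \<inter> IA))))
     else ctrl (held P Alice (Suc k) (mover Alice (Suc k))) (\<lambda>_. op P (Suc k)))"

text \<open>The old input qubits lie in \<open>A\<close> and \<open>B\<close> and are work qubits
  here; they may hold a superposition, as security concerns \<open>IA\<close> and \<open>IB\<close>.
  All of \<open>\<Phi>\<close> is initially with Bob, so there is no prior entanglement between the
  parties.\<close>

definition new_protocol :: "('x, 'y, 'z) qprotocol" where
  "new_protocol = \<lparr>own = (\<lambda>p. case p of Alice \<Rightarrow> A \<union> Z \<union> IA | Bob \<Rightarrow> B \<union> M \<union> K \<union> IB),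
     inp = (\<lambda>p. case p of Alice \<Rightarrow> IA | Bob \<Rightarrow> IB),
     alice_code = ca, bob_code = cb,
     work = (\<lambda>p. case p of Alice \<Rightarrow> (\<lambda>S. if S = {} then 1 else 0)
       | Bob \<Rightarrow> (\<lambda>S. if S \<inter> B = {} then \<Phi> (S \<inter> M) (kinv (S \<inter> K)) else 0)),
     op = new_op,
     msg = (\<lambda>k. if k = 0 then msg P 1 \<union> K else msg P (Suc k)),
     overhead = K, measured = measured P, decode = decode P\<rparr>"

lemma new_protocol_simps [simp]:
  "own new_protocol Alice = A \<union> Z \<union> IA" "own new_protocol Bob = B \<union> M \<union> K \<union> IB"
  "inp new_protocol Alice = IA" "inp new_protocol Bob = IB"
  "alice_code new_protocol = ca" "bob_code new_protocol = cb"
  "work new_protocol Alice = (\<lambda>S. if S = {} then 1 else 0)"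
  "work new_protocol Bob = (\<lambda>S. if S \<inter> B = {} then \<Phi> (S \<inter> M) (kinv (S \<inter> K)) else 0)"
  "op new_protocol = new_op" "overhead new_protocol = K" "measured new_protocol = measured P" "decode new_protocol = decode P"
  by (simp_all add: new_protocol_def)

lemma new_msg: "msg new_protocol 0 = msg P 1 \<union> K" "k > 0 \<Longrightarrow> msg new_protocol k = msg P (Suc k)"
  by (simp_all add: new_protocol_def)

lemma new_all_qubits: "all_qubits new_protocol = univ"
  by (auto simp: all_qubits_def[of new_protocol] univ_def all_qubits)

lemma new_input_qubits: "input_qubits new_protocol = IA \<union> IB"
  by (simp add: input_qubits_def)

section \<open>The qubits held in each step\<close>

lemma held_1: "held P Alice 1 Alice = A" "held P Alice 1 Bob = B \<union> M"
  unfolding A_def B_def unfolding M by (simp_all add: mover_def)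

lemma msg_disjoint:
  assumes "k < t"
  shows "msg P k \<inter> (K \<union> Z) = {}" "msg P k \<inter> IA = {}" "msg P k \<inter> IB = {}"
proof -
  have "msg P k \<subseteq> held P Alice k (mover Alice k)"
    using assms by (rule coinlessD(11)[OF P])
  then show "msg P k \<inter> (K \<union> Z) = {}" "msg P k \<inter> IA = {}" "msg P k \<inter> IB = {}"
    using held_univ(2,3,4)[of k "mover Alice k"] assms by auto
qed

lemma held_2: "held P Alice 2 Alice = A \<union> msg P 1"
  using held_1 held.simps(2)[of P Alice 1 Alice] by (simp add: mover_def numeral_2_eq_2)

text \<open>The qubits absent from the old protocol; \<open>K\<close> passes from Bob to Alice with
  the first new message.\<close>

definition extra :: "nat \<Rightarrow> party \<Rightarrow> nat set" where
  "extra k q = (case q of Alice \<Rightarrow> Z \<union> IA \<union> (if k = 0 then {} else K) | Bob \<Rightarrow> IB \<union> (if k = 0 then K else {}))"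

lemma new_held: "k \<le> t - 1 \<Longrightarrow> held new_protocol Bob k q = held P Alice (Suc k) q \<union> extra k q"
proof (induction k arbitrary: q)
  case 0
  then show ?case
    using held_1 by (cases q) (auto simp: extra_def simp del: held.simps(2) simp: held.simps(1))
next
  case (Suc k)
  have msg: "msg P (Suc k) \<inter> (K \<union> Z) = {}" "msg P (Suc k) \<inter> IA = {}" "msg P (Suc k) \<inter> IB = {}"
    using Suc.prems by (intro msg_disjoint; simp)+
  have heldK: "held P Alice (Suc k) q' \<inter> K = {}" for q'
  proof -
    have "held P Alice (Suc k) q' \<inter> (K \<union> Z) = {}"
      using Suc.prems by (intro held_univ(4)) simp
    then show ?thesis by blast
  qed
  show ?case
  proof (cases k)
    case 0
    have "held new_protocol Bob (Suc 0) q = (if q = Bob then held P Alice 1 q \<union> extra 0 q - (msg P 1 \<union> K)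
        else held P Alice 1 q \<union> extra 0 q \<union> (msg P 1 \<union> K))"
    proof -
      have e: "held new_protocol Bob 0 q = held P Alice 1 q \<union> extra 0 q"
        using Suc.IH[of q] 0 by (simp del: held.simps)
      show ?thesis
        unfolding held.simps(2)[of new_protocol Bob 0 q] e new_msg by (simp add: mover_def del: held.simps)
    qed
    moreover have "held P Alice (Suc (Suc 0)) q = (if q = Bob then held P Alice 1 q - msg P 1 else held P Alice 1 q \<union> msg P 1)"
      using held.simps(2)[of P Alice 1 q] by (simp add: mover_def)
    ultimately show ?thesis
      using msg heldK[of q] dj 0 by (cases q) (auto simp: extra_def simp del: held.simps)
  next
    case (Suc k')
    then have "k > 0" by simp
    have "held new_protocol Bob (Suc k) q = (if q = mover Bob k then held P Alice (Suc k) q \<union> extra k q - msg P (Suc k)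
        else held P Alice (Suc k) q \<union> extra k q \<union> msg P (Suc k))"
    proof -
      have e: "held new_protocol Bob k q = held P Alice (Suc k) q \<union> extra k q"
        using Suc.IH[of q] Suc.prems by (simp del: held.simps)
      show ?thesis
        unfolding held.simps(2)[of new_protocol Bob k q] e new_msg(2)[OF \<open>k > 0\<close>] by (simp del: held.simps)
    qed
    moreover have "held P Alice (Suc (Suc k)) q = (if q = mover Bob k then held P Alice (Suc k) q - msg P (Suc k)
        else held P Alice (Suc k) q \<union> msg P (Suc k))"
      using held.simps(2)[of P Alice "Suc k" q] by (simp add: mover_Suc)
    moreover have "extra (Suc k) q = extra k q" using \<open>k > 0\<close> by (simp add: extra_def)
    moreover have "extra k q \<inter> msg P (Suc k) = {}" using msg \<open>k > 0\<close> by (cases q) (auto simp: extra_def)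
    ultimately show ?thesis by auto
  qed
qed

lemma new_held_mover:
  assumes "k \<le> t - 1"
  shows "held new_protocol Bob k (mover Bob k) = held P Alice (Suc k) (mover Alice (Suc k)) \<union> extra k (mover Bob k)"
  unfolding mover_Suc by (rule new_held[OF assms])

lemma new_held_0: "held new_protocol Bob 0 (mover Bob 0) = B \<union> M \<union> K \<union> IB"
  by (simp add: mover_def)

lemma new_held_1: "t \<ge> 2 \<Longrightarrow> held new_protocol Bob 1 (mover Bob 1) = held P Alice 2 Alice \<union> Z \<union> IA \<union> K"
  using new_held_mover[of 1] by (auto simp: mover_def extra_def numeral_2_eq_2 simp del: held.simps)

lemma finite_held: "k \<le> t \<Longrightarrow> finite (held P Alice k q)"
  using held_univ(1) finite_univ finite_subset by blast

lemma new_op_unitary: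
  assumes k: "k \<le> t - 1"
  shows "unitary_on (held new_protocol Bob k (mover Bob k)) (new_op k)"
proof -
  have U: "unitary_on (held P Alice (Suc k) (mover Alice (Suc k))) (op P (Suc k))"
    using k t by (intro coinlessD(10)[OF P]) auto
  consider "k = 0" | "k = 1" | "k \<ge> 2" by linarith
  then show ?thesis
  proof cases
    case 1
    have "unitary_on (B \<union> M) (op P 1)"
      using U held_1 1 by (simp add: mover_def del: held.simps)
    then show ?thesis
      unfolding 1 new_held_0 new_op_def using fin VB(1)
      by (simp add: unitary_on_eq) (intro unitary_mat_mm; simp flip: unitary_on_eq; intro unitary_on_ctrl; auto)
  next
    case 2
    then have t2: "t \<ge> 2" using k by simp
    have fin': "finite (held P Alice 2 Alice \<union> Z \<union> IA \<union> K)"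
      using finite_held[of 2] t2 fin by auto
    have R: "R \<subseteq> held P Alice 2 Alice \<union> Z \<union> IA \<union> K"
      unfolding held_2 R_def by auto
    have U2: "unitary_on (held P Alice 2 Alice) (op P 2)"
      using U 2 by (simp add: mover_def numeral_2_eq_2 del: held.simps)
    have "unitary_mat (Pow (held P Alice 2 Alice \<union> Z \<union> IA \<union> K)) (new_op 1)"
      unfolding new_op_def using fin'
      by (simp, intro unitary_mat_mm; simp flip: unitary_on_eq)
         (intro unitary_on_ctrl fin' R VA U2; auto)+
    then show ?thesis
      unfolding 2 new_held_1[OF t2] by (simp add: unitary_on_eq)
  next
    case 3
    have "finite (held new_protocol Bob k (mover Bob k))"
      unfolding new_held_mover[OF k] using finite_held[of "Suc k"] k t fin
      by (auto simp: extra_def split: party.split simp del: held.simps)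
    then show ?thesis
      using 3 U new_held_mover[OF k]
      by (simp add: new_op_def del: held.simps) (intro unitary_on_ctrl; auto simp del: held.simps)
  qed
qed

lemma new_init: "init_state new_protocol x y = start \<Phi> x y"
proof
  fix S
  have "A \<union> Z \<union> IA - IA = A \<union> Z" "B \<union> M \<union> K \<union> IB - IB = B \<union> M \<union> K" using dj by auto
  moreover have "S \<inter> (B \<union> M \<union> K) \<inter> B = S \<inter> B" "S \<inter> (B \<union> M \<union> K) \<inter> M = S \<inter> M" "S \<inter> (B \<union> M \<union> K) \<inter> K = S \<inter> K"
    by auto
  ultimately show "init_state new_protocol x y S = start \<Phi> x y S"
    by (simp add: init_state_def start_def)
qed

subsection \<open>The run of the new protocol\<close>

lemma new_qstate_1: "qstate new_protocol Bob x y 1 = run P (prepared \<Phi> x y) 1"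
proof -
  let ?Q = "B \<union> M \<union> K \<union> IB"
  have Q: "finite ?Q" using fin by simp
  have "qstate new_protocol Bob x y 1 = apply_on ?Q (new_op 0) (start \<Phi> x y)"
    by (simp add: new_init mover_def)
  also have "\<dots> = apply_on ?Q (ctrl (B \<union> M) (\<lambda>_. op P 1)) (apply_on ?Q (ctrl B (\<lambda>\<beta>. VB (inv_into UNIV cb (\<beta> \<inter> IB)))) (start \<Phi> x y))"
    by (simp add: new_op_def apply_on_mm)
  also have "apply_on ?Q (ctrl B (\<lambda>\<beta>. VB (inv_into UNIV cb (\<beta> \<inter> IB)))) (start \<Phi> x y) = apply_on B (VB y) (start \<Phi> x y)"
  proof
    fix S
    have *: "(S \<inter> ?Q - B) \<inter> IB = S \<inter> IB" using B_disjoint by auto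
    have "apply_on ?Q (ctrl B (\<lambda>\<beta>. VB (inv_into UNIV cb (\<beta> \<inter> IB)))) (start \<Phi> x y) S = apply_on B (VB (inv_into UNIV cb (S \<inter> IB))) (start \<Phi> x y) S"
      using Q by (subst apply_on_ctrl) (auto simp: *)
    \<comment> \<open>Where \<open>IB\<close> does not hold the code of \<open>y\<close> the state
      vanishes, so the value decoded there is irrelevant.\<close>
    also have "\<dots> = apply_on B (VB y) (start \<Phi> x y) S"
    proof (cases "S \<inter> IB = cb y")
      case True
      then show ?thesis using codes(4) by (simp add: inv_f_f)
    next
      case False
      then have "start \<Phi> x y ((S - B) \<union> T) = 0" if "T \<subseteq> B" for T
        using that B_disjoint(2) by (simp add: start_def Int_replace_outside)
      then show ?thesis by (simp add: apply_on_zero)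
    qed
    finally show "apply_on ?Q (ctrl B (\<lambda>\<beta>. VB (inv_into UNIV cb (\<beta> \<inter> IB)))) (start \<Phi> x y) S = apply_on B (VB y) (start \<Phi> x y) S" .
  qed
  also have "apply_on ?Q (ctrl (B \<union> M) (\<lambda>_. op P 1)) (apply_on B (VB y) (start \<Phi> x y)) = apply_on (B \<union> M) (op P 1) (prepared \<Phi> x y)"
    using Q by (intro ext) (subst apply_on_ctrl, auto simp: apply_VB)
  also have "\<dots> = run P (prepared \<Phi> x y) 1"
    using held_1 by (simp add: mover_def del: held.simps)
  finally show ?thesis .
qed

text \<open>Alice can complete her state only once \<open>K\<close> has arrived, after Bob's first
  operation; as that operation acts on Bob's qubits alone, the delay makes no difference.\<close>

lemma commute_VA: "apply_on R (VA x) (run P \<psi> 1) = run P (apply_on R (VA x) \<psi>) 1"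
proof -
  have "R \<inter> (B \<union> M) = {}" using R_disjoint by auto
  from apply_on_commute[OF this, of "VA x" "op P 1" \<psi>] show ?thesis
    using held_1 by (simp add: mover_def del: held.simps)
qed

text \<open>Once Alice has moved, which is the meaning of \<open>k \<ge> 1\<close>, the state is
  that of a run in which her completion directly followed Bob's preparation.\<close>

lemma new_qstate:
  assumes "k \<ge> 1" "Suc k \<le> t"
  shows "qstate new_protocol Bob x y (Suc k) = run P (apply_on R (VA x) (prepared \<Phi> x y)) (Suc k)"
  using assms
proof (induction k)
  case 0
  then show ?case by simp
next
  case (Suc k)
  have held: "held new_protocol Bob (Suc k) (mover Bob (Suc k)) \<subseteq> univ"
    unfolding new_held_mover[of "Suc k"] using Suc.prems held_univ(1)[of "Suc (Suc k)" "mover Alice (Suc (Suc k))"]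
    by (subst new_held_mover) (auto simp: extra_def univ_def split: party.splits if_splits simp del: held.simps)
  show ?case
  proof (cases "k = 0")
    case True
    then have t2: "t \<ge> 2" using Suc.prems by simp
    let ?H = "held P Alice 2 Alice"
    let ?Q = "?H \<union> Z \<union> IA \<union> K"
    have "finite ?H" using t2 by (rule finite_held)
    then have Q: "finite ?Q" "?H \<subseteq> ?Q" using fin by auto
    have RQ: "R \<subseteq> ?Q" unfolding held_2 R_def by auto
    have "qstate new_protocol Bob x y (Suc (Suc 0)) = apply_on ?Q (new_op 1) (run P (prepared \<Phi> x y) 1)"
      using new_held_1[OF t2] new_qstate_1 qstate.simps(2)[of new_protocol Bob x y 1] by (simp del: qstate.simps held.simps run.simps)
    also have "\<dots> = apply_on ?Q (ctrl ?H (\<lambda>_. op P 2))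
        (apply_on ?Q (ctrl R (\<lambda>\<beta>. VA (inv_into UNIV ca (\<beta> \<inter> IA)))) (run P (prepared \<Phi> x y) 1))"
      by (simp add: new_op_def apply_on_mm del: held.simps run.simps)
    also have "apply_on ?Q (ctrl R (\<lambda>\<beta>. VA (inv_into UNIV ca (\<beta> \<inter> IA)))) (run P (prepared \<Phi> x y) 1)
        = apply_on R (VA x) (run P (prepared \<Phi> x y) 1)"
    proof
      fix S
      have *: "(S \<inter> ?Q - R) \<inter> IA = S \<inter> IA" using R_disjoint by auto
      have "apply_on ?Q (ctrl R (\<lambda>\<beta>. VA (inv_into UNIV ca (\<beta> \<inter> IA)))) (run P (prepared \<Phi> x y) 1) S
          = apply_on R (VA (inv_into UNIV ca (S \<inter> IA))) (run P (prepared \<Phi> x y) 1) S"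
        by (subst apply_on_ctrl[OF Q(1) RQ]) (simp only: *)
      also have "\<dots> = apply_on R (VA x) (run P (prepared \<Phi> x y) 1) S"
      proof (cases "S \<inter> IA = ca x")
        case True
        then show ?thesis using codes(2) by (simp add: inv_f_f)
      next
        case False
        have "supported x y (run P (prepared \<Phi> x y) 1)"
          using t by (intro supported_run supported_prepared \<Phi>) auto
        then have "run P (prepared \<Phi> x y) 1 ((S - R) \<union> T) = 0" if "T \<subseteq> R" for T
          using False Int_replace_outside[OF that R_disjoint(1), of S] unfolding supported_def by metis
        then show ?thesis by (simp add: apply_on_zero del: run.simps)
      qed
      finally show "apply_on ?Q (ctrl R (\<lambda>\<beta>. VA (inv_into UNIV ca (\<beta> \<inter> IA)))) (run P (prepared \<Phi> x y) 1) S
          = apply_on R (VA x) (run P (prepared \<Phi> x y) 1) S" .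
    qed
    also have "\<dots> = run P (apply_on R (VA x) (prepared \<Phi> x y)) 1"
      by (rule commute_VA)
    also have "apply_on ?Q (ctrl ?H (\<lambda>_. op P 2)) (run P (apply_on R (VA x) (prepared \<Phi> x y)) 1)
        = apply_on ?H (op P 2) (run P (apply_on R (VA x) (prepared \<Phi> x y)) 1)"
      by (intro ext) (subst apply_on_ctrl[OF Q], rule refl)
    also have "\<dots> = run P (apply_on R (VA x) (prepared \<Phi> x y)) (Suc 1)"
      unfolding run.simps(2)[of P _ 1] by (simp add: mover_def numeral_2_eq_2 del: held.simps run.simps)
    finally show ?thesis using True by simp
  next
    case False
    let ?H = "held P Alice (Suc (Suc k)) (mover Alice (Suc (Suc k)))"
    let ?Q = "held new_protocol Bob (Suc k) (mover Bob (Suc k))"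
    have Q: "finite ?Q" "?H \<subseteq> ?Q"
      using finite_subset[OF held finite_univ] new_held_mover[of "Suc k"] Suc.prems by auto
    have IH: "qstate new_protocol Bob x y (Suc k) = run P (apply_on R (VA x) (prepared \<Phi> x y)) (Suc k)"
      using Suc False by simp
    have "qstate new_protocol Bob x y (Suc (Suc k)) = apply_on ?Q (ctrl ?H (\<lambda>_. op P (Suc (Suc k))))
        (run P (apply_on R (VA x) (prepared \<Phi> x y)) (Suc k))"
      unfolding qstate.simps(2)[of _ _ _ _ "Suc k"] IH using False by (simp add: new_op_def del: held.simps run.simps)
    also have "\<dots> = apply_on ?H (op P (Suc (Suc k))) (run P (apply_on R (VA x) (prepared \<Phi> x y)) (Suc k))"
      by (intro ext) (subst apply_on_ctrl[OF Q], rule refl)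
    finally show ?thesis by simp
  qed
qed

lemma new_qstate_supported:
  assumes "k \<le> t"
  shows "supported x y (qstate new_protocol Bob x y k)"
proof -
  consider "k = 0" | "k = 1" | k' where "k = Suc k'" "k' \<ge> 1" by (cases k; cases "k - 1") auto
  then show ?thesis
  proof cases
    case 1
    then show ?thesis using supported_start[OF \<Phi>] by (simp add: new_init)
  next
    case 2
    then show ?thesis
      unfolding 2 new_qstate_1 using t by (intro supported_run supported_prepared \<Phi>) auto
  next
    case 3
    then show ?thesis
      using assms new_qstate[of k'] by (simp del: qstate.simps run.simps) (intro supported_run supported_prepared \<Phi>, auto)
  qed
qed

lemma new_is_coinless: "is_coinless_protocol (single_game f) Bob (t - 1) new_protocol"
proof -
  have "unit_state (A \<union> Z) (\<lambda>S. if S = {} then 1 else 0)"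
    using fin by (simp add: unit_state_def if_distrib[of cmod] if_distrib[of "\<lambda>z. z\<^sup>2"] cong: if_cong)
  moreover have "A \<union> Z \<union> IA - IA = A \<union> Z" using dj by auto
  moreover have "unit_state (B \<union> M \<union> K) (\<lambda>S. if S \<inter> B = {} then \<Phi> (S \<inter> M) (kinv (S \<inter> K)) else 0)"
  proof -
    have "(\<Sum>S\<in>Pow (B \<union> (M \<union> K)). (cmod (if S \<inter> B = {} then \<Phi> (S \<inter> M) (kinv (S \<inter> K)) else 0))\<^sup>2)
        = (\<Sum>U\<in>Pow (M \<union> K). (cmod (if ({} \<union> U) \<inter> B = {} then \<Phi> (({} \<union> U) \<inter> M) (kinv (({} \<union> U) \<inter> K)) else 0))\<^sup>2)"
      using fin dj by (intro sum_slice) auto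
    also have "\<dots> = (\<Sum>m\<in>Pow M. \<Sum>T\<in>Pow K. (cmod (if ({} \<union> (m \<union> T)) \<inter> B = {} then \<Phi> (({} \<union> (m \<union> T)) \<inter> M) (kinv (({} \<union> (m \<union> T)) \<inter> K)) else 0))\<^sup>2)"
      using fin dj by (intro sum_Pow_Un) auto
    also have "\<dots> = (\<Sum>m\<in>Pow M. \<Sum>T\<in>Pow K. (cmod (\<Phi> m (kinv T)))\<^sup>2)"
    proof (intro sum.cong refl)
      fix m T assume "m \<in> Pow M" "T \<in> Pow K"
      then have "(m \<union> T) \<inter> B = {}" "(m \<union> T) \<inter> M = m" "(m \<union> T) \<inter> K = T" using dj(3,8,12) by auto
      then show "(cmod (if ({} \<union> (m \<union> T)) \<inter> B = {} then \<Phi> (({} \<union> (m \<union> T)) \<inter> M) (kinv (({} \<union> (m \<union> T)) \<inter> K)) else 0))\<^sup>2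
          = (cmod (\<Phi> m (kinv T)))\<^sup>2" by simp
    qed
    also have "\<dots> = (\<Sum>m\<in>Pow M. \<Sum>T\<in>Pow M. (cmod (\<Phi> m T))\<^sup>2)"
      by (rule sum.cong[OF refl], rule sum_kinv)
    finally show ?thesis using \<Phi> by (simp add: unit_state_def Un_assoc)
  qed
  moreover have "B \<union> M \<union> K \<union> IB - IB = B \<union> M \<union> K" using dj by auto
  moreover have "(A \<union> Z \<union> IA) \<inter> (B \<union> M \<union> K \<union> IB) = {}" using dj by auto
  moreover have "msg new_protocol k \<subseteq> held new_protocol Bob k (mover Bob k)" if "k < t - 1" for k
  proof -
    have "msg P (Suc k) \<subseteq> held P Alice (Suc k) (mover Alice (Suc k))"
      using that by (intro coinlessD(11)[OF P]) auto
    moreover have "extra 0 (mover Bob 0) = IB \<union> K" by (simp add: extra_def mover_def)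
    ultimately show ?thesis
      using new_held_mover[of k] that by (cases "k = 0") (auto simp: new_msg simp del: held.simps)
  qed
  moreover have "measured P \<subseteq> held new_protocol Bob (t - 1) (mover Bob (t - 1))"
    using new_held_mover[of "t - 1"] t coinlessD(12)[OF P] by auto
  moreover have "ca ` fst ` UNIV \<subseteq> Pow IA" "inj_on ca (fst ` UNIV)" "cb ` snd ` UNIV \<subseteq> Pow IB" "inj_on cb (snd ` UNIV)"
    using codes(1-4) by (auto intro: inj_on_subset)
  ultimately show ?thesis
    unfolding is_coinless_protocol_def using fin new_op_unitary by (simp add: single_game_def del: held.simps)
qed

text \<open>The input registers only act as controls, so the support is preserved and their density
  matrix remains that of a basis state.\<close>

lemma new_secure:
  assumes sec: "secure G Alice t P"
  shows "secure (single_game f) Bob (t - 1) new_protocol"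
proof -
  have msg: "msg P (Suc k) \<inter> (IA \<union> IB) = {}" if "Suc k < t" for k
    using msg_disjoint[OF that] by auto
  have "msg new_protocol k \<inter> (IA \<union> IB) = {}" if "k < t - 1" for k
    using msg[of k] that dj by (cases "k = 0") (auto simp: new_msg)
  moreover have "measured P \<inter> (IA \<union> IB) = {}"
    using measured_subset[OF P] fresh by auto
  moreover have "density univ (IA \<union> IB) (qstate new_protocol Bob x y k) = density univ (IA \<union> IB) (init_state new_protocol x y)"
    if "k \<le> Suc (t - 1)" for x y k
    using that t new_qstate_supported[of k x y] new_qstate_supported[of 0 x y] by (simp add: supported_density)
  ultimately show ?thesis
    by (simp add: secure_def new_input_qubits new_all_qubits single_game_def)
qed

text \<open>Bob's operations before his first message avoid \<open>K\<close>, so its state is the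
  reduced state of \<open>\<Phi>\<close>, in which the inputs do not occur.\<close>

lemma new_overhead: "density univ K (qstate new_protocol Bob x y 1) = density univ K (qstate new_protocol Bob x' y' 1)"
proof -
  have U1: "unitary_on (B \<union> M) (op P 1)"
    using coinlessD(10)[OF P t] held_1 by (simp add: mover_def del: held.simps)
  have sub: "B \<union> M \<subseteq> univ - K" "B \<subseteq> univ - K" using subset_univ dj by auto
  have "density univ K (qstate new_protocol Bob x y 1) = (\<lambda>S T. if S \<subseteq> K \<and> T \<subseteq> K
      then \<Sum>m\<in>Pow M. \<Phi> m (kinv S) * cnj (\<Phi> m (kinv T)) else 0)" for x y
  proof -
    have "qstate new_protocol Bob x y 1 = apply_on (B \<union> M) (op P 1) (apply_on B (VB y) (start \<Phi> x y))"
      unfolding new_qstate_1 apply_VB using held_1 by (simp add: mover_def del: held.simps)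
    then have "density univ K (qstate new_protocol Bob x y 1) = density univ K (start \<Phi> x y)"
      using finite_univ subset_univ(6) sub U1 VB(1) by (simp add: density_apply_on)
    also have "\<dots> = (\<lambda>S T. if S \<subseteq> K \<and> T \<subseteq> K then \<Sum>m\<in>Pow M. \<Phi> m (kinv S) * cnj (\<Phi> m (kinv T)) else 0)"
    proof (intro ext)
      fix S T
      show "density univ K (start \<Phi> x y) S T = (if S \<subseteq> K \<and> T \<subseteq> K then \<Sum>m\<in>Pow M. \<Phi> m (kinv S) * cnj (\<Phi> m (kinv T)) else 0)"
      proof (cases "S \<subseteq> K \<and> T \<subseteq> K")
        case True
        let ?Y = "IA \<union> IB \<union> A \<union> Z \<union> B"
        have eq: "univ - K = ?Y \<union> M" using dj by (auto simp: univ_split)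
        have st: "start \<Phi> x y (S \<union> (ca x \<union> cb y \<union> m)) = \<Phi> m (kinv S)" if "S \<subseteq> K" "m \<subseteq> M" for S m
          using start_Un[OF that(2,1), of \<Phi> x y] by (simp add: Un_ac)
        have "(\<Sum>U\<in>Pow (?Y \<union> M). start \<Phi> x y (S \<union> U) * cnj (start \<Phi> x y (T \<union> U)))
            = (\<Sum>m\<in>Pow M. start \<Phi> x y (S \<union> ((ca x \<union> cb y) \<union> m)) * cnj (start \<Phi> x y (T \<union> ((ca x \<union> cb y) \<union> m))))"
        proof (rule sum_slice)
          show "?Y \<inter> M = {}" using dj by auto
          show "ca x \<union> cb y \<subseteq> ?Y" using codes by blast
          fix U assume U: "U \<subseteq> ?Y \<union> M" "U \<inter> ?Y \<noteq> ca x \<union> cb y"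
          have "start \<Phi> x y (S \<union> U) = 0"
          proof (rule ccontr)
            assume "start \<Phi> x y (S \<union> U) \<noteq> 0"
            then have "(S \<union> U) \<inter> IA = ca x" "(S \<union> U) \<inter> IB = cb y" "(S \<union> U) \<inter> (A \<union> Z) = {}" "(S \<union> U) \<inter> B = {}"
              by (auto simp: start_def split: if_splits)
            moreover have "S \<inter> IA = {}" "S \<inter> IB = {}" using True dj(16,17) by auto
            ultimately have "U \<inter> IA = ca x" "U \<inter> IB = cb y" "U \<inter> (A \<union> Z) = {}" "U \<inter> B = {}"
              by (auto simp: Int_Un_distrib2)
            then show False using U(2) by (auto simp: Int_Un_distrib)
          qed
          then show "start \<Phi> x y (S \<union> U) * cnj (start \<Phi> x y (T \<union> U)) = 0" by simp
        qed (use fin in auto)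
        also have "\<dots> = (\<Sum>m\<in>Pow M. \<Phi> m (kinv S) * cnj (\<Phi> m (kinv T)))"
          using True st by (intro sum.cong) auto
        finally show ?thesis using True by (simp add: density_def eq)
      next
        case False
        then show ?thesis unfolding density_def by (simp only: if_False)
      qed
    qed
    finally show ?thesis .
  qed
  then show ?thesis by simp
qed

lemma new_is_safe:
  assumes safe: "is_safe_protocol G Alice t c l P"
  shows "is_safe_protocol (single_game f) Bob (t - 1) (c + hd l) (tl l) new_protocol"
proof -
  have l: "length l = t" and card: "\<And>k. k < t \<Longrightarrow> card (msg P k) = (if k = 0 then l ! k + c else l ! k)"
    and sec: "secure G Alice t P"
    using safe by (auto simp: is_safe_protocol_def)
  \<comment> \<open>\<open>K\<close> copies the entire old first message, main part and overhead,
    whence the new overhead c + l_1.\<close>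
  have cardK: "card K = c + hd l"
    using card[of 0] t l K by (cases l) (auto simp: card_image M)
  have "card (msg new_protocol k) = (if k = 0 then tl l ! k + (c + hd l) else tl l ! k)" if "k < t - 1" for k
  proof -
    have tl: "tl l ! k = l ! Suc k" using that l by (simp add: nth_tl)
    have cardk: "card (msg P (Suc k)) = l ! Suc k" using that card[of "Suc k"] by simp
    show ?thesis
    proof (cases "k = 0")
      case True
      have "msg P 1 \<subseteq> held P Alice 1 (mover Alice 1)"
        using that True by (intro coinlessD(11)[OF P]) auto
      then have "finite (msg P 1)" "msg P 1 \<inter> K = {}"
        using finite_held[of 1] held_univ(4)[of 1] t finite_subset by blast+
      then show ?thesis
        using True tl cardk cardK fin by (simp add: new_msg card_Un_disjoint)
    next
      case False
      then show ?thesis using tl cardk by (simp add: new_msg)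
    qed
  qed
  moreover have "K \<subseteq> msg new_protocol 0" by (simp add: new_msg)
  ultimately show ?thesis
    using new_is_coinless new_secure[OF sec] l cardK new_overhead
    unfolding is_safe_protocol_def new_all_qubits by (auto simp del: qstate.simps)
qed


subsection \<open>The error of the new protocol\<close>

text \<open>The later operations do not touch \<open>Z\<close>, so every branch of the superposition
  runs the given protocol for its own \<open>v\<close>.\<close>

lemma run_ideal:
  "k \<le> t \<Longrightarrow> run P (ideal x y) k S = (if S \<inter> IA = ca x \<and> S \<inter> IB = cb y \<and> S \<inter> K = {}
    then coef (S \<inter> Z) * qstate P Alice (a x (dz (S \<inter> Z))) (b y) (Suc k) S else 0)"
proof (induction k arbitrary: S)
  case 0
  show ?case unfolding run.simps ideal_def One_nat_def by (rule refl)
next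
  case (Suc k)
  let ?Q = "held P Alice (Suc k) (mover Alice (Suc k))"
  define c where "c = (if S \<inter> IA = ca x \<and> S \<inter> IB = cb y \<and> S \<inter> K = {} then coef (S \<inter> Z) else 0)"
  have "?Q \<inter> IA = {}" "?Q \<inter> IB = {}" "?Q \<inter> (K \<union> Z) = {}"
    using Suc.prems by (intro held_univ; simp)+
  then have Q: "?Q \<inter> IA = {}" "?Q \<inter> IB = {}" "?Q \<inter> K = {}" "?Q \<inter> Z = {}" by auto
  have "run P (ideal x y) (Suc k) S = c * apply_on ?Q (op P (Suc k)) (qstate P Alice (a x (dz (S \<inter> Z))) (b y) (Suc k)) S"
    unfolding run.simps
  proof (rule apply_on_scale)
    fix T assume T: "T \<subseteq> ?Q"
    note e = Int_replace_outside[OF T Q(1), of S] Int_replace_outside[OF T Q(2), of S]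
      Int_replace_outside[OF T Q(3), of S] Int_replace_outside[OF T Q(4), of S]
    show "run P (ideal x y) k ((S - ?Q) \<union> T) = c * qstate P Alice (a x (dz (S \<inter> Z))) (b y) (Suc k) ((S - ?Q) \<union> T)"
      using Suc.prems by (subst Suc.IH) (simp_all add: e c_def del: held.simps qstate.simps)
  qed
  then show ?case
    unfolding qstate.simps(2)[of P Alice _ _ "Suc k"] by (simp add: c_def del: held.simps qstate.simps run.simps)
qed

lemma ip_run: "k \<le> t \<Longrightarrow> ip (Pow univ) (run P \<psi> k) (run P \<phi> k) = ip (Pow univ) \<psi> \<phi>"
proof (induction k)
  case (Suc k)
  have "ip (Pow univ) (run P \<psi> (Suc k)) (run P \<phi> (Suc k)) = ip (Pow univ) (run P \<psi> k) (run P \<phi> k)"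
    unfolding run.simps using Suc.prems by (intro ip_apply_on finite_univ held_univ coinlessD(10)[OF P])
  then show ?case using Suc by simp
qed simp

lemma \<Psi>_norm: "(\<Sum>S\<in>Pow M. \<Sum>T\<in>Pow M. (cmod (\<Psi> x S T))\<^sup>2) = 1"
proof -
  let ?d = "\<lambda>v. density (own P Alice) M (alice_state P (a x v))"
  have tr: "(\<Sum>S\<in>Pow M. ?d v S S) = 1" if "v \<in> V" for v
    by (rule density_matD(3)[OF density_mat_density[OF coinlessD(1)[OF P] M_subset alice_state_norm[OF P ab[OF that]]]])
  have "complex_of_real (\<Sum>S\<in>Pow M. \<Sum>T\<in>Pow M. (cmod (\<Psi> x S T))\<^sup>2) = (\<Sum>S\<in>Pow M. \<Sum>T\<in>Pow M. \<Psi> x S T * cnj (\<Psi> x S T))"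
    by (simp add: complex_norm_square del: of_real_power)
  also have "\<dots> = (\<Sum>S\<in>Pow M. \<Sum>v\<in>V. of_real (w v) * ?d v S S)"
    using \<Psi> by simp
  also have "\<dots> = (\<Sum>v\<in>V. \<Sum>S\<in>Pow M. of_real (w v) * ?d v S S)"
    by (rule sum.swap)
  also have "\<dots> = (\<Sum>v\<in>V. of_real (w v) * (\<Sum>S\<in>Pow M. ?d v S S))"
    by (simp add: sum_distrib_left)
  also have "\<dots> = of_real (sum w V)"
    by (simp add: tr)
  finally show ?thesis using w by (simp only: of_real_eq_iff)
qed

text \<open>The branches are distinguished by \<open>Z\<close> and do not interfere, so the outcome
  probabilities are averages with the weights \<open>w v\<close>.\<close>

lemma ideal_error:
  "(\<Sum>S\<in>Pow univ. of_bool (decode P (S \<inter> measured P) \<noteq> f x y) * (cmod (run P (ideal x y) t S))\<^sup>2)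
    = (\<Sum>v\<in>V. w v * incorrect_prob G Alice t P (a x v) (b y))"
proof -
  let ?W = "all_qubits P" and ?c = "ca x \<union> cb y"
  let ?h = "\<lambda>S. of_bool (decode P (S \<inter> measured P) \<noteq> f x y) * (cmod (run P (ideal x y) t S))\<^sup>2"
  let ?g = "\<lambda>v. \<Sum>S\<in>Pow ?W. of_bool (decode P (S \<inter> measured P) \<noteq> f x y) * (cmod (qstate P Alice (a x v) (b y) (Suc t) S))\<^sup>2"
  have finW: "finite ?W" by (rule finite_all_qubits[OF P])
  have eq: "univ = (IA \<union> IB \<union> K) \<union> (Z \<union> ?W)" by (auto simp: univ_def)
  have "(\<Sum>S\<in>Pow univ. ?h S) = (\<Sum>U\<in>Pow (Z \<union> ?W). ?h (?c \<union> U))"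
    unfolding eq
  proof (rule sum_slice)
    show "(IA \<union> IB \<union> K) \<inter> (Z \<union> ?W) = {}" using fresh by auto
    show "?c \<subseteq> IA \<union> IB \<union> K" using codes by blast
    fix S assume S: "S \<inter> (IA \<union> IB \<union> K) \<noteq> ?c"
    then have "\<not> (S \<inter> IA = ca x \<and> S \<inter> IB = cb y \<and> S \<inter> K = {})" by (auto simp: Int_Un_distrib)
    then show "?h S = 0" by (subst run_ideal) (auto simp del: qstate.simps)
  qed (use fin finW in auto)
  also have "\<dots> = (\<Sum>z\<in>Pow Z. \<Sum>S\<in>Pow ?W. ?h (?c \<union> (z \<union> S)))"
    using fin finW fresh by (intro sum_Pow_Un) auto
  also have "\<dots> = (\<Sum>z\<in>Pow Z. of_real ((cmod (coef z))\<^sup>2) * ?g (dz z))"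
  proof (rule sum.cong[OF refl])
    fix z assume z: "z \<in> Pow Z"
    have "?h (?c \<union> (z \<union> S)) = (cmod (coef z))\<^sup>2 * (of_bool (decode P (S \<inter> measured P) \<noteq> f x y) *
        (cmod (qstate P Alice (a x (dz z)) (b y) (Suc t) S))\<^sup>2)" if S: "S \<in> Pow ?W" for S
    proof -
      let ?S = "?c \<union> (z \<union> S)"
      note c = codes(1)[of x] codes(3)[of y]
      have m: "measured P \<subseteq> ?W" by (rule measured_subset[OF P])
      have 1: "?S \<inter> IA = ca x" using c z S fresh(2) dj(19,20) by blast
      have 2: "?S \<inter> IB = cb y" using c z S fresh(3) dj(19,21) by blast
      have 3: "?S \<inter> K = {}" using c z S fresh(1) dj(16,17,18) by blast
      have 4: "?S \<inter> Z = z" using c z S fresh(4) dj(20,21) by blast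
      have 5: "?S \<inter> ?W = S" using c z S fresh by blast
      have 6: "?S \<inter> measured P = S \<inter> measured P" using 5 m by blast
      have 7: "qstate P Alice (a x (dz z)) (b y) (Suc t) ?S = qstate P Alice (a x (dz z)) (b y) (Suc t) S"
        using qstate_restrict[OF P order_refl, of "a x (dz z)" "b y" ?S] unfolding 5 .
      show ?thesis
        unfolding run_ideal[OF order_refl] 1 2 3 4 6 7 by (simp add: norm_mult power_mult_distrib del: qstate.simps)
    qed
    then show "(\<Sum>S\<in>Pow ?W. ?h (?c \<union> (z \<union> S))) = of_real ((cmod (coef z))\<^sup>2) * ?g (dz z)"
      by (simp add: sum_distrib_left del: qstate.simps)
  qed
  also have "\<dots> = (\<Sum>v\<in>V. of_real (w v) * ?g v)"
    by (rule sum_coef)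
  also have "\<dots> = (\<Sum>v\<in>V. w v * incorrect_prob G Alice t P (a x v) (b y))"
    using answer incorrect_prob_eq[OF finW measured_subset[OF P]]
    by (intro sum.cong) (simp_all del: qstate.simps)
  finally show ?thesis .
qed

text \<open>For \<open>t = 1\<close> no message is sent and Alice never completes her state. Her
  completion acts outside the measured qubits and may be inserted without effect on the outcome, so
  one formula covers all \<open>t\<close>.\<close>

lemma new_error_eq:
  "incorrect_prob (single_game f) Bob (t - 1) new_protocol x y
    = (\<Sum>S\<in>Pow univ. of_bool (decode P (S \<inter> measured P) \<noteq> f x y) *
        (cmod (run P (apply_on R (VA x) (prepared \<Phi> x y)) t S))\<^sup>2)"
proof -
  let ?bad = "\<lambda>S. decode P (S \<inter> measured P) \<noteq> f x y"
  have "incorrect_prob (single_game f) Bob (t - 1) new_protocol x y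
      = (\<Sum>S\<in>Pow univ. of_bool (?bad S) * (cmod (qstate new_protocol Bob x y t S))\<^sup>2)"
    using incorrect_prob_eq[of new_protocol "single_game f" Bob "t - 1" x y] finite_univ
      order_trans[OF measured_subset[OF P], of univ] t
    by (simp add: new_all_qubits univ_def single_game_def del: qstate.simps)
  also have "\<dots> = (\<Sum>S\<in>Pow univ. of_bool (?bad S) * (cmod (run P (apply_on R (VA x) (prepared \<Phi> x y)) t S))\<^sup>2)"
  proof (cases "t = 1")
    case False
    then show ?thesis using new_qstate[of "t - 1" x y] t by (simp del: qstate.simps run.simps)
  next
    case True
    have "measured P \<subseteq> B \<union> M"
      using coinlessD(12)[OF P] held_1 True by (simp add: mover_def del: held.simps)
    then have dis: "R \<inter> measured P = {}" using R_disjoint by auto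
    have inv: "complex_of_real (\<Sum>S\<in>Pow univ. of_bool (?bad S) * (cmod (\<psi> S))\<^sup>2)
        = (\<Sum>S\<in>Pow univ. of_bool (?bad S) * (cnj (\<psi> S) * \<psi> S))" for \<psi>
      by (simp add: complex_norm_square mult.commute of_bool_def del: of_real_power) (intro sum.cong; simp)
    have "complex_of_real (\<Sum>S\<in>Pow univ. of_bool (?bad S) * (cmod (apply_on R (VA x) (run P (prepared \<Phi> x y) 1) S))\<^sup>2)
        = of_real (\<Sum>S\<in>Pow univ. of_bool (?bad S) * (cmod (run P (prepared \<Phi> x y) 1 S))\<^sup>2)"
      unfolding inv
      by (rule apply_on_ip[OF finite_univ subset_univ(3) VA(1)]) (simp add: Int_replace_outside[OF _ dis])
    then show ?thesis
      unfolding of_real_eq_iff commute_VA using True new_qstate_1[of x y] by (simp del: qstate.simps run.simps)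
  qed
  finally show ?thesis .
qed

text \<open>The actual and the ideal run apply the same unitaries to the states prepared from
  \<open>\<Phi>\<close> and from \<open>\<Psi> x\<close>, so the overlap of their final states is
  that of \<open>\<Phi>\<close> and \<open>\<Psi> x\<close>.\<close>

lemma new_error:
  "incorrect_prob (single_game f) Bob (t - 1) new_protocol x y
    \<le> (\<Sum>v\<in>V. w v * incorrect_prob G Alice t P (a x v) (b y))
      + sqrt (1 - (cmod (\<Sum>S\<in>Pow M. \<Sum>T\<in>Pow M. cnj (\<Phi> S T) * \<Psi> x S T))\<^sup>2)"
proof -
  let ?r = "run P (apply_on R (VA x) (prepared \<Phi> x y)) t" and ?i = "run P (ideal x y) t"
  let ?bad = "\<lambda>S. decode P (S \<inter> measured P) \<noteq> f x y"
  have "ip (Pow univ) ?r ?i = ip (Pow univ) (apply_on R (VA x) (prepared \<Phi> x y)) (ideal x y)"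
    by (rule ip_run) simp
  also have "\<dots> = ip (Pow univ) (prepared \<Phi> x y) (prepared (\<Psi> x) x y)"
    unfolding apply_VA[symmetric] by (rule ip_apply_on[OF finite_univ subset_univ(3) VA(1)])
  also have "\<dots> = ip (Pow univ) (start \<Phi> x y) (start (\<Psi> x) x y)"
    unfolding apply_VB[symmetric] by (rule ip_apply_on[OF finite_univ subset_univ(1) VB(1)])
  also have "\<dots> = (\<Sum>S\<in>Pow M. \<Sum>T\<in>Pow M. cnj (\<Phi> S T) * \<Psi> x S T)"
    by (rule ip_start)
  finally have ip: "ip (Pow univ) ?r ?i = (\<Sum>S\<in>Pow M. \<Sum>T\<in>Pow M. cnj (\<Phi> S T) * \<Psi> x S T)" .
  have "supported x y ?r" by (intro supported_run supported_prepared \<Phi>) simp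
  moreover have "supported x y ?i"
    unfolding apply_VA[symmetric] by (intro supported_run supported_prepared \<Psi>_norm) simp
  ultimately have "\<bar>(\<Sum>S\<in>Pow univ. of_bool (?bad S) * (cmod (?r S))\<^sup>2) - (\<Sum>S\<in>Pow univ. of_bool (?bad S) * (cmod (?i S))\<^sup>2)\<bar>
      \<le> sqrt (1 - (cmod (ip (Pow univ) ?r ?i))\<^sup>2)"
    using finite_univ by (intro outcome_difference) (auto simp: supported_def)
  then show ?thesis
    unfolding new_error_eq ideal_error ip by linarith
qed

end

section \<open>The quantum case\<close>

text \<open>Supplies concrete qubits for the locale. Inputs and completions are encoded in unary,
  with one qubit for each value.\<close>

lemma ex_quantum_round:
  fixes f :: "'x::finite \<Rightarrow> 'y::finite \<Rightarrow> 'z" and P :: "('a, 'b, 'z) qprotocol"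
    and a :: "'x \<Rightarrow> 'v \<Rightarrow> 'a" and b :: "'y \<Rightarrow> 'b" and V :: "'v set" and w :: "'v \<Rightarrow> real"
  assumes safe: "is_safe_protocol G Alice t c l P" and t: "t \<ge> 1"
    and ab: "\<And>x y v. v \<in> V \<Longrightarrow> (a x v, b y) \<in> inputs G"
    and answer: "\<And>x y v. v \<in> V \<Longrightarrow> answer G (a x v) (b y) = f x y"
    and V: "finite V" and w: "\<And>v. v \<in> V \<Longrightarrow> w v \<ge> 0" "sum w V = 1"
    and \<Phi>: "(\<Sum>S\<in>Pow (msg P 0). \<Sum>T\<in>Pow (msg P 0). (cmod (\<Phi> S T))\<^sup>2) = 1"
    and \<Psi>: "\<And>x S S'. S \<subseteq> msg P 0 \<Longrightarrow> S' \<subseteq> msg P 0 \<Longrightarrow> (\<Sum>T\<in>Pow (msg P 0). \<Psi> x S T * cnj (\<Psi> x S' T))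
      = (\<Sum>v\<in>V. of_real (w v) * density (own P Alice) (msg P 0) (alice_state P (a x v)) S S')"
  shows "\<exists>Q. is_safe_protocol (single_game f) Bob (t - 1) (c + hd l) (tl l) Q \<and>
    (\<forall>x y. incorrect_prob (single_game f) Bob (t - 1) Q x y
      \<le> (\<Sum>v\<in>V. w v * incorrect_prob G Alice t P (a x v) (b y))
        + sqrt (1 - (cmod (\<Sum>S\<in>Pow (msg P 0). \<Sum>T\<in>Pow (msg P 0). cnj (\<Phi> S T) * \<Psi> x S T))\<^sup>2))"
proof -
  have P: "is_coinless_protocol G Alice t P" using safe by (simp add: is_safe_protocol_def)
  obtain N where N: "all_qubits P \<subseteq> {..<N}"
    using finite_nat_bounded[OF finite_all_qubits[OF P]] by (auto simp: lessThan_def)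
  obtain hx :: "'x \<Rightarrow> nat" where hx: "inj hx"
    using finite_imp_inj_to_nat_seg[of "UNIV :: 'x set"] by auto
  obtain hy :: "'y \<Rightarrow> nat" where hy: "inj hy"
    using finite_imp_inj_to_nat_seg[of "UNIV :: 'y set"] by auto
  obtain hv :: "'v \<Rightarrow> nat" where hv: "inj_on hv V"
    using finite_imp_inj_to_nat_seg[OF V] by auto
  \<comment> \<open>Old qubits lie below \<open>N\<close> and the copies of the message between
    \<open>N\<close> and \<open>2 * N\<close>; the other registers start at \<open>2 * N\<close> and
    are separated by the residue of the offset modulo 3.\<close>
  define \<kappa> where "\<kappa> q = q + N" for q
  define qx where "qx x = 2 * N + 3 * hx x" for x
  define qy where "qy y = 2 * N + 3 * hy y + 1" for y
  define qv where "qv v = 2 * N + 3 * hv v + 2" for v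
  have M: "msg P 0 \<subseteq> all_qubits P"
    using coinlessD(11)[OF P, of 0] held_subset[OF P, of 0] t by (simp add: mover_def all_qubits_def) blast
  have bound: "q < N" if "q \<in> all_qubits P" for q using N that by auto
  interpret quantum_round G t P f a b V w \<Phi> \<Psi> "msg P 0" "\<kappa> ` msg P 0" "range qx" "range qy" "qv ` V" \<kappa>
    "\<lambda>x. {qx x}" "\<lambda>y. {qy y}" "\<lambda>v. {qv v}"
  proof unfold_locales
    show "inj_on \<kappa> (msg P 0)" by (simp add: \<kappa>_def inj_on_def)
    show "finite (range qx)" "finite (range qy)" "finite (qv ` V)" using V by auto
    have K: "N \<le> q \<and> q < 2 * N" if "q \<in> \<kappa> ` msg P 0" for q
      using that M bound by (fastforce simp: \<kappa>_def)
    show "all_qubits P \<inter> \<kappa> ` msg P 0 = {}" using bound K by fastforce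
    show "all_qubits P \<inter> range qx = {}" "all_qubits P \<inter> range qy = {}" "all_qubits P \<inter> qv ` V = {}"
      using bound by (fastforce simp: qx_def qy_def qv_def)+
    show "\<kappa> ` msg P 0 \<inter> range qx = {}" "\<kappa> ` msg P 0 \<inter> range qy = {}" "\<kappa> ` msg P 0 \<inter> qv ` V = {}"
      using K by (fastforce simp: qx_def qy_def qv_def)+
    have ne: "2 * N + 3 * i \<noteq> 2 * N + 3 * j + 1" "2 * N + 3 * i \<noteq> 2 * N + 3 * j + 2"
      "2 * N + 3 * i + 1 \<noteq> 2 * N + 3 * j + 2" for i j
      by presburger+
    show "range qx \<inter> range qy = {}" "range qx \<inter> qv ` V = {}" "range qy \<inter> qv ` V = {}"
      using ne by (auto simp: qx_def qy_def qv_def)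
    show "inj (\<lambda>x. {qx x})" "inj (\<lambda>y. {qy y})" "inj_on (\<lambda>v. {qv v}) V"
      using hx hy hv by (auto simp: inj_on_def qx_def qy_def qv_def)
  qed (use P t ab answer V w \<Phi> \<Psi> in auto)
  show ?thesis
    using new_is_safe[OF safe] new_error by (intro exI[of _ new_protocol]) auto
qed

text \<open>The two purifications are the square roots of the message states given \<open>u\<close>
  and given \<open>u\<close> followed by \<open>x\<close>; their overlap is the affinity that the
  increment controls.\<close>

lemma quantum_round_elimination_step:
  fixes f :: "'x::finite \<Rightarrow> 'y::finite \<Rightarrow> 'z"
  assumes safe: "is_safe_protocol (nfold_game n f) Alice t c l P" and t: "t \<ge> 1" and n: "n \<ge> 1"
    and D: "\<And>i. D i > 0" "sum D UNIV = 1"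
  defines "M \<equiv> msg P 0" and "R \<equiv> (\<lambda>xs. density (own P Alice) (msg P 0) (alice_state P xs))"
  shows "lavg (marginal D) n (\<lambda>u. negentropy (Pow M) (prefix_state (marginal D) n R u))
      - negentropy (Pow M) (prefix_state (marginal D) n R []) \<le> 2 * (real (hd l) * ln 2)"
    "length u < n \<Longrightarrow> 0 \<le> increment (marginal D) (\<lambda>u. negentropy (Pow M) (prefix_state (marginal D) n R u)) u"
    "length u < n \<Longrightarrow> \<exists>Q. is_safe_protocol (single_game f) Bob (t - 1) (c + hd l) (tl l) Q \<and>
      (\<Sum>i\<in>UNIV. D i * incorrect_prob (single_game f) Bob (t - 1) Q (fst i) (snd i))
        \<le> prefix_avg D n (incorrect_prob (nfold_game n f) Alice t P) u
          + sqrt (increment (marginal D) (\<lambda>u. negentropy (Pow M) (prefix_state (marginal D) n R u)) u)"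
proof -
  let ?G = "nfold_game n f"
  define w where "w = marginal D"
  have w: "\<And>x. w x > 0" "sum w UNIV = 1"
    using D by (simp_all add: w_def sum_marginal marginal_pos)
  define Ov where "Ov = overhead P"
  have P: "is_coinless_protocol ?G Alice t P" using safe by (simp add: is_safe_protocol_def)
  have "t > 0" using t by simp
  then have safe': "length l = t" "\<forall>k<t. card (msg P k) = (if k = 0 then l ! k + c else l ! k)"
    "overhead P \<subseteq> msg P 0" "card (overhead P) = c"
    "\<forall>(a, b)\<in>inputs ?G. \<forall>(a', b')\<in>inputs ?G.
      density (all_qubits P) Ov (qstate P Alice a b 1) = density (all_qubits P) Ov (qstate P Alice a' b' 1)"
    using safe unfolding is_safe_protocol_def Ov_def by blast+
  have len: "length l = t" and cardM: "card M = l ! 0 + c" and Ov: "Ov \<subseteq> M" "card Ov = c"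
    using safe'(1-4) \<open>t > 0\<close> by (simp_all add: M_def Ov_def)
  have indep: "density (all_qubits P) Ov (qstate P Alice a b 1) = density (all_qubits P) Ov (qstate P Alice a' b' 1)"
    if "(a, b) \<in> inputs ?G" "(a', b') \<in> inputs ?G" for a b a' b'
    using bspec[OF safe'(5) that(1)] that(2) by (simp only: prod.case) (drule (1) bspec, simp only: prod.case)
  have MA: "M \<subseteq> own P Alice"
    using coinlessD(11)[OF P, of 0] t by (simp add: M_def mover_def)
  have finA: "finite (own P Alice)" by (rule coinlessD(1)[OF P])
  have finM: "finite M" "finite Ov" "finite (M - Ov)"
    using finite_subset[OF MA finA] finite_subset[OF Ov(1)] by auto
  have cardMO: "card (M - Ov) = hd l"
    using cardM Ov finM len t by (cases l) (auto simp: card_Diff_subset)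
  have MO: "(M - Ov) \<union> Ov = M" "(M - Ov) \<inter> Ov = {}" using Ov by auto
  have inp: "(xs, (undefined, 1, take 0 xs)) \<in> inputs ?G" if "length xs = n" for xs
    using that n by (auto simp: nfold_game_def)
  have Rd: "density_mat (Pow ((M - Ov) \<union> Ov)) (R xs)" if "length xs = n" for xs
    unfolding MO R_def M_def[symmetric] using density_mat_density[OF finA MA alice_state_norm[OF P inp[OF that]]] .
  \<comment> \<open>An arbitrary reference list; by safety the overhead has the same state for all
    lists.\<close>
  define \<sigma> where "\<sigma> = density (own P Alice) Ov (alice_state P (replicate n undefined))"
  have marg: "(\<Sum>m\<in>Pow (M - Ov). R xs (m \<union> k) (m \<union> k')) = \<sigma> k k'"
    if xs: "length xs = n" and k: "k \<subseteq> Ov" "k' \<subseteq> Ov" for xs k k'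
  proof -
    have OA: "Ov \<subseteq> own P Alice" using Ov MA by blast
    have "(\<Sum>m\<in>Pow (M - Ov). R xs (m \<union> k) (m \<union> k')) = density (own P Alice) Ov (alice_state P xs) k k'"
      unfolding R_def M_def[symmetric] by (rule density_marginal[OF finA Ov(1) MA k])
    also have "density (own P Alice) Ov (alice_state P xs) = \<sigma>"
      unfolding \<sigma>_def density_qstate_1[OF P OA inp[OF xs], symmetric]
        density_qstate_1[OF P OA inp[OF length_replicate], symmetric]
      by (rule indep[OF inp[OF xs] inp[OF length_replicate]])
    finally show ?thesis .
  qed
  note ctx = w finM(3,2) MO(2) Rd marg
  let ?\<rho> = "prefix_state w n R"
  have dens: "density_mat (Pow M) (?\<rho> u)" if "length u \<le> n" for u
    using density_mat_prefix_state[OF ctx that] unfolding MO .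
  have incr: "(\<Sum>x\<in>UNIV. w x * (1 - (cmod (affinity (Pow M) (?\<rho> (u @ [x])) (?\<rho> u)))\<^sup>2))
      \<le> increment w (\<lambda>u. negentropy (Pow M) (?\<rho> u)) u" if "length u < n" for u
    using increment_negentropy_ge[OF ctx that] unfolding MO .
  show "lavg (marginal D) n (\<lambda>u. negentropy (Pow M) (prefix_state (marginal D) n R u))
      - negentropy (Pow M) (prefix_state (marginal D) n R []) \<le> 2 * (real (hd l) * ln 2)"
    using negentropy_total[OF ctx] unfolding MO cardMO w_def .
  have aff: "0 \<le> 1 - (cmod (affinity (Pow M) (?\<rho> (u @ [x])) (?\<rho> u)))\<^sup>2" if "length u < n" for u x
    using affinity_le_1[of "Pow M" "?\<rho> (u @ [x])" "?\<rho> u"] dens that finM by simp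
  show "0 \<le> increment (marginal D) (\<lambda>u. negentropy (Pow M) (prefix_state (marginal D) n R u)) u" if u: "length u < n"
  proof -
    have "0 \<le> (\<Sum>x\<in>UNIV. w x * (1 - (cmod (affinity (Pow M) (?\<rho> (u @ [x])) (?\<rho> u)))\<^sup>2))"
      by (intro sum_nonneg mult_nonneg_nonneg aff[OF u] less_imp_le[OF w(1)])
    then show ?thesis using incr[OF u] unfolding w_def by linarith
  qed
  show "\<exists>Q. is_safe_protocol (single_game f) Bob (t - 1) (c + hd l) (tl l) Q \<and>
      (\<Sum>i\<in>UNIV. D i * incorrect_prob (single_game f) Bob (t - 1) Q (fst i) (snd i))
        \<le> prefix_avg D n (incorrect_prob (nfold_game n f) Alice t P) u
          + sqrt (increment (marginal D) (\<lambda>u. negentropy (Pow M) (prefix_state (marginal D) n R u)) u)"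
    if u: "length u < n"
  proof -
    let ?V = "{v :: 'x list. length v = n - Suc (length u)}"
    let ?inc = "\<lambda>x y v. incorrect_prob ?G Alice t P (u @ x # v) (y, Suc (length u), u)"
    let ?aff = "\<lambda>x. \<Sum>S\<in>Pow M. \<Sum>T\<in>Pow M. cnj (sqrt_mat (Pow M) (?\<rho> u) S T) * sqrt_mat (Pow M) (?\<rho> (u @ [x])) S T"
    have "\<exists>Q. is_safe_protocol (single_game f) Bob (t - 1) (c + hd l) (tl l) Q \<and>
      (\<forall>x y. incorrect_prob (single_game f) Bob (t - 1) Q x y
        \<le> (\<Sum>v\<in>?V. prod_list (map w v) * ?inc x y v) + sqrt (1 - (cmod (?aff x))\<^sup>2))"
      unfolding M_def
    proof (rule ex_quantum_round[OF safe t])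
      show "(u @ x # v, (y, Suc (length u), u)) \<in> inputs ?G" if "v \<in> ?V" for x y v
        using that u by (intro nfold_inputs_prefix) auto
      show "answer ?G (u @ x # v) (y, Suc (length u), u) = f x y" for x y v
        by (simp add: nfold_game_def)
      show "prod_list (map w v) \<ge> 0" for v
        by (rule prod_list_map_nonneg) (simp add: w less_imp_le)
      show "(\<Sum>v\<in>?V. prod_list (map w v)) = 1"
        using lavg_const[OF w(2), of "n - Suc (length u)" 1] by (simp add: lavg_def)
      show "(\<Sum>S\<in>Pow (msg P 0). \<Sum>T\<in>Pow (msg P 0). (cmod (sqrt_mat (Pow (msg P 0)) (?\<rho> u) S T))\<^sup>2) = 1"
        using sqrt_mat_norm[OF _ dens[of u]] u finM(1) by (simp add: M_def)
      fix x S S' assume S: "S \<subseteq> msg P 0" "S' \<subseteq> msg P 0"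
      have "(\<Sum>T\<in>Pow (msg P 0). sqrt_mat (Pow (msg P 0)) (?\<rho> (u @ [x])) S T * cnj (sqrt_mat (Pow (msg P 0)) (?\<rho> (u @ [x])) S' T))
          = ?\<rho> (u @ [x]) S S'"
        using sqrt_mat_gram[OF _ dens[of "u @ [x]"]] u finM(1) S by (simp add: M_def)
      then show "(\<Sum>T\<in>Pow (msg P 0). sqrt_mat (Pow (msg P 0)) (?\<rho> (u @ [x])) S T * cnj (sqrt_mat (Pow (msg P 0)) (?\<rho> (u @ [x])) S' T))
          = (\<Sum>v\<in>?V. of_real (prod_list (map w v)) * density (own P Alice) (msg P 0) (alice_state P (u @ x # v)) S S')"
        by (simp add: prefix_state_def R_def)
    qed simp
    then obtain Q where Q: "is_safe_protocol (single_game f) Bob (t - 1) (c + hd l) (tl l) Q"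
      and err: "\<And>x y. incorrect_prob (single_game f) Bob (t - 1) Q x y
        \<le> (\<Sum>v\<in>?V. prod_list (map w v) * ?inc x y v) + sqrt (1 - (cmod (?aff x))\<^sup>2)"
      by blast
    have aff': "cmod (?aff x) = cmod (affinity (Pow M) (?\<rho> (u @ [x])) (?\<rho> u))" for x
    proof -
      have "?aff x = cnj (affinity (Pow M) (?\<rho> (u @ [x])) (?\<rho> u))"
        by (simp add: affinity_def mult.commute)
      then show ?thesis by (simp only: complex_mod_cnj)
    qed
    let ?s = "\<lambda>x. 1 - (cmod (affinity (Pow M) (?\<rho> (u @ [x])) (?\<rho> u)))\<^sup>2"
    have "(\<Sum>i\<in>UNIV. D i * incorrect_prob (single_game f) Bob (t - 1) Q (fst i) (snd i))
        \<le> (\<Sum>i\<in>UNIV. D i * ((\<Sum>v\<in>?V. prod_list (map w v) * ?inc (fst i) (snd i) v) + sqrt (?s (fst i))))"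
      using D err unfolding aff' by (intro sum_mono mult_left_mono) (auto simp: less_imp_le)
    also have "\<dots> = prefix_avg D n (incorrect_prob ?G Alice t P) u + (\<Sum>i\<in>UNIV. D i * sqrt (?s (fst i)))"
      unfolding prefix_avg_def lavg_def w_def case_prod_unfold distrib_left sum.distrib by (simp only: prod.collapse)
    also have "(\<Sum>i\<in>UNIV. D i * sqrt (?s (fst i))) = (\<Sum>x\<in>UNIV. w x * sqrt (?s x))"
      unfolding w_def marginal_def sum_distrib_right by (simp add: sum.cartesian_product case_prod_unfold)
    also have "\<dots> \<le> sqrt (\<Sum>x\<in>UNIV. w x * ?s x)"
      using w aff[OF u] by (intro sum_weighted_sqrt_le) (auto simp: less_imp_le)
    also have "\<dots> \<le> sqrt (increment w (\<lambda>u. negentropy (Pow M) (?\<rho> u)) u)"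
      by (intro real_sqrt_le_mono incr u)
    finally show ?thesis using Q unfolding w_def by auto
  qed
qed

lemma incorrect_prob_nonneg: "incorrect_prob G s t P a b \<ge> 0"
  unfolding incorrect_prob_def outcome_prob_def by (intro sum_nonneg) auto

lemma quantum_round_elimination:
  fixes f :: "'x::finite \<Rightarrow> 'y::finite \<Rightarrow> 'z"
  assumes n: "n \<ge> 1" and t: "t \<ge> 1" and \<delta>: "\<delta> > 0"
    and p: "is_safe_public_coin_protocol (nfold_game n f) Alice t c l p"
    and err: "quantum_error (nfold_game n f) Alice t p < \<delta>"
  shows "\<exists>q. is_safe_public_coin_protocol (single_game f) Bob (t - 1) (c + hd l) (tl l) q \<and>
    quantum_error (single_game f) Bob (t - 1) q < \<delta> + 1 / 2 * sqrt (8 * real (hd l) * ln 2 / real n)"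
proof -
  define \<delta>0 where "\<delta>0 = quantum_error (nfold_game n f) Alice t p"
  define L where "L = 2 * (real (hd l) * ln 2)"
  let ?\<epsilon> = "\<delta> + 1 / 2 * sqrt (8 * real (hd l) * ln 2 / real n)"
  let ?S = "{Q :: ('x, 'y, 'z) qprotocol. is_safe_protocol (single_game f) Bob (t - 1) (c + hd l) (tl l) Q}"
  have finp: "finite (set_pmf p)" and safe: "\<And>P. P \<in> set_pmf p \<Longrightarrow> is_safe_protocol (nfold_game n f) Alice t c l P"
    using p by (auto simp: is_safe_public_coin_protocol_def)
  \<comment> \<open>The factor 8 is 4 times the 2 in the information bound \<open>L\<close>, and the
    4 cancels the square of 1/2.\<close>
  have eq: "1 / 2 * sqrt (8 * real (hd l) * ln 2 / real n) = sqrt (1 * L / n)"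
  proof -
    have "1 * L / n = (1 / 2)\<^sup>2 * (8 * real (hd l) * ln 2 / real n)"
      by (simp add: L_def power2_eq_square)
    then show ?thesis by (simp only: real_sqrt_mult real_sqrt_abs)
  qed
  have "\<exists>q. finite (set_pmf q) \<and> set_pmf q \<subseteq> ?S \<and>
    (\<forall>i. measure_pmf.expectation q (\<lambda>Q. incorrect_prob (single_game f) Bob (t - 1) Q (fst i) (snd i)) < ?\<epsilon>)"
  proof (rule round_elimination_core[where f = f and L = L and C = 1 and \<delta> = \<delta>0
        and e = "incorrect_prob (nfold_game n f) Alice t", OF finp n])
    fix a b assume ab: "(a, b) \<in> inputs (nfold_game n f)"
    have "measure_pmf.expectation p (\<lambda>P. incorrect_prob (nfold_game n f) Alice t P a b) \<le> \<delta>0"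
      unfolding \<delta>0_def quantum_error_def
      using ab finite_nfold_inputs[of n f] by (intro Max_ge) (auto intro!: image_eqI[of _ _ "(a, b)"])
    then show "(\<Sum>P\<in>set_pmf p. pmf p P * incorrect_prob (nfold_game n f) Alice t P a b) \<le> \<delta>0"
      by (simp add: expectation_finite_pmf[OF finp])
  next
    show "\<delta>0 + sqrt (1 * L / n) < ?\<epsilon>"
      using err by (simp only: eq \<delta>0_def)
    have "L / n \<ge> 0" by (simp add: L_def)
    then have "sqrt (1 * L / n) \<ge> 0" by simp
    then show "0 < ?\<epsilon>"
      unfolding eq using \<delta> by linarith
  next
    fix P and D :: "'x \<times> 'y \<Rightarrow> real"
    assume P: "P \<in> set_pmf p" and D: "\<And>i. D i > 0" "sum D UNIV = 1"
    note step = quantum_round_elimination_step[OF safe[OF P] t n D]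
    let ?\<Phi> = "\<lambda>u. negentropy (Pow (msg P 0)) (prefix_state (marginal D) n
      (\<lambda>xs. density (own P Alice) (msg P 0) (alice_state P xs)) u)"
    show "\<exists>\<Phi>. lavg (marginal D) n \<Phi> - \<Phi> [] \<le> L \<and>
        (\<forall>u. length u < n \<longrightarrow> 0 \<le> increment (marginal D) \<Phi> u \<and>
          (\<exists>Q\<in>?S. (\<Sum>i\<in>UNIV. D i * incorrect_prob (single_game f) Bob (t - 1) Q (fst i) (snd i))
             \<le> prefix_avg D n (incorrect_prob (nfold_game n f) Alice t P) u
               + sqrt (1 * increment (marginal D) \<Phi> u)))"
    proof (intro exI[of _ ?\<Phi>] conjI allI impI)
      show "lavg (marginal D) n ?\<Phi> - ?\<Phi> [] \<le> L"
        using step(1) unfolding L_def .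
      fix u :: "'x list" assume u: "length u < n"
      show "0 \<le> increment (marginal D) ?\<Phi> u" by (rule step(2)[OF u])
      show "\<exists>Q\<in>?S. (\<Sum>i\<in>UNIV. D i * incorrect_prob (single_game f) Bob (t - 1) Q (fst i) (snd i))
             \<le> prefix_avg D n (incorrect_prob (nfold_game n f) Alice t P) u
               + sqrt (1 * increment (marginal D) ?\<Phi> u)"
        using step(3)[OF u] by (simp only: mult_1 bex_simps mem_Collect_eq Bex_def)
    qed
  qed (simp_all add: incorrect_prob_nonneg)
  then obtain q where q: "finite (set_pmf q)" "set_pmf q \<subseteq> ?S"
    "\<And>x y. measure_pmf.expectation q (\<lambda>Q. incorrect_prob (single_game f) Bob (t - 1) Q x y) < ?\<epsilon>"
    by auto
  have "inputs (single_game f) = UNIV" by (simp add: single_game_def)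
  then have "quantum_error (single_game f) Bob (t - 1) q < ?\<epsilon>"
    unfolding quantum_error_def using q(3) by (subst Max_less_iff) auto
  then show ?thesis
    using q by (auto simp: is_safe_public_coin_protocol_def)
qed

theorem mainTheorem2:
  fixes f :: "'x::finite \<Rightarrow> 'y::finite \<Rightarrow> 'z"
    and n t c :: nat and l :: "nat list" and \<delta> :: real
  assumes "n \<ge> 1" and "t \<ge> 1" and "\<delta> > 0" and "length l = t"
  shows "((\<exists>p. is_public_coin_protocol (nfold_game n f) Alice t l p \<and>
              public_coin_error (nfold_game n f) Alice t p < \<delta>) \<longrightarrow>
         (\<exists>q. is_public_coin_protocol (single_game f) Bob (t - 1) (tl l) q \<and>
              public_coin_error (single_game f) Bob (t - 1) q
                < \<delta> + 1 / 2 * sqrt (2 * real (hd l) * ln 2 / real n))) \<and>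
         ((\<exists>p. is_safe_public_coin_protocol (nfold_game n f) Alice t c l p \<and>
              quantum_error (nfold_game n f) Alice t p < \<delta>) \<longrightarrow>
         (\<exists>q. is_safe_public_coin_protocol (single_game f) Bob (t - 1) (c + hd l) (tl l) q \<and>
              quantum_error (single_game f) Bob (t - 1) q
                < \<delta> + 1 / 2 * sqrt (8 * real (hd l) * ln 2 / real n)))"
  using classical_round_elimination[OF assms] quantum_round_elimination[OF assms(1-3)] by blast

end
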